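(* Let $N\ge1$ be an integer, fix $i\in\{1,2,3\}$, and use the notation of the context. Let $$\hat A_N^{(i)}=\langle\Omega_i\Upsilon_N^{o,i},(\Upsilon_N^{e,i})^T\rangle,\qquad \tilde M=2\int_{\Omega_i\ge0}\Upsilon_N^{o,i}(\Upsilon_N^{e,i})^T\,d\Omega,\qquad L_N^{(i)}=2\int_{\Omega_i\ge0}\frac1{\Omega_i}\Upsilon_N^{o,i}(\Upsilon_N^{o,i})^T\,d\Omega .$$ Then: (1) With the components of $\Upsilon_N$ ordered as $(\Upsilon_N^{o,i},\Upsilon_N^{e,i})$, the matrix $A_N^{(i)}=\langle\Omega_i\Upsilon_N,\Upsilon_N^T\rangle$ equals $\begin{pmatrix}0&\hat A_N^{(i)}\\(\hat A_N^{(i)})^T&0\end{pmatrix}$, and $\hat A_N^{(i)}$ has full row rank. (2) $L_N^{(i)}$ is well defined (its entries are finite), symmetric, positive definite, and hence invertible; and $L_N^{(i)}\hat A_N^{(i)}$ differs from $\tilde M$ only in the columns corresponding to the even spherical harmonics of highest degree $l=N$. (3) Consequently, the $P_N$ equations with the boundary conditions $$u^{o,n}=L_N^{(i)}\hat A_N^{(i)}\,u^{e,n}+g,\qquad g=2\int_{\Omega\cdot n<0}\psi_{\rm in}\,\Upsilon_N^{o,n}\,d\Omega\qquad\text{on }\partial G$$ satisfy an energy bound for general boundary data: for a bounded domain $G\subset\mathbb{R}^3$ with boundary regular enough for the divergence theorem and outward unit normal $n$, every (sufficiently regular, classical up to the boundary) solution $u$ with initial datum $u_0$ satisfies, for all $T>0$,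 $$\|u(T,\cdot)\|^2_{L^2(G)}\le\|u_0\|^2_{L^2(G)}+\big\|(L_N^{(i)})^{-1}\big\|_2\,\|g\|^2_{L^2((0,T)\times\partial G)} .$$
   Context: Real spherical harmonics $Y_l^k:\mathbb{S}^2\to\mathbb{R}$, $l\in\mathbb{N}_0$, $|k|\le l$: the orthonormal basis of $L^2(\mathbb{S}^2;\mathbb{R})$ given by $Y_l^k=C_{l,|k|}P_l^{|k|}(\mu)\cdot\{\cos(|k|\varphi)\ (k>0),\ 1/\sqrt2\ (k=0),\ \sin(|k|\varphi)\ (k<0)\}$, where $C_{l,|k|}=(-1)^{|k|}\sqrt{\frac{2l+1}{2\pi}\frac{(l-|k|)!}{(l+|k|)!}}$, $P_l^{|k|}$ are the associated Legendre functions, $\mu=\Omega_3$ and $\varphi$ is the azimuthal angle of $\Omega$. A function $f$ on $\mathbb{S}^2$ is even/odd in direction $n\in\mathbb{S}^2$ if $f(\Omega-2(n\cdot\Omega)n)=\pm f(\Omega)$ for all $\Omega$. Each $Y_l^k$ is either even or odd in each Cartesian direction $e_i$. $\Upsilon_N$ is the vector of all $Y_l^k$ with $l\le N$; $\Upsilon_N^{o,i}$ and $\Upsilon_N^{e,i}$ are the vectors of those that are odd, respectively even, in direction $e_i$ (of lengths $N(N+1)/2$ and $(N+1)(N+2)/2$). $\langle v,w^T\rangle$ is the matrix with entries $\int_{\mathbb{S}^2}v_jw_k\,d\Omega$. $P_N$ equations: for $u(t,x)\in\mathbb{R}^{(N+1)^2}$, with $\psi_{P_N}(t,x,\Omega)=u(t,x)^T\Upsilon_N(\Omega)$,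 $$\partial_tu+\sum_{j=1}^3A_N^{(j)}\partial_{x_j}u=\langle\mathcal Q\Upsilon_N,\Upsilon_N^T\rangle u,$$ where $\mathcal Q\psi(\Omega)=\int_{\mathbb{S}^2}\sigma_s(x,\Omega'\cdot\Omega)\psi(\Omega')\,d\Omega'-\sigma_t(x)\psi(\Omega)$ acts componentwise, $\sigma_s\ge0$ is the scattering cross-section, and $\sigma_t(x)=\int_{\mathbb{S}^2}\sigma_s(x,\Omega'\cdot\Omega)\,d\Omega'$ is the corresponding total cross-section. General normals: for a unit vector $n$ choose a rotation $R$ with $Rn=e_i$ and set $\Upsilon_N^{o,n}(\Omega)=\Upsilon_N^{o,i}(R\Omega)$, $\Upsilon_N^{e,n}(\Omega)=\Upsilon_N^{e,i}(R\Omega)$; the coefficients $u^{o,n},u^{e,n}$ are defined by $\psi_{P_N}=(\Upsilon_N^{o,n})^Tu^{o,n}+(\Upsilon_N^{e,n})^Tu^{e,n}$. The given incoming distribution is $\psi_{\rm in}(t,x,\Omega)$, defined for $x\in\partial G$, $\Omega\cdot n<0$. For vector-valued $v$, $\|v\|^2_{L^2(D)}=\int_Dv^Tv$; $\|\cdot\|_2$ is the spectral norm of matrices. *)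

theory Defs
  imports
    "HOL-Analysis.Analysis"
    "HOL-Computational_Algebra.Polynomial"
    "Jordan_Normal_Form.Gauss_Jordan_Elimination"
    "Jordan_Normal_Form.DL_Rank"
begin

text \<open>
  Points and directions live in the type \<open>real ^ 3\<close>; objects whose size depends on \<open>N\<close> are
  vectors and matrices of Jordan-Normal-Form. In this theory the infix \<open>$\<close> selects a
  coordinate in \<open>real ^ 3\<close> and the infix bullet is the Euclidean inner product.
\<close>

no_notation Matrix.vec_index (infixl \<open>$\<close> 100)
no_notation Matrix.scalar_prod (infix \<open>\<bullet>\<close> 70)

text \<open>
  Rodrigues' formula for the Legendre polynomials. The associated Legendre functions carry the
  Condon-Shortley phase \<open>(-1)^m\<close>, which the factor \<open>(-1)^m\<close> of the normalisation constant
  cancels.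
\<close>

definition legendre_poly :: "nat \<Rightarrow> real poly" where
  "legendre_poly l = Polynomial.smult (1 / (2 ^ l * fact l)) ((pderiv ^^ l) ([:-1, 0, 1:] ^ l))"

definition assoc_legendre :: "nat \<Rightarrow> nat \<Rightarrow> real \<Rightarrow> real" where
  "assoc_legendre l m \<mu> = (-1) ^ m * sqrt (1 - \<mu>\<^sup>2) ^ m * poly ((pderiv ^^ m) (legendre_poly l)) \<mu>"

definition sph_const :: "nat \<Rightarrow> nat \<Rightarrow> real" where
  "sph_const l m = (-1) ^ m * sqrt ((2 * real l + 1) / (2 * pi) * (fact (l - m) / fact (l + m)))"

definition azimuth :: "real ^ 3 \<Rightarrow> real" where
  "azimuth \<Omega> = Arg (Complex (\<Omega> $ 1) (\<Omega> $ 2))"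

definition sph_harm :: "nat \<times> int \<Rightarrow> real ^ 3 \<Rightarrow> real" where
  "sph_harm = (\<lambda>(l, k) \<Omega>. sph_const l (nat \<bar>k\<bar>) * assoc_legendre l (nat \<bar>k\<bar>) (\<Omega> $ 3) *
     (if k > 0 then cos (\<bar>k\<bar> * azimuth \<Omega>)
      else if k = 0 then 1 / sqrt 2
      else sin (\<bar>k\<bar> * azimuth \<Omega>)))"

definition reflect_dir :: "real ^ 3 \<Rightarrow> real ^ 3 \<Rightarrow> real ^ 3" where
  "reflect_dir n \<Omega> = \<Omega> - (2 * (n \<bullet> \<Omega>)) *\<^sub>R n"

definition even_dir :: "real ^ 3 \<Rightarrow> (real ^ 3 \<Rightarrow> real) \<Rightarrow> bool" where
  "even_dir n f \<longleftrightarrow> (\<forall>\<Omega>\<in>sphere 0 1. f (reflect_dir n \<Omega>) = f \<Omega>)"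

definition odd_dir :: "real ^ 3 \<Rightarrow> (real ^ 3 \<Rightarrow> real) \<Rightarrow> bool" where
  "odd_dir n f \<longleftrightarrow> (\<forall>\<Omega>\<in>sphere 0 1. f (reflect_dir n \<Omega>) = - f \<Omega>)"

definition sph_idx :: "nat \<Rightarrow> (nat \<times> int) list" where
  "sph_idx N = concat (map (\<lambda>l. map (Pair l) [- int l..int l]) [0..<Suc N])"

definition odd_idx :: "nat \<Rightarrow> 3 \<Rightarrow> (nat \<times> int) list" where
  "odd_idx N i = filter (\<lambda>p. odd_dir (axis i 1) (sph_harm p)) (sph_idx N)"

definition even_idx :: "nat \<Rightarrow> 3 \<Rightarrow> (nat \<times> int) list" where
  "even_idx N i = filter (\<lambda>p. even_dir (axis i 1) (sph_harm p)) (sph_idx N)"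

definition Ups :: "nat \<Rightarrow> (real ^ 3 \<Rightarrow> real) list" where
  "Ups N = map sph_harm (sph_idx N)"

definition Ups_odd :: "nat \<Rightarrow> 3 \<Rightarrow> (real ^ 3 \<Rightarrow> real) list" where
  "Ups_odd N i = map sph_harm (odd_idx N i)"

definition Ups_even :: "nat \<Rightarrow> 3 \<Rightarrow> (real ^ 3 \<Rightarrow> real) list" where
  "Ups_even N i = map sph_harm (even_idx N i)"

text \<open>
  The surface measure of the unit sphere as cone measure: the measure of \<open>A\<close> is three times the
  volume of the part of the unit ball that projects radially onto \<open>A\<close> (total mass \<open>4 * pi\<close>).
  It is a Borel measure on \<open>real ^ 3\<close> concentrated on \<open>sphere 0 1\<close>.
\<close>

definition sphere_measure :: "(real ^ 3) measure" where
  "sphere_measure = scale_measure 3 (distr (restrict_space lborel (cball 0 1 - {0})) borel sgn)"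

text \<open>The matrix of all integrals of products \<open>v_r w_c\<close> over the part \<open>D\<close> of the sphere.\<close>

definition moment_mat ::
    "(real ^ 3) set \<Rightarrow> (real ^ 3 \<Rightarrow> real) list \<Rightarrow> (real ^ 3 \<Rightarrow> real) list \<Rightarrow> real mat" where
  "moment_mat D v w = Matrix.mat (length v) (length w)
     (\<lambda>(r, c). LINT \<Omega>:D|sphere_measure. (v ! r) \<Omega> * (w ! c) \<Omega>)"

definition omega_times :: "3 \<Rightarrow> (real ^ 3 \<Rightarrow> real) list \<Rightarrow> (real ^ 3 \<Rightarrow> real) list" where
  "omega_times i v = map (\<lambda>f \<Omega>. \<Omega> $ i * f \<Omega>) v"

definition omega_divide :: "3 \<Rightarrow> (real ^ 3 \<Rightarrow> real) list \<Rightarrow> (real ^ 3 \<Rightarrow> real) list" where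
  "omega_divide i v = map (\<lambda>f \<Omega>. 1 / \<Omega> $ i * f \<Omega>) v"

definition A_mat :: "nat \<Rightarrow> 3 \<Rightarrow> real mat" where
  "A_mat N j = moment_mat (sphere 0 1) (omega_times j (Ups N)) (Ups N)"

definition A_hat :: "nat \<Rightarrow> 3 \<Rightarrow> real mat" where
  "A_hat N i = moment_mat (sphere 0 1) (omega_times i (Ups_odd N i)) (Ups_even N i)"

definition half_sphere :: "3 \<Rightarrow> (real ^ 3) set" where
  "half_sphere i = {\<Omega> \<in> sphere 0 1. \<Omega> $ i \<ge> 0}"

definition M_tilde :: "nat \<Rightarrow> 3 \<Rightarrow> real mat" where
  "M_tilde N i = 2 \<cdot>\<^sub>m moment_mat (half_sphere i) (Ups_odd N i) (Ups_even N i)"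

definition L_mat :: "nat \<Rightarrow> 3 \<Rightarrow> real mat" where
  "L_mat N i = 2 \<cdot>\<^sub>m moment_mat (half_sphere i) (omega_divide i (Ups_odd N i)) (Ups_odd N i)"

definition pos_def_mat :: "real mat \<Rightarrow> bool" where
  "pos_def_mat A \<longleftrightarrow> square_mat A \<and>
     (\<forall>v\<in>carrier_vec (dim_col A). v \<noteq> 0\<^sub>v (dim_col A) \<longrightarrow> scalar_prod v (A *\<^sub>v v) > 0)"

definition vec_norm2 :: "real Matrix.vec \<Rightarrow> real" where
  "vec_norm2 v = sqrt (scalar_prod v v)"

text \<open>The analogue of \<^const>\<open>onorm\<close> for matrices with the Euclidean vector norm.\<close>

definition spectral_norm :: "real mat \<Rightarrow> real" where
  "spectral_norm A = (SUP v\<in>carrier_vec (dim_col A). vec_norm2 (A *\<^sub>v v) / vec_norm2 v)"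

text \<open>
  Squared L2 norm of a vector-valued function, in the extended nonnegative reals, so that
  a function that is not square integrable has norm infinity.
\<close>

definition L2_norm_sq :: "'a measure \<Rightarrow> ('a \<Rightarrow> real Matrix.vec) \<Rightarrow> ennreal" where
  "L2_norm_sq M v = (\<integral>\<^sup>+z. ennreal (scalar_prod (v z) (v z)) \<partial>M)"

text \<open>Two-dimensional Hausdorff measure on \<open>real ^ 3\<close>, normalised to agree with area.\<close>

definition hausdorff2_outer :: "(real ^ 3) set \<Rightarrow> ennreal" where
  "hausdorff2_outer A = (SUP \<delta>\<in>{0<..}.
     INF C\<in>{C :: nat \<Rightarrow> (real ^ 3) set. A \<subseteq> (\<Union>k. C k) \<and> (\<forall>k. bounded (C k) \<and> diameter (C k) \<le> \<delta>)}.
       (\<Sum>k. ennreal (pi / 4 * (diameter (C k))\<^sup>2)))"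

definition boundary_measure :: "(real ^ 3) set \<Rightarrow> (real ^ 3) measure" where
  "boundary_measure G =
     restrict_space (measure_of UNIV (sets borel) hausdorff2_outer) (frontier G)"

definition C1_up_to ::
    "'a::real_normed_vector set \<Rightarrow> 'a set \<Rightarrow> ('a \<Rightarrow> 'b::real_normed_vector) \<Rightarrow> bool" where
  "C1_up_to S S' f \<longleftrightarrow> continuous_on S' f \<and>
     (\<exists>f'. (\<forall>z\<in>S. (f has_derivative blinfun_apply (f' z)) (at z)) \<and> continuous_on S' f')"

definition divergence :: "(real ^ 3 \<Rightarrow> real ^ 3) \<Rightarrow> real ^ 3 \<Rightarrow> real" where
  "divergence F x = (\<Sum>j\<in>UNIV. frechet_derivative F (at x) (axis j 1) $ j)"

text \<open>
  A bounded domain with finite boundary area for which the divergence theorem holds with the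
  unit normal field \<open>n\<close>. The identity determines \<open>n\<close> up to null sets of the boundary and fixes
  its sign to be outward; the normal may be undefined on a null set (edges and corners).
\<close>

definition divergence_domain :: "(real ^ 3) set \<Rightarrow> (real ^ 3 \<Rightarrow> real ^ 3) \<Rightarrow> bool" where
  "divergence_domain G n \<longleftrightarrow>
     open G \<and> connected G \<and> bounded G \<and> G \<noteq> {} \<and>
     finite_measure (boundary_measure G) \<and>
     n \<in> borel_measurable (boundary_measure G) \<and>
     (AE x in boundary_measure G. norm (n x) = 1) \<and>
     (\<forall>F :: real ^ 3 \<Rightarrow> real ^ 3. C1_up_to G (closure G) F \<longrightarrow>
        (LINT x:G|lborel. divergence F x) = (LINT x|boundary_measure G. F x \<bullet> n x))"

text \<open>By rotation invariance this does not depend on the unit vector \<open>\<Omega>\<close>.\<close>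

definition total_cross_section :: "(real ^ 3 \<Rightarrow> real \<Rightarrow> real) \<Rightarrow> real ^ 3 \<Rightarrow> real ^ 3 \<Rightarrow> real" where
  "total_cross_section \<sigma>s x \<Omega> = (LINT \<Omega>':sphere 0 1|sphere_measure. \<sigma>s x (\<Omega>' \<bullet> \<Omega>))"

definition collision ::
    "(real ^ 3 \<Rightarrow> real \<Rightarrow> real) \<Rightarrow> real ^ 3 \<Rightarrow> (real ^ 3 \<Rightarrow> real) \<Rightarrow> real ^ 3 \<Rightarrow> real" where
  "collision \<sigma>s x \<psi> \<Omega> =
     (LINT \<Omega>':sphere 0 1|sphere_measure. \<sigma>s x (\<Omega>' \<bullet> \<Omega>) * \<psi> \<Omega>') - total_cross_section \<sigma>s x \<Omega> * \<psi> \<Omega>"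

definition collision_mat :: "nat \<Rightarrow> (real ^ 3 \<Rightarrow> real \<Rightarrow> real) \<Rightarrow> real ^ 3 \<Rightarrow> real mat" where
  "collision_mat N \<sigma>s x = moment_mat (sphere 0 1) (map (collision \<sigma>s x) (Ups N)) (Ups N)"

definition scattering_cross_section :: "(real ^ 3) set \<Rightarrow> (real ^ 3 \<Rightarrow> real \<Rightarrow> real) \<Rightarrow> bool" where
  "scattering_cross_section G \<sigma>s \<longleftrightarrow>
     (\<forall>x\<in>G. (\<forall>\<mu>\<in>{-1..1}. \<sigma>s x \<mu> \<ge> 0) \<and> set_borel_measurable borel {-1..1} (\<sigma>s x) \<and>
        (\<forall>\<Omega>\<in>sphere 0 1. set_integrable sphere_measure (sphere 0 1) (\<lambda>\<Omega>'. \<sigma>s x (\<Omega>' \<bullet> \<Omega>))))"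

definition PN_solution ::
    "nat \<Rightarrow> (real ^ 3 \<Rightarrow> real \<Rightarrow> real) \<Rightarrow> (real ^ 3) set \<Rightarrow> (real ^ 3 \<Rightarrow> real Matrix.vec)
      \<Rightarrow> (real \<Rightarrow> real ^ 3 \<Rightarrow> real Matrix.vec) \<Rightarrow> bool" where
  "PN_solution N \<sigma>s G u0 u \<longleftrightarrow>
     (\<forall>t\<ge>0. \<forall>x\<in>closure G. u t x \<in> carrier_vec ((N + 1)\<^sup>2)) \<and>
     (\<forall>r<(N + 1)\<^sup>2.
        continuous_on ({0..} \<times> closure G) (\<lambda>(t, x). vec_index (u t x) r) \<and>
        C1_up_to ({0<..} \<times> G) ({0<..} \<times> closure G) (\<lambda>(t, x). vec_index (u t x) r)) \<and>
     (\<forall>t>0. \<forall>x\<in>G. \<forall>r<(N + 1)\<^sup>2.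
        deriv (\<lambda>s. vec_index (u s x) r) t +
        (\<Sum>j\<in>UNIV. vec_index (A_mat N j *\<^sub>v
           Matrix.vec ((N + 1)\<^sup>2) (\<lambda>c. deriv (\<lambda>h. vec_index (u t (x + h *\<^sub>R axis j 1)) c) 0)) r)
        = vec_index (collision_mat N \<sigma>s x *\<^sub>v u t x) r) \<and>
     (\<forall>x\<in>G. u 0 x = u0 x)"

definition lin_comb :: "real Matrix.vec \<Rightarrow> (real ^ 3 \<Rightarrow> real) list \<Rightarrow> real ^ 3 \<Rightarrow> real" where
  "lin_comb a v \<Omega> = (\<Sum>r<length v. vec_index a r * (v ! r) \<Omega>)"

definition rotate_fun :: "real ^ 3 ^ 3 \<Rightarrow> (real ^ 3 \<Rightarrow> real) list \<Rightarrow> (real ^ 3 \<Rightarrow> real) list" where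
  "rotate_fun Q v = map (\<lambda>f \<Omega>. f (Q *v \<Omega>)) v"

text \<open>\<open>R\<close> is the chosen family of rotations, \<open>R m\<close> taking the unit vector \<open>m\<close> to \<open>e_i\<close>.\<close>

definition rotation_choice :: "3 \<Rightarrow> (real ^ 3 \<Rightarrow> real ^ 3 ^ 3) \<Rightarrow> bool" where
  "rotation_choice i R \<longleftrightarrow>
     (\<forall>m. norm m = 1 \<longrightarrow> rotation_matrix (R m) \<and> R m *v m = axis i 1)"

definition boundary_data ::
    "nat \<Rightarrow> 3 \<Rightarrow> (real ^ 3 \<Rightarrow> real ^ 3 ^ 3) \<Rightarrow> (real ^ 3 \<Rightarrow> real ^ 3)
      \<Rightarrow> (real \<Rightarrow> real ^ 3 \<Rightarrow> real ^ 3 \<Rightarrow> real) \<Rightarrow> real \<Rightarrow> real ^ 3 \<Rightarrow> real Matrix.vec" where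
  "boundary_data N i R n \<psi>in t x = Matrix.vec (length (Ups_odd N i))
     (\<lambda>r. 2 * (LINT \<Omega>:{\<Omega> \<in> sphere 0 1. \<Omega> \<bullet> n x < 0}|sphere_measure.
        \<psi>in t x \<Omega> * (rotate_fun (R (n x)) (Ups_odd N i) ! r) \<Omega>))"

definition incoming_distribution ::
    "(real ^ 3) set \<Rightarrow> (real ^ 3 \<Rightarrow> real ^ 3) \<Rightarrow> (real \<Rightarrow> real ^ 3 \<Rightarrow> real ^ 3 \<Rightarrow> real) \<Rightarrow> bool" where
  "incoming_distribution G n \<psi>in \<longleftrightarrow>
     (AE x in boundary_measure G. \<forall>t>0.
        set_integrable sphere_measure {\<Omega> \<in> sphere 0 1. \<Omega> \<bullet> n x < 0} (\<psi>in t x))"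

definition PN_boundary_condition ::
    "nat \<Rightarrow> 3 \<Rightarrow> (real ^ 3 \<Rightarrow> real ^ 3 ^ 3) \<Rightarrow> (real ^ 3) set \<Rightarrow> (real ^ 3 \<Rightarrow> real ^ 3)
      \<Rightarrow> (real \<Rightarrow> real ^ 3 \<Rightarrow> real ^ 3 \<Rightarrow> real) \<Rightarrow> (real \<Rightarrow> real ^ 3 \<Rightarrow> real Matrix.vec) \<Rightarrow> bool" where
  "PN_boundary_condition N i R G n \<psi>in u \<longleftrightarrow>
     (AE x in boundary_measure G. \<forall>t>0. \<exists>uo ue.
        uo \<in> carrier_vec (length (Ups_odd N i)) \<and> ue \<in> carrier_vec (length (Ups_even N i)) \<and>
        (\<forall>\<Omega>\<in>sphere 0 1. lin_comb (u t x) (Ups N) \<Omega> =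
           lin_comb uo (rotate_fun (R (n x)) (Ups_odd N i)) \<Omega> +
           lin_comb ue (rotate_fun (R (n x)) (Ups_even N i)) \<Omega>) \<and>
        uo = (L_mat N i * A_hat N i) *\<^sub>v ue + boundary_data N i R n \<psi>in t x)"

end

(*
  Restricted to the sphere, the harmonics of degree at most N span exactly the polynomials of
  degree at most N, and a polynomial that is odd in direction e_i is Omega_i times an even
  polynomial of degree N - 1. Hence Omega_i f with f odd can only be orthogonal to all even
  harmonics if f = 0 (full row rank), the kernel 1 / Omega_i is harmless on odd functions and the
  form of L dominates the identity, and Omega_i Y is again an odd combination of harmonics of
  degree at most N whenever Y is even of degree less than N, so that the 1 / Omega_i in L cancels
  (comparison of L A with M).
  For the energy bound, u^T A_n u is the integral of (Omega . n) psi^2, i.e. 2 (u^o)^T A u^e in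
  coordinates adapted to n. Inserting the boundary condition turns it into a quadratic form
  in A u^e which is bounded below by completing the square with respect to L; the collision
  term is dissipative because its kernel is symmetric and its total cross-section is constant.
*)

theory Submission
  imports Defs
begin

section \<open>The surface measure\<close>

text \<open>No spherical coordinates are introduced: integrals over the sphere are evaluated through
  the invariance of the cone measure under orthogonal maps. Rotations about \<open>e_3\<close> kill
  the mixed azimuthal moments, and rotations that tilt this axis determine the moments of the third
  coordinate. Orthonormality thereby becomes one-dimensional integration by parts for Legendre
  polynomials. The azimuth is discontinuous, so the harmonics are replaced by the polynomials
  \<open>sph_poly\<close>, which agree with them on the sphere; continuity, degree and parity are
  read off there. A solution is C^1 only for positive times, so the energy identity is integrated
  over \<open>[s, T]\<close>, and \<open>s\<close> tends to 0 by dominated convergence. Completing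
  the square gives half of the norm of the inverse of \<open>L\<close> as constant; the stated bound
  has a factor 2 to spare.\<close>

definition usph :: "(real ^ 3) measure" where
  "usph = restrict_space sphere_measure (sphere 0 1)"

lemma sets_sphere_measure [simp, measurable_cong]: "sets sphere_measure = sets borel"
  by (simp add: sphere_measure_def)

lemma space_sphere_measure [simp]: "space sphere_measure = UNIV"
  by (simp add: sphere_measure_def space_scale_measure)

lemma space_usph [simp]: "space usph = sphere 0 1"
  by (simp add: usph_def space_restrict_space)

lemma sets_usph [measurable_cong]: "sets usph = sets (restrict_space borel (sphere 0 1))"
  unfolding usph_def by (rule sets_restrict_space_cong) simp

lemma measurable_sgn_ball:
  "sgn \<in> measurable (restrict_space lborel (cball 0 1 - {0::real^3})) borel"
  by (rule measurable_restrict_space1) simp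

lemma emeasure_sphere_measure:
  assumes "A \<in> sets borel"
  shows "emeasure sphere_measure A = 3 * emeasure lborel ((cball 0 1 - {0}) \<inter> sgn -` A)"
proof -
  have "emeasure sphere_measure A
      = 3 * emeasure (restrict_space lborel (cball 0 1 - {0})) (sgn -` A \<inter> (cball 0 1 - {0}))"
    unfolding sphere_measure_def emeasure_scale_measure
    by (subst emeasure_distr[OF measurable_sgn_ball assms]) (simp add: space_restrict_space)
  also have "\<dots> = 3 * emeasure lborel (sgn -` A \<inter> (cball 0 1 - {0}))"
    by (subst emeasure_restrict_space) auto
  finally show ?thesis by (simp add: Int_commute)
qed

lemma emeasure_sphere_measure_sphere: "emeasure sphere_measure (sphere 0 1) = ennreal (4 * pi)"
proof -
  have "(cball 0 1 - {0::real^3}) \<inter> sgn -` (sphere 0 1) = cball 0 1 - {0}"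
    by (auto simp: norm_sgn)
  hence "emeasure sphere_measure (sphere 0 1) = 3 * emeasure lborel (cball 0 1 - {0::real^3})"
    by (subst emeasure_sphere_measure) auto
  also have "emeasure lborel (cball 0 1 - {0::real^3}) = emeasure lborel (cball 0 (1::real) :: (real^3) set)"
    by (rule emeasure_Diff_null_set) auto
  also have "\<dots> = ennreal (4 / 3 * pi)"
    by (subst emeasure_cball) (auto simp: unit_ball_vol_3)
  also have "3 * \<dots> = ennreal 3 * ennreal (4 / 3 * pi)" by simp
  also have "\<dots> = ennreal (4 * pi)"
    by (subst ennreal_mult[symmetric]) auto
  finally show ?thesis .
qed

lemma sphere_in_sets: "sphere 0 1 \<inter> space sphere_measure \<in> sets sphere_measure"
  by (auto simp: closed_sphere borel_closed)

lemma emeasure_usph: "emeasure usph (space usph) = ennreal (4 * pi)"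
  unfolding usph_def by (subst emeasure_restrict_space)
    (use sphere_in_sets in \<open>auto simp: emeasure_sphere_measure_sphere space_restrict_space\<close>)

interpretation usph: finite_measure usph
  by (rule finite_measureI) (simp add: emeasure_usph del: space_usph)

lemma measure_usph: "measure usph (sphere 0 1) = 4 * pi"
  using emeasure_usph by (simp add: measure_def)

lemma set_integral_sphere:
  "(LINT \<Omega>:sphere 0 1|sphere_measure. f \<Omega>) = (LINT \<Omega>|usph. f \<Omega> :: real)"
  unfolding usph_def set_lebesgue_integral_def
  by (subst integral_restrict_space) (use sphere_in_sets in auto)

lemma set_integrable_sphere:
  "set_integrable sphere_measure (sphere 0 1) f \<longleftrightarrow> integrable usph (f :: _ \<Rightarrow> real)"
  unfolding usph_def by (rule set_integrable_eq) (use sphere_in_sets in auto)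

lemma half_sphere_subset: "half_sphere i \<subseteq> sphere 0 1"
  by (auto simp: half_sphere_def)

lemma half_sphere_closed: "closed (half_sphere i)"
proof -
  have "half_sphere i = sphere 0 1 \<inter> {x. 0 \<le> x $ i}" by (auto simp: half_sphere_def)
  thus ?thesis by (auto intro!: closed_Int closed_sphere closed_Collect_le continuous_intros)
qed

lemma set_integral_half_sphere:
  "(LINT \<Omega>:half_sphere i|sphere_measure. f \<Omega>)
     = (LINT \<Omega>|usph. indicator (half_sphere i) \<Omega> * f \<Omega> :: real)"
proof -
  have "(LINT \<Omega>:half_sphere i|sphere_measure. f \<Omega>)
     = (LINT \<Omega>:sphere 0 1|sphere_measure. indicator (half_sphere i) \<Omega> * f \<Omega>)"
    unfolding set_lebesgue_integral_def using half_sphere_subset[of i]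
    by (intro Bochner_Integration.integral_cong) (auto simp: indicator_def)
  thus ?thesis by (simp add: set_integral_sphere)
qed

lemma set_integrable_half_sphere:
  "set_integrable sphere_measure (half_sphere i) f
     \<longleftrightarrow> integrable usph (\<lambda>\<Omega>. indicator (half_sphere i) \<Omega> * f \<Omega> :: real)"
proof -
  have "set_integrable sphere_measure (half_sphere i) f \<longleftrightarrow>
     set_integrable sphere_measure (sphere 0 1) (\<lambda>\<Omega>. indicator (half_sphere i) \<Omega> * f \<Omega>)"
    unfolding set_integrable_def using half_sphere_subset[of i]
    by (intro Bochner_Integration.integrable_cong) (auto simp: indicator_def)
  thus ?thesis by (simp add: set_integrable_sphere)
qed

lemma measurable_usph_continuous:
  assumes "continuous_on (sphere 0 1) f"
  shows "f \<in> borel_measurable usph"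
proof -
  have "f \<in> borel_measurable (restrict_space borel (sphere 0 1))"
    using assms by (rule borel_measurable_continuous_on_restrict)
  thus ?thesis using sets_usph measurable_cong_sets by blast
qed

lemma integrable_usph_bounded:
  fixes f :: "real^3 \<Rightarrow> real"
  assumes "f \<in> borel_measurable usph" "\<And>x. x \<in> sphere 0 1 \<Longrightarrow> \<bar>f x\<bar> \<le> B"
  shows "integrable usph f"
  by (rule usph.integrable_const_bound[where B=B]) (use assms in auto)

lemma continuous_sphere_bounded:
  fixes f :: "real^3 \<Rightarrow> real"
  assumes "continuous_on (sphere 0 1) f"
  obtains B where "0 \<le> B" "\<And>x. x \<in> sphere 0 1 \<Longrightarrow> \<bar>f x\<bar> \<le> B"
proof -
  have "compact (f ` sphere 0 1)" using assms compact_continuous_image compact_sphere by blast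
  then obtain B where "0 < B" "\<forall>y\<in>f ` sphere 0 1. norm y \<le> B"
    using compact_imp_bounded bounded_pos by metis
  thus ?thesis using that[of B] by auto
qed

lemma integrable_usph_continuous:
  fixes f :: "real^3 \<Rightarrow> real"
  assumes "continuous_on (sphere 0 1) f"
  shows "integrable usph f"
  using continuous_sphere_bounded[OF assms] measurable_usph_continuous[OF assms]
  by (metis integrable_usph_bounded)

section \<open>Invariance under orthogonal maps\<close>

lemma orthogonal_transformation_sphere:
  "orthogonal_transformation T \<Longrightarrow> x \<in> sphere 0 1 \<Longrightarrow> T x \<in> sphere 0 1"
  by (simp add: orthogonal_transformation_norm)

lemma orthogonal_transformation_borel:
  fixes T :: "real ^ 3 \<Rightarrow> real ^ 3"
  assumes T: "orthogonal_transformation T"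
  shows "T \<in> borel_measurable borel"
  using orthogonal_transformation_linear[OF T]
  by (intro borel_measurable_continuous_onI linear_continuous_on) (simp add: linear_conv_bounded_linear)

text \<open>Lebesgue measure is determined by its values on boxes. The preimage of a box under
  \<open>T\<close> is its image under the inverse, which is again orthogonal and preserves measure
  in \<open>lebesgue\<close>. Since the preimage is a Borel set, the completion gives it the same
  measure as \<open>lborel\<close>.\<close>

lemma lborel_orthogonal:
  fixes T :: "real ^ 3 \<Rightarrow> real ^ 3"
  assumes T: "orthogonal_transformation T"
  shows "distr lborel borel T = lborel"
proof (rule lborel_eqI[symmetric])
  fix l u :: "real ^ 3"
  assume lu: "\<And>b. b \<in> Basis \<Longrightarrow> l \<bullet> b \<le> u \<bullet> b"
  have Tm: "T \<in> borel_measurable borel"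
    by (rule orthogonal_transformation_borel[OF T])
  have oi: "orthogonal_transformation (Hilbert_Choice.inv T)"
    using T by (rule orthogonal_transformation_inv)
  have b: "bij T" using T by (rule orthogonal_transformation_bij)
  have eq: "T -` box l u = Hilbert_Choice.inv T ` box l u"
    using b by (simp add: bij_vimage_eq_inv_image)
  have lm: "Hilbert_Choice.inv T ` box l u \<in> lmeasurable"
    using oi by (rule measurable_orthogonal_image) simp
  have bs: "T -` box l u \<in> sets borel" using measurable_sets[OF Tm, of "box l u"] by simp
  have "emeasure (distr lborel borel T) (box l u) = emeasure lborel (T -` box l u)"
    by (subst emeasure_distr) (use Tm in auto)
  also have "\<dots> = emeasure lebesgue (Hilbert_Choice.inv T ` box l u)"
    using bs unfolding eq[symmetric] by (subst emeasure_completion) (auto simp: main_part_sets)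
  also have "\<dots> = ennreal (measure lebesgue (Hilbert_Choice.inv T ` box l u))"
    using lm by (rule emeasure_eq_measure2)
  also have "\<dots> = ennreal (measure lebesgue (box l u))"
    by (subst measure_orthogonal_image[OF oi]) auto
  also have "\<dots> = ennreal (prod ((\<bullet>) (u - l)) Basis)"
    using lu by (simp add: measure_lborel_box)
  finally show "emeasure (distr lborel borel T) (box l u) = ennreal (prod ((\<bullet>) (u - l)) Basis)" .
qed simp

text \<open>An orthogonal map commutes with \<open>sgn\<close> and preserves the punctured unit
  ball, so the cone over a preimage is the preimage of the cone.\<close>

lemma sphere_measure_orthogonal:
  fixes T :: "real ^ 3 \<Rightarrow> real ^ 3"
  assumes T: "orthogonal_transformation T"
  shows "distr sphere_measure borel T = sphere_measure"
proof (rule measure_eqI)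
  fix A assume "A \<in> sets (distr sphere_measure borel T)"
  hence A: "A \<in> sets borel" by simp
  note Tm = orthogonal_transformation_borel[OF T]
  have TA: "T -` A \<in> sets borel" using measurable_sets[OF Tm A] by simp
  define B where "B = (cball 0 1 - {0}) \<inter> sgn -` A"
  have B: "B \<in> sets borel"
    using measurable_sets[of sgn borel borel A] A unfolding B_def
    by (intro sets.Int) auto
  have sg: "T (sgn x) = sgn (T x)" for x
    using T by (simp add: sgn_div_norm orthogonal_transformation_norm orthogonal_transformation_linear linear_scale)
  have z: "T x = 0 \<longleftrightarrow> x = 0" for x
    using orthogonal_transformation_norm[OF T, of x] by (metis norm_eq_zero)
  have "(cball 0 1 - {0}) \<inter> sgn -` (T -` A) = T -` B"
    using orthogonal_transformation_norm[OF T] by (auto simp: B_def sg z)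
  hence "emeasure (distr sphere_measure borel T) A = 3 * emeasure lborel (T -` B)"
    using Tm A TA by (subst emeasure_distr) (auto simp: emeasure_sphere_measure)
  also have "emeasure lborel (T -` B) = emeasure (distr lborel borel T) B"
    using Tm B by (subst emeasure_distr) auto
  also have "\<dots> = emeasure lborel B" by (simp add: lborel_orthogonal[OF T])
  finally show "emeasure (distr sphere_measure borel T) A = emeasure sphere_measure A"
    by (simp add: emeasure_sphere_measure A B_def)
qed simp

text \<open>Measurability of \<open>f\<close> suffices, which is what the scattering kernel and the
  indicator of a half sphere call for; continuous integrands go through
  \<open>integral_usph_rotate\<close>.\<close>

lemma integral_usph_orthogonal:
  fixes T :: "real ^ 3 \<Rightarrow> real ^ 3" and f :: "real ^ 3 \<Rightarrow> real"
  assumes T: "orthogonal_transformation T" and f: "f \<in> borel_measurable usph"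
  shows "(LINT \<Omega>|usph. f (T \<Omega>)) = (LINT \<Omega>|usph. f \<Omega>)"
proof -
  have m: "(\<lambda>x. indicat_real (sphere 0 1) x *\<^sub>R f x) \<in> borel_measurable borel"
  proof -
    have "f \<in> borel_measurable (restrict_space borel (sphere 0 1))"
      using f sets_usph measurable_cong_sets by blast
    thus ?thesis
      by (subst (asm) borel_measurable_restrict_space_iff) (auto simp: closed_sphere borel_closed)
  qed
  have "(LINT \<Omega>|usph. f (T \<Omega>)) = (LINT \<Omega>|sphere_measure. indicat_real (sphere 0 1) (T \<Omega>) *\<^sub>R f (T \<Omega>))"
    unfolding set_integral_sphere[symmetric] set_lebesgue_integral_def
    by (rule Bochner_Integration.integral_cong) (auto simp: indicator_def orthogonal_transformation_norm[OF T])
  also have "\<dots> = (LINT \<Omega>|distr sphere_measure borel T. indicat_real (sphere 0 1) \<Omega> *\<^sub>R f \<Omega>)"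
    using orthogonal_transformation_borel[OF T] m by (subst integral_distr) auto
  also have "\<dots> = (LINT \<Omega>|usph. f \<Omega>)"
    unfolding sphere_measure_orthogonal[OF T] set_integral_sphere[symmetric] set_lebesgue_integral_def ..
  finally show ?thesis .
qed

section \<open>Rotation invariance and the moments of the third coordinate\<close>

lemma integral_usph_linear:
  fixes f g :: "real ^ 3 \<Rightarrow> real"
  assumes "continuous_on (sphere 0 1) f" "continuous_on (sphere 0 1) g"
  shows "(LINT \<Omega>|usph. a * f \<Omega> + b * g \<Omega>) = a * (LINT \<Omega>|usph. f \<Omega>) + b * (LINT \<Omega>|usph. g \<Omega>)"
proof -
  note i = assms[THEN integrable_usph_continuous]
  show ?thesis
    by (subst Bochner_Integration.integral_add)
      (use i in \<open>auto intro: Bochner_Integration.integrable_mult_right\<close>)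
qed

lemma integral_usph_cong:
  "(\<And>\<Omega>. \<Omega> \<in> sphere 0 1 \<Longrightarrow> f \<Omega> = g \<Omega>) \<Longrightarrow> (LINT \<Omega>|usph. f \<Omega>) = (LINT \<Omega>|usph. g \<Omega>)"
  by (rule Bochner_Integration.integral_cong) auto

text \<open>In the applications \<open>g\<close> is either \<open>- f\<close>, and then the integral
  vanishes, or the integrand written in rotated coordinates.\<close>

lemma integral_usph_rotate:
  fixes T :: "real ^ 3 \<Rightarrow> real ^ 3" and f :: "real ^ 3 \<Rightarrow> real"
  assumes T: "orthogonal_transformation T" and f: "continuous_on (sphere 0 1) f"
    and fT: "\<And>\<Omega>. \<Omega> \<in> sphere 0 1 \<Longrightarrow> f (T \<Omega>) = g \<Omega>"
  shows "(LINT \<Omega>|usph. f \<Omega>) = (LINT \<Omega>|usph. g \<Omega>)"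
proof -
  have "(LINT \<Omega>|usph. f \<Omega>) = (LINT \<Omega>|usph. f (T \<Omega>))"
    by (rule integral_usph_orthogonal[OF T measurable_usph_continuous[OF f], symmetric])
  also have "\<dots> = (LINT \<Omega>|usph. g \<Omega>)" using fT by (rule integral_usph_cong)
  finally show ?thesis .
qed

lemma sphere_3_eq: "(\<Omega> :: real^3) \<in> sphere 0 1 \<longleftrightarrow> (\<Omega> $ 1)\<^sup>2 + (\<Omega> $ 2)\<^sup>2 + (\<Omega> $ 3)\<^sup>2 = 1"
  by (simp add: norm_eq_1 inner_vec_def sum_3 power2_eq_square)

lemma orthogonal_transformation_3I:
  fixes T :: "real ^ 3 \<Rightarrow> real ^ 3"
  assumes "linear T"
    and "\<And>v. (T v $ 1)\<^sup>2 + (T v $ 2)\<^sup>2 + (T v $ 3)\<^sup>2 = (v $ 1)\<^sup>2 + (v $ 2)\<^sup>2 + (v $ 3)\<^sup>2"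
  shows "orthogonal_transformation T"
  unfolding orthogonal_transformation
  using assms by (simp add: norm_eq inner_vec_def sum_3 power2_eq_square)

text \<open>The parameters are a cosine and a sine given as bare numbers with
  \<open>c^2 + s^2 = 1\<close>. In \<open>moment_rotation\<close> they are \<open>1 / r\<close> and
  \<open>t / r\<close> with \<open>r = sqrt (1 + t^2)\<close>, so that no angle with tangent
  \<open>t\<close> has to be named.\<close>

definition rot_xz :: "real \<Rightarrow> real \<Rightarrow> real ^ 3 \<Rightarrow> real ^ 3" where
  "rot_xz c s v = vector [c * v $ 1 - s * v $ 3, v $ 2, s * v $ 1 + c * v $ 3]"

definition rot_xy :: "real \<Rightarrow> real \<Rightarrow> real ^ 3 \<Rightarrow> real ^ 3" where
  "rot_xy c s v = vector [c * v $ 1 - s * v $ 2, s * v $ 1 + c * v $ 2, v $ 3]"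

lemma rot_xz_nth [simp]:
  "rot_xz c s v $ 1 = c * v $ 1 - s * v $ 3" "rot_xz c s v $ 2 = v $ 2" "rot_xz c s v $ 3 = s * v $ 1 + c * v $ 3"
  by (simp_all add: rot_xz_def)

lemma rot_xy_nth [simp]:
  "rot_xy c s v $ 1 = c * v $ 1 - s * v $ 2" "rot_xy c s v $ 2 = s * v $ 1 + c * v $ 2" "rot_xy c s v $ 3 = v $ 3"
  by (simp_all add: rot_xy_def)

lemma rotation_2d_norm:
  fixes c s x y :: real
  assumes "c\<^sup>2 + s\<^sup>2 = 1"
  shows "(c * x - s * y)\<^sup>2 + (s * x + c * y)\<^sup>2 = x\<^sup>2 + y\<^sup>2"
proof -
  have "(c * x - s * y)\<^sup>2 + (s * x + c * y)\<^sup>2 = (c\<^sup>2 + s\<^sup>2) * (x\<^sup>2 + y\<^sup>2)"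
    by (simp add: power2_eq_square algebra_simps)
  thus ?thesis using assms by simp
qed

lemma orthogonal_rot_xz: "c\<^sup>2 + s\<^sup>2 = 1 \<Longrightarrow> orthogonal_transformation (rot_xz c s)"
proof (rule orthogonal_transformation_3I)
  show "linear (rot_xz c s)"
    by (rule linearI) (simp_all add: Finite_Cartesian_Product.vec_eq_iff forall_3 algebra_simps)
  fix v assume "c\<^sup>2 + s\<^sup>2 = 1"
  from rotation_2d_norm[OF this, of "v $ 1" "v $ 3"]
  show "(rot_xz c s v $ 1)\<^sup>2 + (rot_xz c s v $ 2)\<^sup>2 + (rot_xz c s v $ 3)\<^sup>2
      = (v $ 1)\<^sup>2 + (v $ 2)\<^sup>2 + (v $ 3)\<^sup>2"
    by simp
qed

lemma orthogonal_rot_xy: "c\<^sup>2 + s\<^sup>2 = 1 \<Longrightarrow> orthogonal_transformation (rot_xy c s)"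
proof (rule orthogonal_transformation_3I)
  show "linear (rot_xy c s)"
    by (rule linearI) (simp_all add: Finite_Cartesian_Product.vec_eq_iff forall_3 algebra_simps)
  fix v assume "c\<^sup>2 + s\<^sup>2 = 1"
  from rotation_2d_norm[OF this, of "v $ 1" "v $ 2"]
  show "(rot_xy c s v $ 1)\<^sup>2 + (rot_xy c s v $ 2)\<^sup>2 + (rot_xy c s v $ 3)\<^sup>2
      = (v $ 1)\<^sup>2 + (v $ 2)\<^sup>2 + (v $ 3)\<^sup>2"
    by simp
qed

lemma reflect_axis_nth:
  "reflect_dir (axis i 1) \<Omega> $ j = (if j = i then - \<Omega> $ j else \<Omega> $ j)"
proof -
  have "axis i 1 \<bullet> \<Omega> = \<Omega> $ i" by (simp add: inner_axis')
  thus ?thesis by (simp add: reflect_dir_def) (simp add: axis_def)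
qed

lemma orthogonal_reflect_axis: "orthogonal_transformation (reflect_dir (axis i 1) :: real^3 \<Rightarrow> real^3)"
proof (rule orthogonal_transformation_3I)
  show "linear (reflect_dir (axis i 1) :: real^3 \<Rightarrow> real^3)"
    by (rule linearI) (simp_all add: Finite_Cartesian_Product.vec_eq_iff reflect_axis_nth)
  fix v :: "real ^ 3"
  show "(reflect_dir (axis i 1) v $ 1)\<^sup>2 + (reflect_dir (axis i 1) v $ 2)\<^sup>2 + (reflect_dir (axis i 1) v $ 3)\<^sup>2
      = (v $ 1)\<^sup>2 + (v $ 2)\<^sup>2 + (v $ 3)\<^sup>2"
    by (simp add: reflect_axis_nth)
qed

text \<open>The image of the surface measure under the third coordinate, as a linear functional on
  polynomials. The Legendre theory below uses its linearity, its value at 1 and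
  \<open>zint_pderiv\<close>, which identifies it with \<open>2 * pi\<close> times integration over
  \<open>[-1, 1]\<close>.\<close>

definition zint :: "real poly \<Rightarrow> real" where
  "zint q = (LINT \<Omega>|usph. poly q (\<Omega> $ 3))"

lemma continuous_poly_nth [continuous_intros]:
  "continuous_on S (\<lambda>\<Omega> :: real^3. poly q (\<Omega> $ 3))"
  by (intro continuous_on_poly continuous_intros)

lemma zint_add: "zint (p + q) = zint p + zint q"
  unfolding zint_def using integral_usph_linear[of "\<lambda>\<Omega>. poly p (\<Omega> $ 3)" "\<lambda>\<Omega>. poly q (\<Omega> $ 3)" 1 1]
  by (simp add: continuous_poly_nth)

lemma zint_smult: "zint (Polynomial.smult a p) = a * zint p"
  unfolding zint_def by simp

lemma zint_0 [simp]: "zint 0 = 0" by (simp add: zint_def)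

lemma zint_uminus: "zint (- p) = - zint p"
  unfolding zint_def by simp

lemma zint_diff: "zint (p - q) = zint p - zint q"
  using zint_add[of p "- q"] zint_uminus by simp

lemma zint_sum: "zint (sum f A) = (\<Sum>i\<in>A. zint (f i))"
  by (induction A rule: infinite_finite_induct) (auto simp: zint_add)

lemma zint_1: "zint 1 = 4 * pi"
  unfolding zint_def by (simp add: measure_usph)

lemma coeff_2_power: "Polynomial.coeff ([:1, 0, 1 :: real:] ^ m) 2 = real m"
proof (induction m)
  case (Suc m)
  have 0: "Polynomial.coeff ([:1, 0, 1 :: real:] ^ m) 0 = 1" for m
    by (simp flip: poly_0_coeff_0)
  show ?case
    by (simp add: numeral_2_eq_2 coeff_pCons Suc.IH[unfolded numeral_2_eq_2] 0)
qed simp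

text \<open>
  Invariance under the rotations about an axis orthogonal to \<open>e_3\<close> gives
  \<open>\<integral> (z + t x)^(2 m) = (1 + t^2)^m \<integral> z^(2 m)\<close>; compare the coefficients of \<open>t^2\<close>.
\<close>
lemma moment_rotation:
  assumes m: "m > 0"
  shows "(2 * real m - 1) * (LINT \<Omega>|usph. (\<Omega> $ 3) ^ (2 * m - 2) * (\<Omega> $ 1)\<^sup>2) = (LINT \<Omega>|usph. (\<Omega> $ 3) ^ (2 * m))"
proof -
  define M where "M j = (LINT \<Omega>|usph. (\<Omega> $ 1) ^ j * (\<Omega> $ 3) ^ (2 * m - j))" for j
  define P where "P = (\<Sum>j\<le>2*m. Polynomial.monom (real (2 * m choose j) * M j) j)"
  have "poly P t = poly (Polynomial.smult (M 0) ([:1, 0, 1:] ^ m)) t" for t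
  proof -
    define r where "r = sqrt (1 + t\<^sup>2)"
    have r: "r > 0" "r\<^sup>2 = 1 + t\<^sup>2" by (auto simp: r_def add_pos_nonneg)
    have r0: "1 + t\<^sup>2 \<noteq> 0" using r by (metis less_irrefl zero_less_power)
    have cs: "(1 / r)\<^sup>2 + (t / r)\<^sup>2 = 1"
      using r r0 by (simp add: power_divide add_divide_distrib[symmetric])
    have "(LINT \<Omega>|usph. (\<Omega> $ 3) ^ (2 * m)) = (LINT \<Omega>|usph. (t / r * \<Omega> $ 1 + 1 / r * \<Omega> $ 3) ^ (2 * m))"
      by (rule integral_usph_rotate[OF orthogonal_rot_xz[OF cs]]) (auto intro!: continuous_intros)
    also have "\<dots> = (LINT \<Omega>|usph. (1 / r) ^ (2 * m) * (t * \<Omega> $ 1 + \<Omega> $ 3) ^ (2 * m))"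
    proof (rule integral_usph_cong)
      fix \<Omega> :: "real^3"
      have "t / r * \<Omega> $ 1 + 1 / r * \<Omega> $ 3 = 1 / r * (t * \<Omega> $ 1 + \<Omega> $ 3)"
        by (simp add: algebra_simps)
      thus "(t / r * \<Omega> $ 1 + 1 / r * \<Omega> $ 3) ^ (2 * m) = (1 / r) ^ (2 * m) * (t * \<Omega> $ 1 + \<Omega> $ 3) ^ (2 * m)"
        by (simp only: power_mult_distrib)
    qed
    also have "\<dots> = (1 / r) ^ (2 * m) * (LINT \<Omega>|usph. (t * \<Omega> $ 1 + \<Omega> $ 3) ^ (2 * m))"
      by simp
    also have "(1 / r) ^ (2 * m) = 1 / (1 + t\<^sup>2) ^ m"
      by (simp add: power_mult power_divide r)
    also have "(LINT \<Omega>|usph. (t * \<Omega> $ 1 + \<Omega> $ 3) ^ (2 * m))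
       = (LINT \<Omega>|usph. (\<Sum>j\<le>2*m. real (2 * m choose j) * t ^ j * ((\<Omega> $ 1) ^ j * (\<Omega> $ 3) ^ (2 * m - j))))"
      by (rule integral_usph_cong) (simp add: binomial_ring power_mult_distrib mult.assoc)
    also have "\<dots> = (\<Sum>j\<le>2*m. (LINT \<Omega>|usph. real (2 * m choose j) * t ^ j * ((\<Omega> $ 1) ^ j * (\<Omega> $ 3) ^ (2 * m - j))))"
      by (intro Bochner_Integration.integral_sum integrable_usph_continuous continuous_intros)
    also have "\<dots> = poly P t"
      unfolding P_def poly_sum poly_monom M_def integral_mult_right_zero by (simp only: mult_ac)
    finally have "M 0 * (1 + t\<^sup>2) ^ m = poly P t"
      using r0 by (simp add: M_def field_simps)
    thus ?thesis by (simp add: power2_eq_square)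
  qed
  hence "P = Polynomial.smult (M 0) ([:1, 0, 1:] ^ m)"
    unfolding poly_eq_poly_eq_iff[symmetric] fun_eq_iff by blast
  hence "Polynomial.coeff P 2 = M 0 * real m"
    by (simp add: coeff_2_power)
  moreover have "Polynomial.coeff P 2 = real (2 * m choose 2) * M 2"
    using m unfolding P_def by (simp add: coeff_sum)
  moreover have "real (2 * m choose 2) = real m * (2 * real m - 1)"
    using m by (simp add: choose_two of_nat_diff)
  ultimately have "real m * ((2 * real m - 1) * M 2) = real m * M 0" by simp
  hence "(2 * real m - 1) * M 2 = M 0" using m by simp
  thus ?thesis by (simp add: M_def mult.commute)
qed

text \<open>The integral of \<open>z^(2 m) x^2\<close> is known from \<open>moment_rotation\<close>,
  a quarter turn about \<open>e_3\<close> gives the same value with \<open>y^2\<close>, and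
  \<open>x^2 + y^2 = 1 - z^2\<close> closes the recursion
  \<open>(2 m + 3) Z (2 m + 2) = (2 m + 1) Z (2 m)\<close>.\<close>

lemma zint_monom_even: "zint (Polynomial.monom 1 (2 * m)) = 4 * pi / (2 * real m + 1)"
proof (induction m)
  case 0
  show ?case using zint_1 by simp
next
  case (Suc m)
  let ?I = "\<lambda>f. LINT \<Omega>::real^3|usph. f \<Omega>"
  define Z where "Z k = (LINT \<Omega>::real^3|usph. (\<Omega> $ 3) ^ k)" for k
  have x: "(2 * real m + 1) * ?I (\<lambda>\<Omega>. (\<Omega> $ 3) ^ (2 * m) * (\<Omega> $ 1)\<^sup>2) = Z (2 * m + 2)"
    using moment_rotation[of "Suc m"] by (simp add: Z_def algebra_simps)
  have y: "?I (\<lambda>\<Omega>. (\<Omega> $ 3) ^ (2 * m) * (\<Omega> $ 2)\<^sup>2) = ?I (\<lambda>\<Omega>. (\<Omega> $ 3) ^ (2 * m) * (\<Omega> $ 1)\<^sup>2)"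
    by (rule integral_usph_rotate[OF orthogonal_rot_xy[of 0 1]]) (auto intro!: continuous_intros)
  have "?I (\<lambda>\<Omega>. (\<Omega> $ 3) ^ (2 * m) * (\<Omega> $ 2)\<^sup>2) = ?I (\<lambda>\<Omega>. 1 * (\<Omega> $ 3) ^ (2 * m) + (-1) * (\<Omega> $ 3) ^ (2 * m + 2) - (\<Omega> $ 3) ^ (2 * m) * (\<Omega> $ 1)\<^sup>2)"
  proof (rule integral_usph_cong)
    fix \<Omega> :: "real^3" assume "\<Omega> \<in> sphere 0 1"
    hence "(\<Omega> $ 2)\<^sup>2 = 1 - (\<Omega> $ 1)\<^sup>2 - (\<Omega> $ 3)\<^sup>2" unfolding sphere_3_eq by simp
    thus "(\<Omega> $ 3) ^ (2 * m) * (\<Omega> $ 2)\<^sup>2 = 1 * (\<Omega> $ 3) ^ (2 * m) + (-1) * (\<Omega> $ 3) ^ (2 * m + 2) - (\<Omega> $ 3) ^ (2 * m) * (\<Omega> $ 1)\<^sup>2"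
      by (simp only:) (simp add: algebra_simps power_add power2_eq_square)
  qed
  also have "\<dots> = Z (2 * m) - Z (2 * m + 2) - ?I (\<lambda>\<Omega>. (\<Omega> $ 3) ^ (2 * m) * (\<Omega> $ 1)\<^sup>2)"
    by (subst Bochner_Integration.integral_diff, intro integrable_usph_continuous continuous_intros,
        intro integrable_usph_continuous continuous_intros, subst integral_usph_linear)
      (auto intro!: continuous_intros simp: Z_def)
  finally have e: "2 * ?I (\<lambda>\<Omega>. (\<Omega> $ 3) ^ (2 * m) * (\<Omega> $ 1)\<^sup>2) = Z (2 * m) - Z (2 * m + 2)"
    using y by simp
  have "2 * Z (2 * m + 2) = (2 * real m + 1) * (Z (2 * m) - Z (2 * m + 2))"
    using arg_cong[OF e, of "\<lambda>v. (2 * real m + 1) * v"] x by linarith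
  hence "(2 * real m + 3) * Z (2 * m + 2) = (2 * real m + 1) * Z (2 * m)"
    by (simp add: algebra_simps)
  also have "Z (2 * m) = 4 * pi / (2 * real m + 1)"
    using Suc.IH by (simp add: zint_def Z_def poly_monom)
  finally have "Z (2 * m + 2) = 4 * pi / (2 * real m + 3)"
    by (simp add: divide_simps mult.commute)
  thus ?case
    by (simp add: zint_def Z_def poly_monom add.commute)
qed

lemma zint_monom_odd: "zint (Polynomial.monom 1 (2 * m + 1)) = 0"
proof -
  have "zint (Polynomial.monom 1 (2 * m + 1)) = (LINT \<Omega>|usph. - poly (Polynomial.monom 1 (2 * m + 1)) (\<Omega> $ 3))"
    unfolding zint_def
    by (rule integral_usph_rotate[OF orthogonal_reflect_axis[of 3]])
      (auto intro!: continuous_intros simp: reflect_axis_nth poly_monom)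
  thus ?thesis by (simp add: zint_def)
qed

text \<open>Archimedes: the projection of the surface measure to an axis is \<open>2 \<pi>\<close> times Lebesgue measure on \<open>[-1, 1]\<close>.\<close>
lemma zint_pderiv: "zint (pderiv p) = 2 * pi * (poly p 1 - poly p (-1))"
proof -
  have m: "zint (Polynomial.monom 1 k) = 2 * pi / real (Suc k) * (1 - (-1) ^ Suc k)" for k
  proof (cases "even k")
    case True
    then obtain j where "k = 2 * j" by blast
    thus ?thesis using zint_monom_even[of j] by (simp add: field_simps)
  next
    case False
    then obtain j where "k = 2 * j + 1" using oddE by blast
    thus ?thesis using zint_monom_odd[of j] by simp
  qed
  have mm: "zint (pderiv (Polynomial.monom a k)) = 2 * pi * (poly (Polynomial.monom a k) 1 - poly (Polynomial.monom a k) (-1))" for a k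
  proof (cases k)
    case 0
    thus ?thesis by (simp add: pderiv_monom poly_monom)
  next
    case (Suc j)
    have "zint (pderiv (Polynomial.monom a k)) = zint (Polynomial.smult (real k * a) (Polynomial.monom 1 j))"
      by (simp add: pderiv_monom Suc smult_monom)
    also have "\<dots> = 2 * pi * a * (1 - (-1) ^ Suc j)"
      unfolding zint_smult m using Suc by (simp del: power_Suc)
    finally show ?thesis using Suc by (simp add: poly_monom algebra_simps)
  qed
  have ps: "pderiv (sum f A) = (\<Sum>i\<in>A. pderiv (f i))" for f :: "nat \<Rightarrow> real poly" and A
    by (induction A rule: infinite_finite_induct) (auto simp: pderiv_add)
  have "zint (pderiv (\<Sum>i\<le>Polynomial.degree p. Polynomial.monom (Polynomial.coeff p i) i))
    = 2 * pi * (poly (\<Sum>i\<le>Polynomial.degree p. Polynomial.monom (Polynomial.coeff p i) i) 1 - poly (\<Sum>i\<le>Polynomial.degree p. Polynomial.monom (Polynomial.coeff p i) i) (-1))"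
    by (simp add: ps zint_sum mm poly_sum sum_subtractf[symmetric] sum_distrib_left)
  thus ?thesis by (simp add: poly_as_sum_of_monoms)
qed

section \<open>Legendre polynomials\<close>

lemma zint_by_parts:
  "zint (pderiv p * q) = 2 * pi * (poly (p * q) 1 - poly (p * q) (-1)) - zint (p * pderiv q)"
proof -
  have "zint (pderiv (p * q)) = zint (p * pderiv q) + zint (pderiv p * q)"
    by (simp add: pderiv_mult zint_add mult.commute)
  thus ?thesis using zint_pderiv[of "p * q"] by simp
qed

text \<open>The weight \<open>1 - z^2\<close> of the associated Legendre functions; on the sphere it
  is also \<open>x^2 + y^2\<close>. Its zeros at 1 and -1 remove the boundary terms in integrations
  by parts.\<close>

definition wpol :: "real poly" where "wpol = [:1, 0, -1:]"

lemma poly_wpol: "poly wpol x = 1 - x\<^sup>2"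
  by (simp add: wpol_def power2_eq_square)

lemma wpol_power_dvd_pderiv:
  assumes "wpol ^ Suc m dvd q"
  shows "wpol ^ m dvd pderiv q"
proof -
  obtain r where q: "q = wpol ^ Suc m * r" using assms by blast
  have "pderiv q = wpol ^ m * (wpol * pderiv r + Polynomial.smult (of_nat (Suc m)) (pderiv wpol) * r)"
    unfolding q pderiv_mult pderiv_power_Suc by (simp add: algebra_simps)
  thus ?thesis by simp
qed

text \<open>Each of the \<open>m\<close> integrations by parts costs \<open>q\<close> one power of
  \<open>wpol\<close>, so a factor of \<open>wpol\<close> is still present whenever a boundary term
  is evaluated.\<close>

lemma zint_higher_pderiv:
  assumes "wpol ^ m dvd q"
  shows "zint ((pderiv ^^ m) p * q) = (-1) ^ m * zint (p * (pderiv ^^ m) q)"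
  using assms
proof (induction m arbitrary: q)
  case (Suc m)
  have "poly q 1 = 0" "poly q (-1) = 0"
    using Suc.prems by (auto simp: poly_wpol elim!: dvdE)
  hence "zint ((pderiv ^^ Suc m) p * q) = - zint ((pderiv ^^ m) p * pderiv q)"
    using zint_by_parts[of "(pderiv ^^ m) p" q] by simp
  also have "\<dots> = - ((-1) ^ m * zint (p * (pderiv ^^ m) (pderiv q)))"
    by (subst Suc.IH[OF wpol_power_dvd_pderiv[OF Suc.prems]]) simp
  finally show ?case by (simp add: funpow_swap1)
qed simp

lemma wpol_neg: "[:-1, 0, 1:] = - wpol"
  by (simp add: wpol_def)

lemma degree_wpol_power: "Polynomial.degree (wpol ^ m) = 2 * m"
  by (simp add: degree_power_eq wpol_def)

lemma degree_higher_pderiv: "Polynomial.degree ((pderiv ^^ m) (p :: real poly)) = Polynomial.degree p - m"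
  by (induction m) (auto simp: degree_pderiv)

lemma degree_legendre: "Polynomial.degree (legendre_poly l) = l"
proof -
  have "Polynomial.degree ([:-1, 0, 1 :: real:] ^ l) = 2 * l" by (simp add: degree_power_eq)
  thus ?thesis by (simp add: legendre_poly_def degree_higher_pderiv)
qed

text \<open>In Rodrigues' formula the \<open>l\<close>-fold derivative multiplies the leading term
  of degree \<open>2 * l\<close>, whose coefficient is 1, by
  \<open>fact (2 * l) / fact l\<close>.\<close>

lemma lead_coeff_legendre: "Polynomial.coeff (legendre_poly l) l = fact (2 * l) / (2 ^ l * fact l * fact l)"
proof -
  have "Polynomial.coeff ([:-1, 0, 1 :: real:] ^ l) (2 * l) = 1"
    using lead_coeff_power[of "[:-1, 0, 1 :: real:]" l] by (simp add: degree_power_eq mult_2)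
  moreover have "pochhammer (real (Suc l)) l = fact (2 * l) / fact l"
    using pochhammer_product[of l "2 * l" "1 :: real"] by (simp add: pochhammer_fact[symmetric] field_simps)
  ultimately show ?thesis
    by (simp add: legendre_poly_def coeff_higher_pderiv mult_2)
qed

text \<open>A beta integral. The derivative of \<open>z (1 - z^2)^(l + 1)\<close> has integral 0 and
  is a combination of two consecutive powers of \<open>wpol\<close>, which yields the ratio
  \<open>(2 l + 2) / (2 l + 3)\<close>.\<close>

lemma zint_wpol_power: "zint (wpol ^ l) = 4 * pi * 4 ^ l * (fact l)\<^sup>2 / fact (2 * l + 1)"
proof (induction l)
  case 0
  show ?case using zint_1 by simp
next
  case (Suc l)
  have x2: "[:0, 1:] * pderiv wpol = Polynomial.smult 2 (wpol - 1)"
    by (simp add: wpol_def pderiv_pCons one_pCons)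
  have "pderiv ([:0, 1:] * wpol ^ Suc l)
      = wpol ^ Suc l + Polynomial.smult (real (Suc l)) (wpol ^ l * ([:0, 1:] * pderiv wpol))"
    unfolding pderiv_mult pderiv_power_Suc by (simp add: pderiv_pCons algebra_simps)
  also have "\<dots> = Polynomial.smult (2 * real l + 3) (wpol ^ Suc l) - Polynomial.smult (2 * real l + 2) (wpol ^ l)"
    unfolding x2 by (rule poly_eqI) (simp add: algebra_simps)
  finally have "zint (pderiv ([:0, 1:] * wpol ^ Suc l)) = (2 * real l + 3) * zint (wpol ^ Suc l) - (2 * real l + 2) * zint (wpol ^ l)"
    by (simp add: zint_diff zint_smult)
  hence "(2 * real l + 3) * zint (wpol ^ Suc l) = (2 * real l + 2) * zint (wpol ^ l)"
    unfolding zint_pderiv by (simp add: poly_wpol)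
  hence "zint (wpol ^ Suc l) = (2 * real l + 2) / (2 * real l + 3) * zint (wpol ^ l)"
    by (simp add: field_simps)
  also have "\<dots> = (2 * real l + 2) / (2 * real l + 3) * (4 * pi * 4 ^ l * (fact l)\<^sup>2 / fact (2 * l + 1))"
    by (simp only: Suc.IH)
  also have "\<dots> = 4 * pi * 4 ^ Suc l * (fact (Suc l))\<^sup>2 / fact (2 * Suc l + 1)"
    by (simp add: divide_simps power2_eq_square) (simp add: algebra_simps)
  finally show ?case .
qed

text \<open>By Rodrigues' formula all \<open>l\<close> derivatives move to \<open>q\<close> and
  leave the constant \<open>fact l * coeff q l\<close>. The sign of the integrations by parts
  cancels against that of \<open>(z^2 - 1)^l = (- wpol)^l\<close>. For \<open>q\<close> of degree
  below \<open>l\<close> this is the orthogonality of the Legendre polynomials.\<close>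

lemma zint_legendre:
  assumes "Polynomial.degree q \<le> l"
  shows "zint (legendre_poly l * q) = Polynomial.coeff q l / 2 ^ l * zint (wpol ^ l)"
proof -
  have d: "(pderiv ^^ l) q = [:fact l * Polynomial.coeff q l:]"
  proof -
    have "Polynomial.degree ((pderiv ^^ l) q) = 0" using assms by (simp add: degree_higher_pderiv)
    then obtain a where a: "(pderiv ^^ l) q = [:a:]" using degree_eq_zeroE by blast
    have "a = Polynomial.coeff ((pderiv ^^ l) q) 0" using a by simp
    also have "\<dots> = fact l * Polynomial.coeff q l"
      by (simp add: coeff_higher_pderiv pochhammer_fact)
    finally show ?thesis using a by simp
  qed
  have "zint (legendre_poly l * q) = 1 / (2 ^ l * fact l) * zint ((pderiv ^^ l) ((- wpol) ^ l) * q)"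
    by (simp add: legendre_poly_def wpol_neg zint_smult)
  also have "zint ((pderiv ^^ l) ((- wpol) ^ l) * q) = (-1) ^ l * zint ((pderiv ^^ l) q * (- wpol) ^ l)"
  proof -
    have "wpol ^ l dvd (- wpol) ^ l" by (simp add: dvd_power_same)
    from zint_higher_pderiv[OF this, of q] show ?thesis
      by (simp add: mult.commute flip: mult.assoc power_add)
  qed
  also have "(pderiv ^^ l) q * (- wpol) ^ l = Polynomial.smult ((-1) ^ l * (fact l * Polynomial.coeff q l)) (wpol ^ l)"
    unfolding d by (cases "even l") auto
  also have "(-1) ^ l * zint \<dots> = fact l * Polynomial.coeff q l * zint (wpol ^ l)"
    unfolding zint_smult by (simp flip: mult.assoc power_mult_distrib)
  finally show ?thesis by simp
qed

abbreviation legendre_deriv :: "nat \<Rightarrow> nat \<Rightarrow> real poly" where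
  "legendre_deriv l m \<equiv> (pderiv ^^ m) (legendre_poly l)"

text \<open>Integration by parts \<open>m\<close> times moves all derivatives to a polynomial of degree at most \<open>k\<close>.\<close>
lemma zint_assoc_legendre_le:
  assumes "k \<le> l" "m \<le> k"
  shows "zint (legendre_deriv l m * legendre_deriv k m * wpol ^ m)
      = (if l = k then 4 * pi / (2 * real l + 1) * (fact (l + m) / fact (l - m)) else 0)"
proof -
  define q where "q = (pderiv ^^ m) (wpol ^ m * legendre_deriv k m)"
  have "Polynomial.degree (wpol ^ m * legendre_deriv k m) \<le> k + m"
    using degree_mult_le[of "wpol ^ m" "legendre_deriv k m"] assms
    by (simp add: degree_wpol_power degree_higher_pderiv degree_legendre)
  hence dq: "Polynomial.degree q \<le> k"
    by (simp add: q_def degree_higher_pderiv)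
  have cw: "Polynomial.coeff (wpol ^ m * legendre_deriv k m) (2 * m + (k - m)) = (-1) ^ m * Polynomial.coeff (legendre_deriv k m) (k - m)"
  proof -
    have "Polynomial.coeff (wpol ^ m) (2 * m) = (-1) ^ m"
      using lead_coeff_power[of wpol m] by (simp add: degree_wpol_power) (simp add: wpol_def)
    thus ?thesis
      using coeff_mult_degree_sum[of "wpol ^ m" "legendre_deriv k m"]
      by (simp add: degree_wpol_power degree_higher_pderiv degree_legendre)
  qed
  have ph: "pochhammer (real (Suc a)) b = fact (a + b) / fact a" for a b
    using pochhammer_product'[of "1 :: real" a b] by (simp add: pochhammer_fact[symmetric] field_simps)
  have cq: "Polynomial.coeff q k = (-1) ^ m * (fact (k + m) / fact (k - m) * Polynomial.coeff (legendre_poly k) k)"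
  proof -
    have "Polynomial.coeff q k = pochhammer (real (Suc k)) m * Polynomial.coeff (wpol ^ m * legendre_deriv k m) (k + m)"
      by (simp add: q_def coeff_higher_pderiv)
    also have "k + m = 2 * m + (k - m)" using assms by simp
    also note cw
    also have "Polynomial.coeff (legendre_deriv k m) (k - m) = pochhammer (real (Suc (k - m))) m * Polynomial.coeff (legendre_poly k) k"
      using assms by (simp add: coeff_higher_pderiv)
    finally show ?thesis unfolding ph using assms by (simp add: field_simps)
  qed
  have "zint (legendre_deriv l m * legendre_deriv k m * wpol ^ m) = zint (legendre_deriv l m * (wpol ^ m * legendre_deriv k m))"
    by (simp add: mult_ac)
  also have "\<dots> = (-1) ^ m * zint (legendre_poly l * q)"
    unfolding q_def by (rule zint_higher_pderiv) simp
  also have "zint (legendre_poly l * q) = Polynomial.coeff q l / 2 ^ l * zint (wpol ^ l)"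
    using dq assms by (intro zint_legendre) auto
  finally have *: "zint (legendre_deriv l m * legendre_deriv k m * wpol ^ m) = (-1) ^ m * (Polynomial.coeff q l / 2 ^ l * zint (wpol ^ l))" .
  show ?thesis
  proof (cases "l = k")
    case True
    have "(4::real) ^ l = 2 ^ l * 2 ^ l" by (simp flip: power_mult_distrib)
    moreover have "(-1) ^ m * ((-1) ^ m * x) = (x::real)" for x
      by (simp flip: mult.assoc power_mult_distrib)
    ultimately have "zint (legendre_deriv l m * legendre_deriv k m * wpol ^ m)
        = fact (k + m) / fact (k - m) * (fact (2 * k) / (2 ^ k * fact k * fact k)) / 2 ^ k
          * (4 * pi * (2 ^ k * 2 ^ k) * (fact k)\<^sup>2 / ((2 * real k + 1) * fact (2 * k)))"
      unfolding * using True cq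
      by (simp only: lead_coeff_legendre zint_wpol_power) (simp add: algebra_simps)
    also have "\<dots> = 4 * pi / (2 * real k + 1) * (fact (k + m) / fact (k - m))"
    proof -
      have aux: "F * (f / (w * h * h)) / w * (4 * pi * (w * w) * h\<^sup>2 / (c * f)) = 4 * pi / c * F"
        if "f \<noteq> 0" "w \<noteq> 0" "h \<noteq> 0" for F f w h c :: real
        using that by (simp add: power2_eq_square)
      show ?thesis by (rule aux) simp_all
    qed
    finally show ?thesis using True by simp
  next
    case False
    hence "Polynomial.coeff q l = 0" using dq assms by (intro coeff_eq_0) simp
    thus ?thesis using False * by simp
  qed
qed

lemma zint_assoc_legendre:
  assumes "m \<le> k" "m \<le> l"
  shows "zint (legendre_deriv l m * legendre_deriv k m * wpol ^ m)
      = (if l = k then 4 * pi / (2 * real l + 1) * (fact (l + m) / fact (l - m)) else 0)"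
proof (cases "k \<le> l")
  case True
  thus ?thesis using zint_assoc_legendre_le assms by blast
next
  case False
  thus ?thesis using zint_assoc_legendre_le[of l k m] assms
    by (auto simp: mult.commute[of "legendre_deriv l m" "legendre_deriv k m"])
qed

lemma pderiv_parity:
  fixes p :: "real poly"
  assumes "\<And>x. poly p (- x) = s * poly p x"
  shows "poly (pderiv p) (- x) = - s * poly (pderiv p) x"
proof -
  have "pcompose p [:0, -1:] = Polynomial.smult s p"
    unfolding poly_eq_poly_eq_iff[symmetric] fun_eq_iff by (simp add: poly_pcompose assms)
  hence "pderiv (pcompose p [:0, -1:]) = Polynomial.smult s (pderiv p)" by (simp add: pderiv_smult)
  hence "- poly (pderiv p) (-x) = s * poly (pderiv p) x"
    by (simp add: pderiv_pcompose pderiv_pCons poly_eq_poly_eq_iff[symmetric] fun_eq_iff poly_pcompose)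
  thus ?thesis by simp
qed

lemma higher_pderiv_parity:
  fixes p :: "real poly"
  assumes "\<And>x. poly p (- x) = s * poly p x"
  shows "poly ((pderiv ^^ m) p) (- x) = (-1) ^ m * s * poly ((pderiv ^^ m) p) x"
proof (induction m arbitrary: x)
  case (Suc m)
  show ?case using pderiv_parity[OF Suc.IH] by simp
qed (simp add: assms)

text \<open>The polynomial in Rodrigues' formula is even and is differentiated \<open>l + m\<close>
  times, each derivative reversing the parity. This is the behaviour of a harmonic under reflection
  in direction \<open>e_3\<close>.\<close>

lemma legendre_deriv_parity:
  "poly (legendre_deriv l m) (- x) = (-1) ^ (l + m) * poly (legendre_deriv l m) x"
proof -
  have "poly ([:-1, 0, 1:] ^ l) (- x) = 1 * poly ([:-1, 0, 1:] ^ l) x" for x :: real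
    by simp
  from higher_pderiv_parity[OF this, of l]
  have "poly (legendre_poly l) (- x) = (-1) ^ l * poly (legendre_poly l) x" for x
    by (simp add: legendre_poly_def)
  from higher_pderiv_parity[OF this, of m x] show ?thesis by (simp add: power_add mult_ac)
qed

section \<open>Orthonormality of the spherical harmonics\<close>

text \<open>On the sphere this is \<open>sqrt (1 - z^2)\<close> times the unit complex number at the
  azimuth. Powers of it express the trigonometric factors as polynomials in \<open>x\<close> and
  \<open>y\<close>.\<close>

definition wc :: "real ^ 3 \<Rightarrow> complex" where
  "wc \<Omega> = complex_of_real (\<Omega> $ 1) + \<i> * complex_of_real (\<Omega> $ 2)"

lemma wc_sel [simp]: "Re (wc \<Omega>) = \<Omega> $ 1" "Im (wc \<Omega>) = \<Omega> $ 2"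
  by (simp_all add: wc_def)

lemma continuous_wc [continuous_intros]: "continuous_on S wc"
  unfolding wc_def[abs_def] by (intro continuous_intros)

lemma norm_wc_sphere:
  assumes "\<Omega> \<in> sphere 0 1"
  shows "(cmod (wc \<Omega>))\<^sup>2 = poly wpol (\<Omega> $ 3)" "cmod (wc \<Omega>) = sqrt (1 - (\<Omega> $ 3)\<^sup>2)"
proof -
  have "(\<Omega> $ 1)\<^sup>2 + (\<Omega> $ 2)\<^sup>2 = 1 - (\<Omega> $ 3)\<^sup>2" using assms unfolding sphere_3_eq by simp
  thus "(cmod (wc \<Omega>))\<^sup>2 = poly wpol (\<Omega> $ 3)" "cmod (wc \<Omega>) = sqrt (1 - (\<Omega> $ 3)\<^sup>2)"
    by (simp add: cmod_power2 poly_wpol, simp add: cmod_def)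
qed

text \<open>The azimuthal factor of a harmonic with the \<open>sqrt (1 - z^2) ^ |k|\<close> of the
  associated Legendre function absorbed, hence a homogeneous polynomial of degree \<open>|k|\<close>
  in \<open>x\<close> and \<open>y\<close>.\<close>

definition ang :: "int \<Rightarrow> real ^ 3 \<Rightarrow> real" where
  "ang k \<Omega> = (if k > 0 then Re (wc \<Omega> ^ nat \<bar>k\<bar>)
      else if k = 0 then 1 / sqrt 2 else Im (wc \<Omega> ^ nat \<bar>k\<bar>))"

definition sph_norm :: "nat \<Rightarrow> nat \<Rightarrow> real" where
  "sph_norm l m = sqrt ((2 * real l + 1) / (2 * pi) * (fact (l - m) / fact (l + m)))"

lemma sph_norm_pos: "sph_norm l m > 0"
  by (simp add: sph_norm_def)

definition sph_poly :: "nat \<times> int \<Rightarrow> real ^ 3 \<Rightarrow> real" where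
  "sph_poly = (\<lambda>(l, k) \<Omega>. sph_norm l (nat \<bar>k\<bar>) * poly (legendre_deriv l (nat \<bar>k\<bar>)) (\<Omega> $ 3) * ang k \<Omega>)"

text \<open>De Moivre's formula for \<open>wc\<close>. The two phases \<open>(-1) ^ m\<close>, of
  the normalisation and of the associated Legendre function, cancel. At the poles the azimuth is
  conventional, but there \<open>r = 0\<close> and the polar form of \<open>wc\<close> still
  holds.\<close>

lemma sph_harm_eq_sph_poly:
  assumes S: "\<Omega> \<in> sphere 0 1"
  shows "sph_harm p \<Omega> = sph_poly p \<Omega>"
proof -
  obtain l k where p: "p = (l, k)" by fastforce
  define m where "m = nat \<bar>k\<bar>"
  define r where "r = sqrt (1 - (\<Omega> $ 3)\<^sup>2)"
  have w: "wc \<Omega> = Complex (\<Omega> $ 1) (\<Omega> $ 2)" by (simp add: complex_eq_iff)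
  have "wc \<Omega> = rcis r (azimuth \<Omega>)"
    using rcis_cmod_Arg[of "wc \<Omega>"] norm_wc_sphere(2)[OF S] by (simp add: w azimuth_def r_def)
  hence wm: "wc \<Omega> ^ m = rcis (r ^ m) (real m * azimuth \<Omega>)" by (simp add: DeMoivre2)
  have km: "real m = \<bar>real_of_int k\<bar>" by (simp add: m_def)
  have sg: "(-1) ^ m * a * ((-1) ^ m * b * c) * d = a * (c * (b * d))" for a b c d :: real
    by (cases "even m") auto
  have "sph_harm p \<Omega> = sph_norm l m * (poly (legendre_deriv l m) (\<Omega> $ 3) * (r ^ m *
     (if k > 0 then cos (real m * azimuth \<Omega>) else if k = 0 then 1 / sqrt 2 else sin (real m * azimuth \<Omega>))))"
    unfolding p sph_harm_def prod.case sph_const_def assoc_legendre_def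
      sph_norm_def[symmetric] m_def[symmetric] km[symmetric] r_def[symmetric]
    by (simp only: sg)
  also have "r ^ m * (if k > 0 then cos (real m * azimuth \<Omega>) else if k = 0 then 1 / sqrt 2 else sin (real m * azimuth \<Omega>)) = ang k \<Omega>"
    unfolding ang_def m_def[symmetric] wm by (simp add: m_def)
  finally show ?thesis by (simp add: p sph_poly_def m_def)
qed

lemma wc_rot_xy: "wc (rot_xy (cos t) (sin t) \<Omega>) = cis t * wc \<Omega>"
  by (simp add: complex_eq_iff)

text \<open>Rotation about \<open>e_3\<close> by the angle \<open>pi / (a - b)\<close> multiplies
  \<open>w^a * cnj w ^ b\<close> by -1 and fixes the third coordinate, so each integral equals its
  own negative.\<close>

lemma wc_moment_0:
  assumes ab: "a \<noteq> b"
  shows "(LINT \<Omega>|usph. poly q (\<Omega> $ 3) * Re (wc \<Omega> ^ a * cnj (wc \<Omega>) ^ b)) = 0"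
    and "(LINT \<Omega>|usph. poly q (\<Omega> $ 3) * Im (wc \<Omega> ^ a * cnj (wc \<Omega>) ^ b)) = 0"
proof -
  define t where "t = pi / (real a - real b)"
  have d: "real a * t - real b * t = pi"
  proof -
    have "(real a - real b) * t = pi" using ab by (simp add: t_def)
    thus ?thesis by (simp add: left_diff_distrib)
  qed
  have e: "wc (rot_xy (cos t) (sin t) \<Omega>) ^ a * cnj (wc (rot_xy (cos t) (sin t) \<Omega>)) ^ b
      = - (wc \<Omega> ^ a * cnj (wc \<Omega>) ^ b)" for \<Omega>
  proof -
    have "cis t ^ a * cnj (cis t) ^ b = cis (real a * t) * cis (real b * (- t))"
      by (simp only: cis_cnj Complex.DeMoivre)
    also have "\<dots> = cis (real a * t - real b * t)" by (simp add: cis_mult)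
    also have "\<dots> = -1" unfolding d by simp
    finally have "cis t ^ a * cnj (cis t) ^ b = -1" .
    moreover have "wc (rot_xy (cos t) (sin t) \<Omega>) ^ a * cnj (wc (rot_xy (cos t) (sin t) \<Omega>)) ^ b
      = (cis t ^ a * cnj (cis t) ^ b) * (wc \<Omega> ^ a * cnj (wc \<Omega>) ^ b)"
      unfolding wc_rot_xy complex_cnj_mult power_mult_distrib by (simp only: mult_ac)
    ultimately show ?thesis by simp
  qed
  note T = orthogonal_rot_xy[of "cos t" "sin t"]
  have "(LINT \<Omega>|usph. poly q (\<Omega> $ 3) * Re (wc \<Omega> ^ a * cnj (wc \<Omega>) ^ b))
    = (LINT \<Omega>|usph. - (poly q (\<Omega> $ 3) * Re (wc \<Omega> ^ a * cnj (wc \<Omega>) ^ b)))"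
    by (rule integral_usph_rotate[OF T])
       (simp, intro continuous_intros, simp only: e rot_xy_nth uminus_complex.sel mult_minus_right)
  thus "(LINT \<Omega>|usph. poly q (\<Omega> $ 3) * Re (wc \<Omega> ^ a * cnj (wc \<Omega>) ^ b)) = 0" by simp
  have "(LINT \<Omega>|usph. poly q (\<Omega> $ 3) * Im (wc \<Omega> ^ a * cnj (wc \<Omega>) ^ b))
    = (LINT \<Omega>|usph. - (poly q (\<Omega> $ 3) * Im (wc \<Omega> ^ a * cnj (wc \<Omega>) ^ b)))"
    by (rule integral_usph_rotate[OF T])
       (simp, intro continuous_intros, simp only: e rot_xy_nth uminus_complex.sel mult_minus_right)
  thus "(LINT \<Omega>|usph. poly q (\<Omega> $ 3) * Im (wc \<Omega> ^ a * cnj (wc \<Omega>) ^ b)) = 0" by simp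
qed

lemma wc_power_cnj: "wc \<Omega> ^ a * cnj (wc \<Omega>) ^ a = complex_of_real ((cmod (wc \<Omega>))\<^sup>2 ^ a)"
  by (simp only: power_mult_distrib[symmetric] complex_norm_square[symmetric] of_real_power)

lemma wc_moment_Re:
  "(LINT \<Omega>|usph. poly q (\<Omega> $ 3) * Re (wc \<Omega> ^ a * cnj (wc \<Omega>) ^ b)) = (if a = b then zint (q * wpol ^ a) else 0)"
proof (cases "a = b")
  case True
  have "(LINT \<Omega>|usph. poly q (\<Omega> $ 3) * Re (wc \<Omega> ^ a * cnj (wc \<Omega>) ^ b)) = zint (q * wpol ^ a)"
    unfolding zint_def
  proof (rule integral_usph_cong)
    fix \<Omega> :: "real ^ 3" assume "\<Omega> \<in> sphere 0 1"
    thus "poly q (\<Omega> $ 3) * Re (wc \<Omega> ^ a * cnj (wc \<Omega>) ^ b) = poly (q * wpol ^ a) (\<Omega> $ 3)"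
      unfolding True[symmetric] wc_power_cnj Re_complex_of_real by (simp add: norm_wc_sphere(1))
  qed
  thus ?thesis using True by simp
next
  case False
  thus ?thesis by (simp only: wc_moment_0(1)[OF False] if_False)
qed

lemma wc_moment_Im:
  "(LINT \<Omega>|usph. poly q (\<Omega> $ 3) * Im (wc \<Omega> ^ a * cnj (wc \<Omega>) ^ b)) = 0"
proof (cases "a = b")
  case True
  show ?thesis unfolding True wc_power_cnj Im_complex_of_real by simp
qed (rule wc_moment_0(2))

text \<open>Product-to-sum formulas in complex form. The factor \<open>cnj 1 ^ 0\<close> is 1 and
  imitates the shape \<open>w^a * cnj w ^ b\<close> of the moments.\<close>

lemma Re_mult_Re: "Re u * Re v = (Re (u * v * cnj 1 ^ 0) + Re (u * cnj v)) / 2"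
  and Im_mult_Im: "Im u * Im v = (Re (u * cnj v) - Re (u * v)) / 2"
  and Re_mult_Im: "Re u * Im v = (Im (u * v) - Im (u * cnj v)) / 2"
  by (simp_all add: algebra_simps)

text \<open>Product-to-sum formulas leave half the moments with exponents \<open>(i + j, 0)\<close>
  and \<open>(i, j)\<close>, of which only those with equal exponents survive. The factor
  \<open>1 / sqrt 2\<close> at \<open>k = 0\<close>, where both of them contribute, is what makes
  the value \<open>1 / 2\<close> uniform in \<open>k\<close>.\<close>

lemma ang_moment:
  "(LINT \<Omega>|usph. poly q (\<Omega> $ 3) * (ang k \<Omega> * ang k' \<Omega>)) = (if k = k' then zint (q * wpol ^ nat \<bar>k\<bar>) / 2 else 0)"
proof -
  let ?R = "\<lambda>a b \<Omega>. poly q (\<Omega> $ 3) * Re (wc \<Omega> ^ a * cnj (wc \<Omega>) ^ b)"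
  let ?I = "\<lambda>a b \<Omega>. poly q (\<Omega> $ 3) * Im (wc \<Omega> ^ a * cnj (wc \<Omega>) ^ b)"
  have cR: "continuous_on (sphere 0 1) (?R i j)" and cI: "continuous_on (sphere 0 1) (?I i j)" for i j
    by (intro continuous_intros)+
  have RR: "(LINT \<Omega>|usph. poly q (\<Omega> $ 3) * (Re (wc \<Omega> ^ i) * Re (wc \<Omega> ^ j)))
      = (LINT \<Omega>|usph. ?R (i + j) 0 \<Omega>) / 2 + (LINT \<Omega>|usph. ?R i j \<Omega>) / 2" for i j
  proof -
    have "(LINT \<Omega>|usph. poly q (\<Omega> $ 3) * (Re (wc \<Omega> ^ i) * Re (wc \<Omega> ^ j)))
       = (LINT \<Omega>|usph. (1/2) * ?R (i + j) 0 \<Omega> + (1/2) * ?R i j \<Omega>)"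
      by (rule integral_usph_cong) (simp add: Re_mult_Re power_add complex_cnj_power[symmetric] del: times_complex.sel complex_cnj_power, simp add: algebra_simps del: times_complex.sel)
    thus ?thesis by (simp only: integral_usph_linear[OF cR cR], simp?)
  qed
  have II: "(LINT \<Omega>|usph. poly q (\<Omega> $ 3) * (Im (wc \<Omega> ^ i) * Im (wc \<Omega> ^ j)))
      = (LINT \<Omega>|usph. ?R i j \<Omega>) / 2 - (LINT \<Omega>|usph. ?R (i + j) 0 \<Omega>) / 2" for i j
  proof -
    have "(LINT \<Omega>|usph. poly q (\<Omega> $ 3) * (Im (wc \<Omega> ^ i) * Im (wc \<Omega> ^ j)))
       = (LINT \<Omega>|usph. (1/2) * ?R i j \<Omega> + (-1/2) * ?R (i + j) 0 \<Omega>)"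
      by (rule integral_usph_cong) (simp add: Im_mult_Im power_add complex_cnj_power[symmetric] del: times_complex.sel complex_cnj_power, simp add: algebra_simps del: times_complex.sel)
    thus ?thesis by (simp only: integral_usph_linear[OF cR cR], simp?)
  qed
  have RI: "(LINT \<Omega>|usph. poly q (\<Omega> $ 3) * (Re (wc \<Omega> ^ i) * Im (wc \<Omega> ^ j)))
      = (LINT \<Omega>|usph. ?I (i + j) 0 \<Omega>) / 2 - (LINT \<Omega>|usph. ?I i j \<Omega>) / 2" for i j
  proof -
    have "(LINT \<Omega>|usph. poly q (\<Omega> $ 3) * (Re (wc \<Omega> ^ i) * Im (wc \<Omega> ^ j)))
       = (LINT \<Omega>|usph. (1/2) * ?I (i + j) 0 \<Omega> + (-1/2) * ?I i j \<Omega>)"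
      by (rule integral_usph_cong) (simp add: Re_mult_Im power_add complex_cnj_power[symmetric] del: times_complex.sel complex_cnj_power, simp add: algebra_simps del: times_complex.sel)
    thus ?thesis by (simp only: integral_usph_linear[OF cI cI], simp?)
  qed
  have Rj: "(LINT \<Omega>|usph. poly q (\<Omega> $ 3) * Re (wc \<Omega> ^ j)) = (if j = 0 then zint q else 0)"
   and Ij: "(LINT \<Omega>|usph. poly q (\<Omega> $ 3) * Im (wc \<Omega> ^ j)) = 0" for j
    using wc_moment_Re[of q j 0] wc_moment_Im[of q j 0] by auto
  have IR: "(LINT \<Omega>|usph. poly q (\<Omega> $ 3) * (Im (wc \<Omega> ^ i) * Re (wc \<Omega> ^ j))) = 0" for i j
    unfolding mult.commute[of "Im _"] RI wc_moment_Im by simp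
  note moments = RR[unfolded wc_moment_Re] II[unfolded wc_moment_Re] RI[unfolded wc_moment_Im] IR
  have s2: "1 / sqrt 2 * (1 / sqrt 2) = (1 / 2 :: real)" by simp
  consider "k > 0" | "k = 0" | "k < 0" by linarith
  thus ?thesis
  proof cases
    assume k: "k > 0"
    consider "k' > 0" | "k' = 0" | "k' < 0" by linarith
    thus ?thesis
      using k by cases (auto simp: ang_def moments Rj)
  next
    assume k: "k = 0"
    consider "k' > 0" | "k' = 0" | "k' < 0" by linarith
    thus ?thesis
      using k by cases (auto simp: ang_def moments Rj Ij zint_def s2)
  next
    assume k: "k < 0"
    consider "k' > 0" | "k' = 0" | "k' < 0" by linarith
    thus ?thesis
      using k by cases (auto simp: ang_def moments Ij )
  qed
qed

lemma continuous_ang [continuous_intros]: "continuous_on S (ang k)"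
  unfolding ang_def[abs_def] by (cases "k > 0"; cases "k = 0") (auto intro!: continuous_intros)

lemma continuous_sph_poly [continuous_intros]: "continuous_on S (sph_poly p)"
  unfolding sph_poly_def by (cases p) (auto intro!: continuous_intros)

lemma continuous_sph_harm [continuous_intros]: "continuous_on (sphere 0 1) (sph_harm p)"
  using continuous_sph_poly[of "sphere 0 1" p] by (rule continuous_on_eq) (simp add: sph_harm_eq_sph_poly)

lemma set_sph_idx: "set (sph_idx N) = {(l, k). l \<le> N \<and> \<bar>k\<bar> \<le> int l}"
  unfolding sph_idx_def by (auto simp: image_iff simp del: upt_Suc)

lemma distinct_sph_idx: "distinct (sph_idx N)"
proof (induction N)
  case (Suc N)
  have "sph_idx (Suc N) = sph_idx N @ map (Pair (Suc N)) [- int (Suc N)..int (Suc N)]"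
    by (simp add: sph_idx_def)
  moreover have "distinct (map (Pair (Suc N)) [- int (Suc N)..int (Suc N)])"
    by (simp add: distinct_map inj_on_def)
  moreover have "set (sph_idx N) \<inter> set (map (Pair (Suc N)) [- int (Suc N)..int (Suc N)]) = {}"
    unfolding set_sph_idx by auto
  ultimately show ?case using Suc.IH by simp
qed (simp add: sph_idx_def)

lemma length_sph_idx: "length (sph_idx N) = (N + 1)\<^sup>2"
  by (induction N) (simp_all add: sph_idx_def power2_eq_square nat_add_distrib)

text \<open>The squared normalisation \<open>(2 l + 1) / (2 pi) * (l - m)! / (l + m)!\<close> is the
  reciprocal of the Legendre norm \<open>4 pi / (2 l + 1) * (l + m)! / (l - m)!\<close> multiplied
  by the azimuthal factor \<open>1 / 2\<close>.\<close>

lemma sph_harm_orthonormal: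
  assumes "p \<in> set (sph_idx N)" "p' \<in> set (sph_idx N)"
  shows "(LINT \<Omega>|usph. sph_harm p \<Omega> * sph_harm p' \<Omega>) = (if p = p' then 1 else 0)"
proof -
  obtain l k l' k' where p: "p = (l, k)" "p' = (l', k')" by fastforce
  define m where "m = nat \<bar>k\<bar>"
  have km: "nat \<bar>k\<bar> \<le> l" "nat \<bar>k'\<bar> \<le> l'" using assms by (auto simp: p set_sph_idx)
  let ?q = "legendre_deriv l (nat \<bar>k\<bar>) * legendre_deriv l' (nat \<bar>k'\<bar>)"
  have "(LINT \<Omega>|usph. sph_harm p \<Omega> * sph_harm p' \<Omega>)
     = (LINT \<Omega>|usph. (sph_norm l (nat \<bar>k\<bar>) * sph_norm l' (nat \<bar>k'\<bar>)) * (poly ?q (\<Omega> $ 3) * (ang k \<Omega> * ang k' \<Omega>)))"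
    by (rule integral_usph_cong) (simp add: sph_harm_eq_sph_poly p sph_poly_def)
  also have "\<dots> = (sph_norm l (nat \<bar>k\<bar>) * sph_norm l' (nat \<bar>k'\<bar>)) * (if k = k' then zint (?q * wpol ^ nat \<bar>k\<bar>) / 2 else 0)"
    by (simp only: integral_mult_right_zero ang_moment)
  also have "\<dots> = (if p = p' then 1 else 0)"
  proof (cases "k = k'")
    case True
    have n2: "sph_norm l m * sph_norm l m = (2 * real l + 1) / (2 * pi) * (fact (l - m) / fact (l + m))"
      by (simp add: sph_norm_def)
    have aux: "c / (2 * pi) * (f / g) * (4 * pi / c * (g / f) / 2) = 1" if "c \<noteq> 0" "f \<noteq> 0" "g \<noteq> 0" for c f g :: real
      using that by simp
    have nz: "2 * real l + 1 \<noteq> 0" using of_nat_0_le_iff[of l, where ?'a = real] by linarith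
    have "sph_norm l m * sph_norm l m * (4 * pi / (2 * real l + 1) * (fact (l + m) / fact (l - m)) / 2) = 1"
      unfolding n2 by (intro aux nz fact_nonzero)
    hence n3: "sph_norm l m * sph_norm l m * (zint (legendre_deriv l m * legendre_deriv l m * wpol ^ m) / 2) = 1"
      using zint_assoc_legendre[of m l l] km by (simp only: m_def if_True refl)
    show ?thesis
    proof (cases "l = l'")
      case t: True
      show ?thesis
        unfolding p True[symmetric] t[symmetric] m_def[symmetric] using n3 by (simp only: if_True refl)
    next
      case False
      thus ?thesis using zint_assoc_legendre[of m l' l] km True by (simp add: p m_def)
    qed
  qed (simp add: p)
  finally show ?thesis .
qed

section \<open>Completeness and parity\<close>

text \<open>Polynomial functions on the whole space, with \<open>n\<close> an upper bound for the
  degree. The inductive form allows proofs by rule induction and requires no normal form; the rule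
  for constants applies at every \<open>n\<close>, so the classes increase with
  \<open>n\<close>.\<close>

inductive polyf :: "nat \<Rightarrow> (real ^ 3 \<Rightarrow> real) \<Rightarrow> bool" where
  const: "polyf n (\<lambda>_. c)"
| add: "polyf n f \<Longrightarrow> polyf n g \<Longrightarrow> polyf n (\<lambda>\<Omega>. f \<Omega> + g \<Omega>)"
| coord: "polyf n f \<Longrightarrow> polyf (Suc n) (\<lambda>\<Omega>. \<Omega> $ j * f \<Omega>)"

lemma polyf_cmult: "polyf n f \<Longrightarrow> polyf n (\<lambda>\<Omega>. c * f \<Omega>)"
proof (induction rule: polyf.induct)
  case (coord n f j)
  from polyf.coord[OF coord.IH, of j] show ?case by (simp add: mult.left_commute)
qed (auto simp: distrib_left intro: polyf.intros)

lemma polyf_Suc: "polyf n f \<Longrightarrow> polyf (Suc n) f"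
  by (induction rule: polyf.induct) (auto intro: polyf.intros)

lemma polyf_mono: "n \<le> m \<Longrightarrow> polyf n f \<Longrightarrow> polyf m f"
  by (induction m rule: dec_induct) (auto intro: polyf_Suc)

lemma polyf_diff: "polyf n f \<Longrightarrow> polyf n g \<Longrightarrow> polyf n (\<lambda>\<Omega>. f \<Omega> - g \<Omega>)"
  using polyf.add[OF _ polyf_cmult[of n g "-1"], of f] by simp

lemma polyf_sum: "(\<And>x. x \<in> A \<Longrightarrow> polyf n (f x)) \<Longrightarrow> polyf n (\<lambda>\<Omega>. \<Sum>x\<in>A. f x \<Omega>)"
  by (induction A rule: infinite_finite_induct) (auto intro: polyf.intros)

lemma polyf_mult: "polyf m f \<Longrightarrow> polyf n g \<Longrightarrow> polyf (m + n) (\<lambda>\<Omega>. f \<Omega> * g \<Omega>)"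
proof (induction rule: polyf.induct)
  case (const m c)
  thus ?case using polyf_mono[of n "m + n"] polyf_cmult by simp
next
  case (coord m f j)
  from polyf.coord[OF coord.IH[OF coord.prems], of j] show ?case by (simp add: mult.assoc)
qed (auto simp: distrib_right intro: polyf.intros)

lemma polyf_continuous: "polyf n f \<Longrightarrow> continuous_on S f"
  by (induction rule: polyf.induct) (auto intro!: continuous_intros)

lemma polyf_nth: "polyf 1 (\<lambda>\<Omega>. \<Omega> $ j)"
  using polyf.coord[OF polyf.const[of 0 1], of j] by simp

lemma polyf_poly: "polyf (Polynomial.degree q) (\<lambda>\<Omega>. poly q (\<Omega> $ 3))"
proof (induction q)
  case 0
  show ?case by (simp add: polyf.const)
next
  case (pCons a q)
  show ?case
  proof (cases "q = 0")
    case False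
    have "polyf (Suc (Polynomial.degree q)) (\<lambda>\<Omega>. a + \<Omega> $ 3 * poly q (\<Omega> $ 3))"
      by (intro polyf.intros pCons.IH)
    thus ?thesis using False by simp
  qed (simp add: polyf.const)
qed

lemma polyf_wc_power: "polyf m (\<lambda>\<Omega>. Re (wc \<Omega> ^ m)) \<and> polyf m (\<lambda>\<Omega>. Im (wc \<Omega> ^ m))"
proof (induction m)
  case 0
  show ?case by (simp add: polyf.const)
next
  case (Suc m)
  thus ?case by (auto intro!: polyf_diff polyf.intros)
qed

lemma polyf_ang: "polyf (nat \<bar>k\<bar>) (ang k)"
  unfolding ang_def[abs_def] using polyf_wc_power[of "nat \<bar>k\<bar>"]
  by (cases "k > 0"; cases "k = 0") (auto intro: polyf.const)

lemma polyf_sph_poly: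
  assumes "\<bar>k\<bar> \<le> int l"
  shows "polyf l (sph_poly (l, k))"
proof -
  have "polyf ((l - nat \<bar>k\<bar>) + nat \<bar>k\<bar>) (\<lambda>\<Omega>. (sph_norm l (nat \<bar>k\<bar>) * poly (legendre_deriv l (nat \<bar>k\<bar>)) (\<Omega> $ 3)) * ang k \<Omega>)"
    using polyf_poly[of "legendre_deriv l (nat \<bar>k\<bar>)"]
    by (intro polyf_mult polyf_cmult polyf_ang) (simp add: degree_higher_pderiv degree_legendre)
  thus ?thesis using assms by (simp add: sph_poly_def)
qed

section \<open>Polynomials on the sphere are spanned by harmonics\<close>

definition sph_span :: "nat \<Rightarrow> (real ^ 3 \<Rightarrow> real) \<Rightarrow> bool" where
  "sph_span n f \<longleftrightarrow> (\<exists>c. \<forall>\<Omega>\<in>sphere 0 1. f \<Omega> = (\<Sum>p\<in>set (sph_idx n). c p * sph_harm p \<Omega>))"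

lemma sph_span_cong: "sph_span n f \<Longrightarrow> (\<And>\<Omega>. \<Omega> \<in> sphere 0 1 \<Longrightarrow> g \<Omega> = f \<Omega>) \<Longrightarrow> sph_span n g"
  unfolding sph_span_def by simp

lemma sph_span_0: "sph_span n (\<lambda>_. 0)"
  unfolding sph_span_def by (rule exI[of _ "\<lambda>_. 0"]) simp

lemma sph_span_add: "sph_span n f \<Longrightarrow> sph_span n g \<Longrightarrow> sph_span n (\<lambda>\<Omega>. f \<Omega> + g \<Omega>)"
proof -
  assume "sph_span n f" "sph_span n g"
  then obtain c d where "\<forall>\<Omega>\<in>sphere 0 1. f \<Omega> = (\<Sum>p\<in>set (sph_idx n). c p * sph_harm p \<Omega>)"
    "\<forall>\<Omega>\<in>sphere 0 1. g \<Omega> = (\<Sum>p\<in>set (sph_idx n). d p * sph_harm p \<Omega>)"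
    unfolding sph_span_def by blast
  thus ?thesis unfolding sph_span_def
    by (intro exI[of _ "\<lambda>p. c p + d p"]) (simp add: distrib_right sum.distrib)
qed

lemma sph_span_cmult: "sph_span n f \<Longrightarrow> sph_span n (\<lambda>\<Omega>. a * f \<Omega>)"
proof -
  assume "sph_span n f"
  then obtain c where "\<forall>\<Omega>\<in>sphere 0 1. f \<Omega> = (\<Sum>p\<in>set (sph_idx n). c p * sph_harm p \<Omega>)"
    unfolding sph_span_def by blast
  thus ?thesis unfolding sph_span_def
    by (intro exI[of _ "\<lambda>p. a * c p"]) (simp add: sum_distrib_left mult.assoc)
qed

lemma sph_span_sum: "(\<And>x. x \<in> A \<Longrightarrow> sph_span n (f x)) \<Longrightarrow> sph_span n (\<lambda>\<Omega>. \<Sum>x\<in>A. f x \<Omega>)"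
  by (induction A rule: infinite_finite_induct) (auto intro: sph_span_0 sph_span_add)

lemma sph_span_single: "p \<in> set (sph_idx n) \<Longrightarrow> sph_span n (sph_harm p)"
  unfolding sph_span_def by (rule exI[of _ "\<lambda>q. if q = p then 1 else 0"]) (simp add: if_distrib[of "\<lambda>x. x * _"] cong: if_cong)

text \<open>The coefficient of degree \<open>d\<close> is removed by a multiple of the
  \<open>m\<close>-th derivative of the Legendre polynomial of degree \<open>d + m\<close>, which
  has exact degree \<open>d\<close> and whose product with \<open>ang k\<close> is a harmonic up to
  a factor. Stating the degree bound through coefficients makes \<open>d = 0\<close> mean
  \<open>q = 0\<close>, a base case that \<open>degree\<close> cannot express.\<close>

lemma sph_span_ang_aux:
  assumes "\<And>i. i \<ge> d \<Longrightarrow> Polynomial.coeff q i = 0" "d + nat \<bar>k\<bar> \<le> Suc n"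
  shows "sph_span n (\<lambda>\<Omega>. poly q (\<Omega> $ 3) * ang k \<Omega>)"
  using assms
proof (induction d arbitrary: q)
  case 0
  hence "q = 0" by (intro poly_eqI) simp
  thus ?case by (simp add: sph_span_0)
next
  case (Suc d)
  define m where "m = nat \<bar>k\<bar>"
  define D where "D = legendre_deriv (d + m) m"
  have dD: "Polynomial.degree D = d" by (simp add: D_def degree_higher_pderiv degree_legendre)
  have D0: "Polynomial.coeff D d \<noteq> 0"
  proof -
    have "Polynomial.coeff D d = pochhammer (real (Suc d)) m * Polynomial.coeff (legendre_poly (d + m)) (d + m)"
      by (simp add: D_def coeff_higher_pderiv)
    also have "\<dots> \<noteq> 0" unfolding lead_coeff_legendre
      using pochhammer_pos[of "real (Suc d)" m] by simp
    finally show ?thesis .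
  qed
  define a where "a = Polynomial.coeff q d / Polynomial.coeff D d"
  have "sph_span n (\<lambda>\<Omega>. poly (q - Polynomial.smult a D) (\<Omega> $ 3) * ang k \<Omega>)"
  proof (rule Suc.IH)
    fix i assume "d \<le> i"
    show "Polynomial.coeff (q - Polynomial.smult a D) i = 0"
    proof (cases "i = d")
      case True
      thus ?thesis using D0 by (simp add: a_def)
    next
      case False
      thus ?thesis using Suc.prems(1)[of i] \<open>d \<le> i\<close> by (simp add: coeff_eq_0 dD)
    qed
  qed (use Suc.prems in auto)
  moreover have "sph_span n (\<lambda>\<Omega>. (a / sph_norm (d + m) m) * sph_harm (d + m, k) \<Omega>)"
    by (intro sph_span_cmult sph_span_single) (use Suc.prems in \<open>auto simp: set_sph_idx m_def\<close>)
  ultimately have "sph_span n (\<lambda>\<Omega>. poly (q - Polynomial.smult a D) (\<Omega> $ 3) * ang k \<Omega> + (a / sph_norm (d + m) m) * sph_harm (d + m, k) \<Omega>)"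
    by (rule sph_span_add)
  thus ?case
  proof (rule sph_span_cong)
    fix \<Omega> :: "real ^ 3" assume "\<Omega> \<in> sphere 0 1"
    hence "(a / sph_norm (d + m) m) * sph_harm (d + m, k) \<Omega> = a * poly D (\<Omega> $ 3) * ang k \<Omega>"
      using sph_norm_pos[of "d + m" m] by (simp add: sph_harm_eq_sph_poly sph_poly_def D_def m_def[symmetric])
    thus "poly q (\<Omega> $ 3) * ang k \<Omega> = poly (q - Polynomial.smult a D) (\<Omega> $ 3) * ang k \<Omega> + (a / sph_norm (d + m) m) * sph_harm (d + m, k) \<Omega>"
      by (simp add: algebra_simps)
  qed
qed

lemma sph_span_ang:
  "Polynomial.degree q + nat \<bar>k\<bar> \<le> n \<Longrightarrow> sph_span n (\<lambda>\<Omega>. poly q (\<Omega> $ 3) * ang k \<Omega>)"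
  by (rule sph_span_ang_aux[of "Suc (Polynomial.degree q)"]) (auto intro: coeff_eq_0)

lemma sph_span_Re:
  assumes "Polynomial.degree q + m \<le> n"
  shows "sph_span n (\<lambda>\<Omega>. poly q (\<Omega> $ 3) * Re (wc \<Omega> ^ m))"
proof (cases "m = 0")
  case True
  have "sph_span n (\<lambda>\<Omega>. sqrt 2 * (poly q (\<Omega> $ 3) * ang 0 \<Omega>))"
    using assms by (intro sph_span_cmult sph_span_ang) simp
  thus ?thesis using True by (auto simp: ang_def elim: sph_span_cong)
next
  case False
  thus ?thesis using sph_span_ang[of q "int m" n] assms by (simp add: ang_def)
qed

lemma sph_span_Im:
  assumes "Polynomial.degree q + m \<le> n"
  shows "sph_span n (\<lambda>\<Omega>. poly q (\<Omega> $ 3) * Im (wc \<Omega> ^ m))"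
proof (cases "m = 0")
  case True
  thus ?thesis by (simp add: sph_span_0)
next
  case False
  thus ?thesis using sph_span_ang[of q "- int m" n] assms by (simp add: ang_def)
qed

text \<open>Since \<open>x = (w + cnj w) / 2\<close>, \<open>y = - i (w - cnj w) / 2\<close> and
  \<open>w * cnj w = 1 - z^2\<close> on the sphere, multiplication by \<open>x\<close> or
  \<open>y\<close> shifts the azimuthal order by one in either direction.\<close>

lemma wc_mult_power_sphere:
  assumes "\<Omega> \<in> sphere 0 1"
  shows "complex_of_real (\<Omega> $ 1) * wc \<Omega> ^ Suc m = (wc \<Omega> ^ Suc (Suc m) + complex_of_real (poly wpol (\<Omega> $ 3)) * wc \<Omega> ^ m) / 2"
    and "complex_of_real (\<Omega> $ 2) * wc \<Omega> ^ Suc m = - \<i> * (wc \<Omega> ^ Suc (Suc m) - complex_of_real (poly wpol (\<Omega> $ 3)) * wc \<Omega> ^ m) / 2"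
proof -
  have n: "complex_of_real (poly wpol (\<Omega> $ 3)) = wc \<Omega> * cnj (wc \<Omega>)"
    using complex_norm_square[of "wc \<Omega>"] norm_wc_sphere(1)[OF assms] by simp
  have x: "complex_of_real (\<Omega> $ 1) = (wc \<Omega> + cnj (wc \<Omega>)) / 2"
    and y: "complex_of_real (\<Omega> $ 2) = - \<i> * (wc \<Omega> - cnj (wc \<Omega>)) / 2"
    by (simp_all add: complex_eq_iff)
  show "complex_of_real (\<Omega> $ 1) * wc \<Omega> ^ Suc m = (wc \<Omega> ^ Suc (Suc m) + complex_of_real (poly wpol (\<Omega> $ 3)) * wc \<Omega> ^ m) / 2"
    unfolding n x by (simp add: field_simps)
  show "complex_of_real (\<Omega> $ 2) * wc \<Omega> ^ Suc m = - \<i> * (wc \<Omega> ^ Suc (Suc m) - complex_of_real (poly wpol (\<Omega> $ 3)) * wc \<Omega> ^ m) / 2"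
    unfolding n y by (simp add: field_simps)
qed

lemma nth_mult_wc_power_sphere:
  assumes "\<Omega> \<in> sphere 0 1"
  shows "\<Omega> $ 1 * Re (wc \<Omega> ^ Suc m) = (Re (wc \<Omega> ^ Suc (Suc m)) + poly wpol (\<Omega> $ 3) * Re (wc \<Omega> ^ m)) / 2"
    and "\<Omega> $ 1 * Im (wc \<Omega> ^ Suc m) = (Im (wc \<Omega> ^ Suc (Suc m)) + poly wpol (\<Omega> $ 3) * Im (wc \<Omega> ^ m)) / 2"
    and "\<Omega> $ 2 * Re (wc \<Omega> ^ Suc m) = (Im (wc \<Omega> ^ Suc (Suc m)) - poly wpol (\<Omega> $ 3) * Im (wc \<Omega> ^ m)) / 2"
    and "\<Omega> $ 2 * Im (wc \<Omega> ^ Suc m) = (poly wpol (\<Omega> $ 3) * Re (wc \<Omega> ^ m) - Re (wc \<Omega> ^ Suc (Suc m))) / 2"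
proof -
  have 1: "x * Re a = (Re b + w * Re c) / 2" "x * Im a = (Im b + w * Im c) / 2"
    if "complex_of_real x * a = (b + complex_of_real w * c) / 2" for x w a b c
    using arg_cong[OF that, of Re] arg_cong[OF that, of Im] by simp_all
  have 2: "x * Re a = (Im b - w * Im c) / 2" "x * Im a = (w * Re c - Re b) / 2"
    if "complex_of_real x * a = - \<i> * (b - complex_of_real w * c) / 2" for x w a b c
    using arg_cong[OF that, of Re] arg_cong[OF that, of Im] by (simp_all add: field_simps)
  show "\<Omega> $ 1 * Re (wc \<Omega> ^ Suc m) = (Re (wc \<Omega> ^ Suc (Suc m)) + poly wpol (\<Omega> $ 3) * Re (wc \<Omega> ^ m)) / 2"
    "\<Omega> $ 1 * Im (wc \<Omega> ^ Suc m) = (Im (wc \<Omega> ^ Suc (Suc m)) + poly wpol (\<Omega> $ 3) * Im (wc \<Omega> ^ m)) / 2"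
    "\<Omega> $ 2 * Re (wc \<Omega> ^ Suc m) = (Im (wc \<Omega> ^ Suc (Suc m)) - poly wpol (\<Omega> $ 3) * Im (wc \<Omega> ^ m)) / 2"
    "\<Omega> $ 2 * Im (wc \<Omega> ^ Suc m) = (poly wpol (\<Omega> $ 3) * Re (wc \<Omega> ^ m) - Re (wc \<Omega> ^ Suc (Suc m))) / 2"
    by (rule 1 2, rule wc_mult_power_sphere[OF assms])+
qed

lemma degree_mult_wpol: "Polynomial.degree (q * wpol) \<le> Polynomial.degree q + 2"
  using degree_mult_le[of q wpol] degree_wpol_power[of 1] by simp

text \<open>The quantity \<open>degree q + m\<close> grows by at most one: \<open>z\<close> raises
  the degree of \<open>q\<close>, while \<open>x\<close> and \<open>y\<close> either raise
  \<open>m\<close> by one or lower it by one at the price of the quadratic factor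
  \<open>wpol\<close>. For \<open>m = 0\<close> nothing can be lowered, but there \<open>x\<close>
  and \<open>y\<close> are the real and imaginary parts of \<open>wc\<close> itself.\<close>

lemma sph_span_nth_Re_Im:
  assumes q: "Polynomial.degree q + m \<le> n"
  shows "sph_span (Suc n) (\<lambda>\<Omega>. \<Omega> $ j * (poly q (\<Omega> $ 3) * Re (wc \<Omega> ^ m)))"
    and "sph_span (Suc n) (\<lambda>\<Omega>. \<Omega> $ j * (poly q (\<Omega> $ 3) * Im (wc \<Omega> ^ m)))"
proof -
  have Xq: "Polynomial.degree ([:0, 1:] * q) + m \<le> Suc n"
    using degree_mult_le[of "[:0, 1:]" q] q by simp
  have lin: "x * a = (b + w * c) / 2 \<Longrightarrow> x * (q * a) = 1/2 * (q * b + q * w * c)"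
    "x * a = (b - w * c) / 2 \<Longrightarrow> x * (q * a) = 1/2 * (q * b) + -1/2 * (q * w * c)"
    "x * a = (w * c - b) / 2 \<Longrightarrow> x * (q * a) = -1/2 * (q * b) + 1/2 * (q * w * c)" for x a b c w q :: real
    by (simp_all only: mult.left_commute[of x]) (simp_all add: field_simps)
  have s: "sph_span (Suc n) (\<lambda>\<Omega>. \<Omega> $ j * (poly q (\<Omega> $ 3) * Re (wc \<Omega> ^ m))) \<and>
        sph_span (Suc n) (\<lambda>\<Omega>. \<Omega> $ j * (poly q (\<Omega> $ 3) * Im (wc \<Omega> ^ m)))"
  proof -
    consider "j = 3" | "j = 1" | "j = 2" using exhaust_3 by blast
    thus ?thesis
    proof cases
      case 1
      show ?thesis using sph_span_Re[OF Xq] sph_span_Im[OF Xq] by (simp add: 1 mult_ac)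
    next
      case j: 2
      show ?thesis
      proof (cases m)
        case 0
        thus ?thesis using sph_span_Re[of q 1 "Suc n"] q by (simp add: j mult_ac sph_span_0)
      next
        case (Suc m')
        have d: "Polynomial.degree q + Suc m \<le> Suc n" "Polynomial.degree (q * wpol) + m' \<le> Suc n"
          using q degree_mult_wpol[of q] Suc by auto
        note a = sph_span_cmult[OF sph_span_add[OF sph_span_Re[OF d(1)] sph_span_Re[OF d(2)]], of "1/2"]
        note b = sph_span_cmult[OF sph_span_add[OF sph_span_Im[OF d(1)] sph_span_Im[OF d(2)]], of "1/2"]
        show ?thesis
        proof (intro conjI; rule sph_span_cong)
          fix \<Omega> :: "real ^ 3" assume "\<Omega> \<in> sphere 0 1"
          note e = nth_mult_wc_power_sphere(1,2)[OF this, of m']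
          show "\<Omega> $ j * (poly q (\<Omega> $ 3) * Re (wc \<Omega> ^ m)) = 1/2 * (poly q (\<Omega> $ 3) * Re (wc \<Omega> ^ Suc m) + poly (q * wpol) (\<Omega> $ 3) * Re (wc \<Omega> ^ m'))"
            unfolding j Suc poly_mult by (rule lin(1)[OF e(1)])
          show "\<Omega> $ j * (poly q (\<Omega> $ 3) * Im (wc \<Omega> ^ m)) = 1/2 * (poly q (\<Omega> $ 3) * Im (wc \<Omega> ^ Suc m) + poly (q * wpol) (\<Omega> $ 3) * Im (wc \<Omega> ^ m'))"
            unfolding j Suc poly_mult by (rule lin(1)[OF e(2)])
        qed (fact a b)+
      qed
    next
      case j: 3
      show ?thesis
      proof (cases m)
        case 0
        thus ?thesis using sph_span_Im[of q 1 "Suc n"] q by (simp add: j mult_ac sph_span_0)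
      next
        case (Suc m')
        have d: "Polynomial.degree q + Suc m \<le> Suc n" "Polynomial.degree (q * wpol) + m' \<le> Suc n"
          using q degree_mult_wpol[of q] Suc by auto
        note a = sph_span_add[OF sph_span_cmult[OF sph_span_Im[OF d(1)], of "1/2"] sph_span_cmult[OF sph_span_Im[OF d(2)], of "-1/2"]]
        note b = sph_span_add[OF sph_span_cmult[OF sph_span_Re[OF d(1)], of "-1/2"] sph_span_cmult[OF sph_span_Re[OF d(2)], of "1/2"]]
        show ?thesis
        proof (intro conjI; rule sph_span_cong)
          fix \<Omega> :: "real ^ 3" assume "\<Omega> \<in> sphere 0 1"
          note e = nth_mult_wc_power_sphere(3,4)[OF this, of m']
          show "\<Omega> $ j * (poly q (\<Omega> $ 3) * Re (wc \<Omega> ^ m)) = 1/2 * (poly q (\<Omega> $ 3) * Im (wc \<Omega> ^ Suc m)) + -1/2 * (poly (q * wpol) (\<Omega> $ 3) * Im (wc \<Omega> ^ m'))"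
            unfolding j Suc poly_mult by (rule lin(2)[OF e(1)])
          show "\<Omega> $ j * (poly q (\<Omega> $ 3) * Im (wc \<Omega> ^ m)) = -1/2 * (poly q (\<Omega> $ 3) * Re (wc \<Omega> ^ Suc m)) + 1/2 * (poly (q * wpol) (\<Omega> $ 3) * Re (wc \<Omega> ^ m'))"
            unfolding j Suc poly_mult by (rule lin(3)[OF e(2)])
        qed (fact a b)+
      qed
    qed
  qed
  thus "sph_span (Suc n) (\<lambda>\<Omega>. \<Omega> $ j * (poly q (\<Omega> $ 3) * Re (wc \<Omega> ^ m)))"
    "sph_span (Suc n) (\<lambda>\<Omega>. \<Omega> $ j * (poly q (\<Omega> $ 3) * Im (wc \<Omega> ^ m)))" by auto
qed

lemma sph_span_nth_sph_harm:
  assumes "p \<in> set (sph_idx n)"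
  shows "sph_span (Suc n) (\<lambda>\<Omega>. \<Omega> $ j * sph_harm p \<Omega>)"
proof -
  obtain l k where p: "p = (l, k)" by fastforce
  define m where "m = nat \<bar>k\<bar>"
  have lk: "l \<le> n" "m \<le> l" using assms by (auto simp: p set_sph_idx m_def)
  define q where "q = legendre_deriv l m"
  have q: "Polynomial.degree q + m \<le> n"
    using lk by (simp add: q_def degree_higher_pderiv degree_legendre)
  note r = sph_span_nth_Re_Im[OF q, of j, THEN sph_span_cmult[of _ _ "sph_norm l m"]]
    sph_span_nth_Re_Im(1)[of q 0 n j, THEN sph_span_cmult[of _ _ "sph_norm l m / sqrt 2"]]
  consider "k > 0" | "k = 0" | "k < 0" by linarith
  thus ?thesis
  proof cases
    case 1
    show ?thesis
      by (rule sph_span_cong[OF r(1)]) (use 1 in \<open>simp add: sph_harm_eq_sph_poly p sph_poly_def ang_def m_def q_def\<close>)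
  next
    case 2
    show ?thesis
      by (rule sph_span_cong[OF r(3)]) (use 2 q in \<open>simp_all add: sph_harm_eq_sph_poly p sph_poly_def ang_def m_def q_def\<close>)
  next
    case 3
    show ?thesis
      by (rule sph_span_cong[OF r(2)]) (use 3 in \<open>simp add: sph_harm_eq_sph_poly p sph_poly_def ang_def m_def q_def\<close>)
  qed
qed

lemma sph_span_nth:
  assumes "sph_span n f"
  shows "sph_span (Suc n) (\<lambda>\<Omega>. \<Omega> $ j * f \<Omega>)"
proof -
  obtain c where c: "\<forall>\<Omega>\<in>sphere 0 1. f \<Omega> = (\<Sum>p\<in>set (sph_idx n). c p * sph_harm p \<Omega>)"
    using assms unfolding sph_span_def by blast
  have "sph_span (Suc n) (\<lambda>\<Omega>. \<Sum>p\<in>set (sph_idx n). c p * (\<Omega> $ j * sph_harm p \<Omega>))"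
    by (intro sph_span_sum sph_span_cmult sph_span_nth_sph_harm)
  thus ?thesis by (rule sph_span_cong) (simp add: c sum_distrib_left mult.left_commute)
qed

lemma polyf_sph_span: "polyf n f \<Longrightarrow> sph_span n f"
proof (induction rule: polyf.induct)
  case (const n c)
  show ?case using sph_span_Re[of "[:c:]" 0 n] by simp
qed (auto intro: sph_span_add sph_span_nth)

lemma sph_span_expansion:
  assumes f: "sph_span n f" and S: "\<Omega> \<in> sphere 0 1"
  shows "f \<Omega> = (\<Sum>p\<in>set (sph_idx n). (LINT \<Omega>|usph. f \<Omega> * sph_harm p \<Omega>) * sph_harm p \<Omega>)"
proof -
  obtain c where c: "\<forall>\<Omega>\<in>sphere 0 1. f \<Omega> = (\<Sum>p\<in>set (sph_idx n). c p * sph_harm p \<Omega>)"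
    using f unfolding sph_span_def by blast
  have "(LINT \<Omega>|usph. f \<Omega> * sph_harm p \<Omega>) = c p" if p: "p \<in> set (sph_idx n)" for p
  proof -
    have "(LINT \<Omega>|usph. f \<Omega> * sph_harm p \<Omega>) = (LINT \<Omega>|usph. (\<Sum>p'\<in>set (sph_idx n). c p' * (sph_harm p' \<Omega> * sph_harm p \<Omega>)))"
      by (rule integral_usph_cong) (simp add: c sum_distrib_right mult.assoc)
    also have "\<dots> = (\<Sum>p'\<in>set (sph_idx n). c p' * (LINT \<Omega>|usph. sph_harm p' \<Omega> * sph_harm p \<Omega>))"
      by (subst Bochner_Integration.integral_sum) (auto intro!: integrable_usph_continuous continuous_intros)
    also have "\<dots> = (\<Sum>p'\<in>set (sph_idx n). c p' * (if p' = p then 1 else 0))"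
      by (rule sum.cong) (simp_all add: sph_harm_orthonormal p)
    also have "\<dots> = (\<Sum>p'\<in>set (sph_idx n). if p' = p then c p' else 0)"
      by (rule sum.cong) auto
    also have "\<dots> = c p" using p by (simp add: sum.delta)
    finally show ?thesis .
  qed
  thus ?thesis using c S by simp
qed

section \<open>Parity under reflections in the coordinate directions\<close>

lemma reflect_axis_reflect: "reflect_dir (axis i 1) (reflect_dir (axis i 1) \<Omega>) = \<Omega>"
  by (simp add: Finite_Cartesian_Product.vec_eq_iff reflect_axis_nth)

lemma reflect_axis_sphere: "\<Omega> \<in> sphere 0 1 \<Longrightarrow> reflect_dir (axis i 1) \<Omega> \<in> sphere 0 1"
  by (rule orthogonal_transformation_sphere[OF orthogonal_reflect_axis])

lemma polyf_reflect: "polyf n f \<Longrightarrow> polyf n (\<lambda>\<Omega>. f (reflect_dir (axis i 1) \<Omega>))"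
proof (induction rule: polyf.induct)
  case (coord n f j)
  have "polyf (Suc n) (\<lambda>\<Omega>. (if j = i then -1 else 1) * (\<Omega> $ j * f (reflect_dir (axis i 1) \<Omega>)))"
    by (intro polyf_cmult polyf.coord coord.IH)
  moreover have "(\<lambda>\<Omega>. (if j = i then -1 else 1) * (\<Omega> $ j * f (reflect_dir (axis i 1) \<Omega>)))
      = (\<lambda>\<Omega>. reflect_dir (axis i 1) \<Omega> $ j * f (reflect_dir (axis i 1) \<Omega>))"
    by (auto simp: reflect_axis_nth)
  ultimately show ?case by simp
qed (auto intro: polyf.intros)

text \<open>Division of the odd part by the \<open>i\<close>-th coordinate, as an identity on the
  whole space. Multiplying \<open>f\<close> by another coordinate multiplies the quotient by it;
  multiplying by the \<open>i\<close>-th one makes \<open>f\<close> plus its reflection the new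
  quotient. The clause for \<open>n = 0\<close> compensates for the truncated \<open>n - 1\<close>:
  in the step from degree 0 to 1 the new quotient has to be of degree 0 again.\<close>

lemma polyf_odd_part:
  "polyf n f \<Longrightarrow> \<exists>q. (n = 0 \<longrightarrow> q = (\<lambda>_. 0)) \<and> polyf (n - 1) q \<and>
     (\<forall>\<Omega>. q (reflect_dir (axis i 1) \<Omega>) = q \<Omega> \<and> f \<Omega> - f (reflect_dir (axis i 1) \<Omega>) = \<Omega> $ i * q \<Omega>)"
proof (induction rule: polyf.induct)
  case (const n c)
  show ?case by (rule exI[of _ "\<lambda>_. 0"]) (simp add: polyf.const)
next
  case (add n f g)
  then obtain q r where qr: "n = 0 \<longrightarrow> q = (\<lambda>_. 0)" "polyf (n - 1) q" "n = 0 \<longrightarrow> r = (\<lambda>_. 0)" "polyf (n - 1) r"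
     "\<And>\<Omega>. q (reflect_dir (axis i 1) \<Omega>) = q \<Omega>" "\<And>\<Omega>. r (reflect_dir (axis i 1) \<Omega>) = r \<Omega>"
     "\<And>\<Omega>. f \<Omega> - f (reflect_dir (axis i 1) \<Omega>) = \<Omega> $ i * q \<Omega>"
     "\<And>\<Omega>. g \<Omega> - g (reflect_dir (axis i 1) \<Omega>) = \<Omega> $ i * r \<Omega>"
    by blast
  show ?case
    by (rule exI[of _ "\<lambda>\<Omega>. q \<Omega> + r \<Omega>"])
      (use qr(1-4) in \<open>auto intro: polyf.add simp: qr(5,6) distrib_left qr(7,8)[symmetric]\<close>)
next
  case (coord n f j)
  then obtain q where q: "n = 0 \<longrightarrow> q = (\<lambda>_. 0)" "polyf (n - 1) q"
     "\<And>\<Omega>. q (reflect_dir (axis i 1) \<Omega>) = q \<Omega>" "\<And>\<Omega>. f \<Omega> - f (reflect_dir (axis i 1) \<Omega>) = \<Omega> $ i * q \<Omega>"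
    by blast
  show ?case
  proof (cases "j = i")
    case True
    show ?thesis
      by (rule exI[of _ "\<lambda>\<Omega>. f \<Omega> + f (reflect_dir (axis i 1) \<Omega>)"])
        (use coord.hyps True in \<open>auto intro!: polyf.add polyf_reflect simp: reflect_axis_nth reflect_axis_reflect algebra_simps\<close>)
  next
    case False
    have "polyf n (\<lambda>\<Omega>. \<Omega> $ j * q \<Omega>)"
      using q(1,2) polyf.coord[of "n - 1" q j] by (cases n) (auto intro: polyf.const)
    moreover have "\<Omega> $ j * f \<Omega> - reflect_dir (axis i 1) \<Omega> $ j * f (reflect_dir (axis i 1) \<Omega>) = \<Omega> $ i * (\<Omega> $ j * q \<Omega>)" for \<Omega>
      using False q(4)[of \<Omega>] by (simp add: reflect_axis_nth right_diff_distrib[symmetric] mult.left_commute)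
    ultimately show ?thesis
      using False by (intro exI[of _ "\<lambda>\<Omega>. \<Omega> $ j * q \<Omega>"]) (simp add: reflect_axis_nth q(3))
  qed
qed

text \<open>Oddness is known only on the sphere, so \<open>f\<close> itself need not be an odd
  polynomial. Its difference with its reflection is divisible everywhere and equals
  \<open>2 * g\<close> on the sphere; hence the factor \<open>1/2\<close>.\<close>

lemma odd_polyf_factor:
  assumes f: "polyf n f" and fg: "\<And>\<Omega>. \<Omega> \<in> sphere 0 1 \<Longrightarrow> g \<Omega> = f \<Omega>" and odd: "odd_dir (axis i 1) g"
  obtains q where "polyf (n - 1) q" "even_dir (axis i 1) q" "\<And>\<Omega>. \<Omega> \<in> sphere 0 1 \<Longrightarrow> g \<Omega> = \<Omega> $ i * q \<Omega>"
proof -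
  obtain q where q: "polyf (n - 1) q" "\<And>\<Omega>. q (reflect_dir (axis i 1) \<Omega>) = q \<Omega>"
    "\<And>\<Omega>. f \<Omega> - f (reflect_dir (axis i 1) \<Omega>) = \<Omega> $ i * q \<Omega>"
    using polyf_odd_part[OF f] by blast
  show ?thesis
  proof (rule that)
    show "polyf (n - 1) (\<lambda>\<Omega>. 1/2 * q \<Omega>)" by (intro polyf_cmult q)
    show "even_dir (axis i 1) (\<lambda>\<Omega>. 1/2 * q \<Omega>)" by (simp add: even_dir_def q)
    fix \<Omega> :: "real ^ 3" assume S: "\<Omega> \<in> sphere 0 1"
    have "f (reflect_dir (axis i 1) \<Omega>) = - f \<Omega>"
      using odd S fg[OF S] fg[OF reflect_axis_sphere[OF S, of i]] by (simp add: odd_dir_def)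
    thus "g \<Omega> = \<Omega> $ i * (1/2 * q \<Omega>)" using q(3)[of \<Omega>] fg[OF S] by simp
  qed
qed

lemma wc_reflect_axis:
  "wc (reflect_dir (axis 1 1) \<Omega>) = - cnj (wc \<Omega>)" "wc (reflect_dir (axis 2 1) \<Omega>) = cnj (wc \<Omega>)"
  "wc (reflect_dir (axis 3 1) \<Omega>) = wc \<Omega>"
  by (simp_all add: complex_eq_iff reflect_axis_nth)

text \<open>The reflections in \<open>e_1\<close>, \<open>e_2\<close>, \<open>e_3\<close> turn
  \<open>w\<close> into \<open>- cnj w\<close>, \<open>cnj w\<close>, \<open>w\<close>, and only the
  last one changes \<open>z\<close>. With \<open>m = |k|\<close> and \<open>s\<close> equal to 1 for
  \<open>k >= 0\<close> and -1 otherwise, the parities are \<open>s * (-1)^m\<close>,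
  \<open>s\<close> and \<open>(-1)^(l + m)\<close>.\<close>

lemma even_or_odd_sph_harm: "even_dir (axis i 1) (sph_harm p) \<or> odd_dir (axis i 1) (sph_harm p)"
proof -
  obtain l k where p: "p = (l, k)" by fastforce
  define m where "m = nat \<bar>k\<bar>"
  have m1: "Re ((- z) ^ m) = (-1) ^ m * Re (z ^ m)" "Im ((- z) ^ m) = (-1) ^ m * Im (z ^ m)" for z :: complex and m
    by (cases "even m"; simp)+
  have c: "Re (cnj z ^ m) = Re (z ^ m)" "Im (cnj z ^ m) = - Im (z ^ m)" for z m
    by (simp_all flip: complex_cnj_power)
  have "\<exists>s\<in>{1, -1}. \<forall>\<Omega>. sph_poly p (reflect_dir (axis i 1) \<Omega>) = s * sph_poly p \<Omega>"
  proof -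
    consider "i = 3" | "i = 1" | "i = 2" using exhaust_3 by blast
    thus ?thesis
    proof cases
      case 1
      have "sph_poly p (reflect_dir (axis i 1) \<Omega>) = (-1) ^ (l + m) * sph_poly p \<Omega>" for \<Omega>
        by (simp add: 1 sph_poly_def p m_def[symmetric] reflect_axis_nth legendre_deriv_parity ang_def wc_reflect_axis)
      thus ?thesis by (cases "even (l + m)") auto
    next
      case 2
      have "sph_poly p (reflect_dir (axis i 1) \<Omega>) = (if k \<ge> 0 then 1 else -1) * (-1) ^ m * sph_poly p \<Omega>" for \<Omega>
        by (simp add: 2 sph_poly_def p m_def[symmetric] reflect_axis_nth ang_def wc_reflect_axis m1 c) (simp add: m_def)
      thus ?thesis by (cases "even m"; cases "k \<ge> 0") auto
    next
      case 3
      have "sph_poly p (reflect_dir (axis i 1) \<Omega>) = (if k \<ge> 0 then 1 else -1) * sph_poly p \<Omega>" for \<Omega>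
        by (simp add: 3 sph_poly_def p m_def[symmetric] reflect_axis_nth ang_def wc_reflect_axis m1 c)
      thus ?thesis by (cases "k \<ge> 0") auto
    qed
  qed
  thus ?thesis unfolding even_dir_def odd_dir_def using reflect_axis_sphere
    by (auto simp: sph_harm_eq_sph_poly simp del: mem_sphere_0)
qed

text \<open>Being both would force the harmonic to vanish on the sphere, against its unit norm.
  Hence the odd and even lists partition the index set.\<close>

lemma not_even_and_odd_sph_harm:
  assumes "p \<in> set (sph_idx N)"
  shows "\<not> (even_dir (axis i 1) (sph_harm p) \<and> odd_dir (axis i 1) (sph_harm p))"
proof
  assume "even_dir (axis i 1) (sph_harm p) \<and> odd_dir (axis i 1) (sph_harm p)"
  hence "sph_harm p \<Omega> = - sph_harm p \<Omega>" if "\<Omega> \<in> sphere 0 1" for \<Omega>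
    using that unfolding even_dir_def odd_dir_def by metis
  hence z: "sph_harm p \<Omega> = 0" if "\<Omega> \<in> sphere 0 1" for \<Omega> using that by fastforce
  have "(LINT \<Omega>|usph. sph_harm p \<Omega> * sph_harm p \<Omega>) = (LINT \<Omega>|usph. 0)"
    by (rule integral_usph_cong) (simp add: z)
  thus False using sph_harm_orthonormal[OF assms assms] by simp
qed

lemma mset_odd_even_idx: "mset (odd_idx N i @ even_idx N i) = mset (sph_idx N)"
proof -
  have "even_idx N i = filter (\<lambda>p. \<not> odd_dir (axis i 1) (sph_harm p)) (sph_idx N)"
    unfolding even_idx_def using even_or_odd_sph_harm not_even_and_odd_sph_harm by (intro filter_cong) blast+
  thus ?thesis by (simp add: odd_idx_def mset_filter)
qed

lemma integral_even_odd:
  assumes "even_dir (axis i 1) f" "odd_dir (axis i 1) g" "continuous_on (sphere 0 1) (\<lambda>\<Omega>. f \<Omega> * g \<Omega>)"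
  shows "(LINT \<Omega>|usph. f \<Omega> * g \<Omega>) = 0"
proof -
  have "(LINT \<Omega>|usph. f \<Omega> * g \<Omega>) = (LINT \<Omega>|usph. - (f \<Omega> * g \<Omega>))"
    by (rule integral_usph_rotate[OF orthogonal_reflect_axis[of i] assms(3)])
      (use assms(1,2) in \<open>simp add: even_dir_def odd_dir_def\<close>)
  thus ?thesis by simp
qed

section \<open>The matrix of the advection term\<close>

lemma mat_unit_of_injective:
  fixes A :: "real mat"
  assumes A: "A \<in> carrier_mat n n" and inj: "\<And>v. v \<in> carrier_vec n \<Longrightarrow> A *\<^sub>v v = 0\<^sub>v n \<Longrightarrow> v = 0\<^sub>v n"
  obtains B where "B \<in> carrier_mat n n" "A * B = 1\<^sub>m n" "B * A = 1\<^sub>m n" "mat_inverse A = Some B"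
proof -
  have "Determinant.det A \<noteq> 0" using det_0_iff_vec_prod_zero_field[OF A] inj by blast
  hence u: "A \<in> Units (ring_mat TYPE(real) n ())" by (rule det_non_zero_imp_unit[OF A])
  then obtain B where "mat_inverse A = Some B"
    using mat_inverse(1)[OF A, of "()"] by (cases "mat_inverse A") auto
  thus ?thesis using mat_inverse(2)[OF A] that by blast
qed

lemma scalar_prod_self_eq_0:
  fixes w :: "real Matrix.vec"
  assumes "w \<in> carrier_vec m" "scalar_prod w w = 0"
  shows "w = 0\<^sub>v m"
proof -
  have "(\<Sum>i\<in>{0..<m}. vec_index w i * vec_index w i) = 0"
    using assms by (simp add: scalar_prod_def)
  hence "\<forall>i\<in>{0..<m}. vec_index w i * vec_index w i = 0"
    by (subst (asm) sum_nonneg_eq_0_iff) auto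
  thus ?thesis using assms(1) by (intro eq_vecI) auto
qed

text \<open>The form of the Gram matrix \<open>A * transpose_mat A\<close> at \<open>v\<close> is
  the square of the transpose applied to \<open>v\<close>, so this matrix is injective and has an
  inverse \<open>B\<close>. Then \<open>transpose_mat A *\<^sub>v (B *\<^sub>v y)\<close> is a
  preimage of \<open>y\<close> under \<open>A\<close>, and the columns of \<open>A\<close> span the
  whole space.\<close>

lemma rank_eq_dim_row:
  fixes A :: "real mat"
  assumes A: "A \<in> carrier_mat n m"
    and inj: "\<And>v. v \<in> carrier_vec n \<Longrightarrow> transpose_mat A *\<^sub>v v = 0\<^sub>v m \<Longrightarrow> v = 0\<^sub>v n"
  shows "vec_space.rank n A = n"
proof -
  interpret vec_space "TYPE(real)" n .
  have At: "transpose_mat A \<in> carrier_mat m n" using A by simp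
  have AAt: "A * transpose_mat A \<in> carrier_mat n n" using A by simp
  obtain B where B: "B \<in> carrier_mat n n" "A * transpose_mat A * B = 1\<^sub>m n"
  proof (rule mat_unit_of_injective[OF AAt])
    fix v :: "real Matrix.vec" assume v: "v \<in> carrier_vec n" and 0: "A * transpose_mat A *\<^sub>v v = 0\<^sub>v n"
    have w: "transpose_mat A *\<^sub>v v \<in> carrier_vec m" using At v by simp
    have "scalar_prod (transpose_mat A *\<^sub>v v) (transpose_mat A *\<^sub>v v) = scalar_prod v (A *\<^sub>v (transpose_mat A *\<^sub>v v))"
      by (rule transpose_vec_mult_scalar[OF A w v])
    also have "A *\<^sub>v (transpose_mat A *\<^sub>v v) = 0\<^sub>v n" using 0 assoc_mult_mat_vec[OF A At v] by simp
    finally have "scalar_prod (transpose_mat A *\<^sub>v v) (transpose_mat A *\<^sub>v v) = 0" using v by simp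
    hence "transpose_mat A *\<^sub>v v = 0\<^sub>v m" using w by (intro scalar_prod_self_eq_0)
    thus "v = 0\<^sub>v n" using inj v by blast
  qed blast
  have "carrier_vec n \<subseteq> span (set (cols A))"
  proof
    fix y :: "real Matrix.vec" assume y: "y \<in> carrier_vec n"
    define x where "x = transpose_mat A *\<^sub>v (B *\<^sub>v y)"
    have x: "x \<in> carrier_vec m" unfolding x_def using At B y by (intro mult_mat_vec_carrier)
    have "y = A * transpose_mat A * B *\<^sub>v y" using B y by simp
    also have "\<dots> = A * transpose_mat A *\<^sub>v (B *\<^sub>v y)"
      by (rule assoc_mult_mat_vec[OF AAt B(1) y])
    also have "\<dots> = A *\<^sub>v x"
      unfolding x_def by (rule assoc_mult_mat_vec[OF A At]) (use B y in auto)
    also have "x = Matrix.vec (length (cols A)) (vec_index x)"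
      using A x by (intro eq_vecI) auto
    also have "A *\<^sub>v \<dots> = mat_of_cols n (cols A) *\<^sub>v Matrix.vec (length (cols A)) (vec_index x)"
      using A mat_of_cols_cols[of A] by simp
    also have "\<dots> = lincomb_list (vec_index x) (cols A)"
      by (rule lincomb_list_as_mat_mult[symmetric]) (use A cols_dim[of A] in auto)
    finally have "y \<in> span_list (cols A)" unfolding span_list_def by auto
    thus "y \<in> span (set (cols A))"
      using span_list_as_span[of "cols A"] A cols_dim[of A] by auto
  qed
  moreover have "span (set (cols A)) \<subseteq> carrier_vec n"
    by (rule span_closed[THEN subsetI]) (use A cols_dim[of A] in auto)
  ultimately have "span (set (cols A)) = carrier_vec n" by blast
  hence "rank A = vectorspace.dim class_ring (vs (carrier_vec n))" by (simp add: rank_def)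
  also have "vs (carrier_vec n) = V" by (simp add: module_vec_def)
  finally show ?thesis using dim_is_n by simp
qed

lemma scalar_prod_mult_mat_vec:
  fixes A :: "real mat"
  assumes "A \<in> carrier_mat n m" "a \<in> carrier_vec n" "b \<in> carrier_vec m"
  shows "scalar_prod a (A *\<^sub>v b) = (\<Sum>r<n. \<Sum>c<m. vec_index a r * vec_index b c * A $$ (r, c))"
proof -
  have "scalar_prod a (A *\<^sub>v b) = (\<Sum>r<n. vec_index a r * (\<Sum>c<m. A $$ (r, c) * vec_index b c))"
    using assms by (auto simp: scalar_prod_def atLeast0LessThan intro!: sum.cong)
  thus ?thesis by (simp add: sum_distrib_left mult_ac)
qed

lemma sum_nth_distinct:
  "distinct v \<Longrightarrow> (\<Sum>r<length v. g (v ! r)) = (\<Sum>p\<in>set v. g p)"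
  by (rule sum.reindex_bij_betw[OF bij_betw_nth]) auto

text \<open>The weight \<open>K\<close> will be 1, a coordinate, the half-sphere indicator times
  \<open>1 / Omega_i\<close>, or the scattering kernel on the product space. Integrability is asked
  of the weighted products because \<open>1 / Omega_i\<close> alone is not integrable on the half
  sphere.\<close>

lemma integral_bilinear:
  fixes K :: "'a \<Rightarrow> real"
  assumes "\<And>r c. r < n \<Longrightarrow> c < m \<Longrightarrow> integrable M (\<lambda>x. K x * f r x * h c x)"
  shows "(LINT x|M. K x * (\<Sum>r<n. a r * f r x) * (\<Sum>c<m. b c * h c x))
     = (\<Sum>r<n. \<Sum>c<m. a r * b c * (LINT x|M. K x * f r x * h c x))"
    and "integrable M (\<lambda>x. K x * (\<Sum>r<n. a r * f r x) * (\<Sum>c<m. b c * h c x))"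
proof -
  have e: "K x * (\<Sum>r<n. a r * f r x) * (\<Sum>c<m. b c * h c x) = (\<Sum>r<n. \<Sum>c<m. a r * b c * (K x * f r x * h c x))" for x
    by (simp add: mult.assoc sum_product sum_distrib_left mult_ac)
  show "integrable M (\<lambda>x. K x * (\<Sum>r<n. a r * f r x) * (\<Sum>c<m. b c * h c x))"
    unfolding e by (intro Bochner_Integration.integrable_sum integrable_mult_right assms) auto
  show "(LINT x|M. K x * (\<Sum>r<n. a r * f r x) * (\<Sum>c<m. b c * h c x))
     = (\<Sum>r<n. \<Sum>c<m. a r * b c * (LINT x|M. K x * f r x * h c x))"
  proof -
    have i: "integrable M (\<lambda>x. a r * b c * (K x * f r x * h c x))" if "r \<in> {..<n}" "c \<in> {..<m}" for r c
      using assms that by (intro integrable_mult_right) auto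
    have "(LINT x|M. (\<Sum>r<n. \<Sum>c<m. a r * b c * (K x * f r x * h c x)))
        = (\<Sum>r<n. LINT x|M. (\<Sum>c<m. a r * b c * (K x * f r x * h c x)))"
      by (rule Bochner_Integration.integral_sum) (rule Bochner_Integration.integrable_sum, rule i)
    also have "\<dots> = (\<Sum>r<n. \<Sum>c<m. LINT x|M. a r * b c * (K x * f r x * h c x))"
      by (intro sum.cong refl Bochner_Integration.integral_sum i)
    finally show ?thesis unfolding e by simp
  qed
qed

section \<open>Entries of the moment matrices\<close>

lemma moment_mat_dim [simp]:
  "dim_row (moment_mat D v w) = length v" "dim_col (moment_mat D v w) = length w"
  by (simp_all add: moment_mat_def)

lemma moment_mat_sphere_index:
  "r < length v \<Longrightarrow> c < length w \<Longrightarrow>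
    moment_mat (sphere 0 1) v w $$ (r, c) = (LINT \<Omega>|usph. (v ! r) \<Omega> * (w ! c) \<Omega>)"
  by (simp add: moment_mat_def set_integral_sphere)

lemma moment_mat_half_index:
  "r < length v \<Longrightarrow> c < length w \<Longrightarrow>
    moment_mat (half_sphere i) v w $$ (r, c) = (LINT \<Omega>|usph. indicator (half_sphere i) \<Omega> * ((v ! r) \<Omega> * (w ! c) \<Omega>))"
  by (simp add: moment_mat_def set_integral_half_sphere)

lemma length_Ups [simp]:
  "length (Ups_odd N i) = length (odd_idx N i)" "length (Ups_even N i) = length (even_idx N i)"
  "length (Ups N) = length (sph_idx N)" "length (omega_times i v) = length v" "length (omega_divide i v) = length v"
  by (simp_all add: Ups_odd_def Ups_even_def Ups_def omega_times_def omega_divide_def)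

lemma Ups_nth:
  "r < length (odd_idx N i) \<Longrightarrow> Ups_odd N i ! r = sph_harm (odd_idx N i ! r)"
  "r < length (even_idx N i) \<Longrightarrow> Ups_even N i ! r = sph_harm (even_idx N i ! r)"
  "r < length (sph_idx N) \<Longrightarrow> Ups N ! r = sph_harm (sph_idx N ! r)"
  "r < length v \<Longrightarrow> omega_times i v ! r = (\<lambda>\<Omega>. \<Omega> $ i * (v ! r) \<Omega>)"
  "r < length v \<Longrightarrow> omega_divide i v ! r = (\<lambda>\<Omega>. 1 / \<Omega> $ i * (v ! r) \<Omega>)"
  by (simp_all add: Ups_odd_def Ups_even_def Ups_def omega_times_def omega_divide_def)

lemma distinct_odd_even_idx: "distinct (odd_idx N i)" "distinct (even_idx N i)"
  by (simp_all add: odd_idx_def even_idx_def distinct_sph_idx)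

lemma set_odd_even_idx:
  "set (odd_idx N i) \<union> set (even_idx N i) = set (sph_idx N)"
  "set (odd_idx N i) \<inter> set (even_idx N i) = {}"
  using even_or_odd_sph_harm not_even_and_odd_sph_harm by (auto simp: odd_idx_def even_idx_def)

lemma odd_idx_nth:
  assumes "r < length (odd_idx N i)"
  shows "odd_idx N i ! r \<in> set (sph_idx N)" "odd_dir (axis i 1) (sph_harm (odd_idx N i ! r))"
  using nth_mem[OF assms] unfolding odd_idx_def by auto

lemma even_idx_nth:
  assumes "r < length (even_idx N i)"
  shows "even_idx N i ! r \<in> set (sph_idx N)" "even_dir (axis i 1) (sph_harm (even_idx N i ! r))"
  using nth_mem[OF assms] unfolding even_idx_def by auto

lemma odd_dir_nth_mult: "odd_dir (axis i 1) f \<Longrightarrow> even_dir (axis i 1) (\<lambda>\<Omega>. \<Omega> $ i * f \<Omega>)"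
  and even_dir_nth_mult: "even_dir (axis i 1) f \<Longrightarrow> odd_dir (axis i 1) (\<lambda>\<Omega>. \<Omega> $ i * f \<Omega>)"
  by (simp_all add: odd_dir_def even_dir_def reflect_axis_nth)

text \<open>Points with \<open>Omega_i = 0\<close> are fixed by the reflection. This controls the
  integrands with \<open>1 / Omega_i\<close> at the places where the division is by zero.\<close>

lemma odd_dir_zero:
  assumes "odd_dir (axis i 1) f" "\<Omega> \<in> sphere 0 1" "\<Omega> $ i = 0"
  shows "f \<Omega> = 0"
proof -
  have "reflect_dir (axis i 1) \<Omega> = \<Omega>"
    using assms(3) by (simp add: Finite_Cartesian_Product.vec_eq_iff reflect_axis_nth)
  moreover have "f (reflect_dir (axis i 1) \<Omega>) = - f \<Omega>"
    using assms(1,2) unfolding odd_dir_def by blast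
  ultimately show ?thesis by simp
qed

lemma A_hat_carrier: "A_hat N i \<in> carrier_mat (length (odd_idx N i)) (length (even_idx N i))"
  by (rule carrier_matI) (simp_all add: A_hat_def)

lemma A_hat_index:
  "r < length (odd_idx N i) \<Longrightarrow> c < length (even_idx N i) \<Longrightarrow>
     A_hat N i $$ (r, c) = (LINT \<Omega>|usph. \<Omega> $ i * sph_harm (odd_idx N i ! r) \<Omega> * sph_harm (even_idx N i ! c) \<Omega>)"
  by (simp add: A_hat_def moment_mat_sphere_index Ups_nth)

text \<open>The factor \<open>Omega_i\<close> reverses parity, so within a diagonal block an even
  function meets an odd one and the integral is 0; the two off-diagonal blocks differ only in the
  order of the factors.\<close>

lemma block_form:
  "moment_mat (sphere 0 1) (omega_times i (Ups_odd N i @ Ups_even N i)) (Ups_odd N i @ Ups_even N i)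
     = four_block_mat
         (0\<^sub>m (length (Ups_odd N i)) (length (Ups_odd N i))) (A_hat N i)
         (transpose_mat (A_hat N i)) (0\<^sub>m (length (Ups_even N i)) (length (Ups_even N i)))" (is "?L = ?R")
proof (rule eq_matI)
  let ?o = "length (odd_idx N i)" and ?e = "length (even_idx N i)"
  show "dim_row ?L = dim_row ?R" "dim_col ?L = dim_col ?R" using A_hat_carrier[of N i] by auto
  fix r c assume "r < dim_row ?R" "c < dim_col ?R"
  hence rc: "r < ?o + ?e" "c < ?o + ?e" using A_hat_carrier[of N i] by auto
  let ?Y = "\<lambda>r. if r < ?o then sph_harm (odd_idx N i ! r) else sph_harm (even_idx N i ! (r - ?o))"
  have nth: "(Ups_odd N i @ Ups_even N i) ! r = ?Y r" if "r < ?o + ?e" for r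
    using that by (simp add: nth_append Ups_nth)
  have L: "?L $$ (r, c) = (LINT \<Omega>|usph. \<Omega> $ i * ?Y r \<Omega> * ?Y c \<Omega>)"
    using rc by (simp add: moment_mat_sphere_index Ups_nth nth cong: if_cong)
  consider "r < ?o" "c < ?o" | "r < ?o" "\<not> c < ?o" | "\<not> r < ?o" "c < ?o" | "\<not> r < ?o" "\<not> c < ?o" by blast
  thus "?L $$ (r, c) = ?R $$ (r, c)"
  proof cases
    case 1
    have "(LINT \<Omega>|usph. \<Omega> $ i * ?Y r \<Omega> * ?Y c \<Omega>) = 0"
      by (rule integral_even_odd[of i])
        (use 1 odd_idx_nth in \<open>auto intro!: odd_dir_nth_mult continuous_intros\<close>)
    thus ?thesis unfolding L using 1 rc A_hat_carrier[of N i] by auto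
  next
    case 2
    thus ?thesis unfolding L using rc A_hat_carrier[of N i] by (auto simp: A_hat_index)
  next
    case 3
    have "(LINT \<Omega>|usph. \<Omega> $ i * ?Y r \<Omega> * ?Y c \<Omega>) = (LINT \<Omega>|usph. \<Omega> $ i * ?Y c \<Omega> * ?Y r \<Omega>)"
      by (simp add: mult_ac)
    also have "\<dots> = A_hat N i $$ (c, r - ?o)" using 3 rc by (simp add: A_hat_index)
    finally show ?thesis unfolding L using 3 rc A_hat_carrier[of N i] by auto
  next
    case 4
    have "(LINT \<Omega>|usph. \<Omega> $ i * ?Y r \<Omega> * ?Y c \<Omega>) = (LINT \<Omega>|usph. ?Y c \<Omega> * (\<Omega> $ i * ?Y r \<Omega>))"
      by (simp add: mult_ac)
    also have "\<dots> = 0"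
      by (rule integral_even_odd[of i])
        (use 4 rc even_idx_nth in \<open>auto intro!: even_dir_nth_mult continuous_intros\<close>)
    finally show ?thesis unfolding L using 4 rc A_hat_carrier[of N i] by auto
  qed
qed

text \<open>Indexed by a list of degree-order pairs, so that the odd, the even and the full vector
  of harmonics share one orthonormality statement, \<open>integral_harm_comb\<close>.\<close>

definition harm_comb :: "(nat \<times> int) list \<Rightarrow> (nat \<Rightarrow> real) \<Rightarrow> real ^ 3 \<Rightarrow> real" where
  "harm_comb ps a \<Omega> = (\<Sum>r<length ps. a r * sph_harm (ps ! r) \<Omega>)"

lemma harm_comb_continuous [continuous_intros]: "continuous_on (sphere 0 1) (harm_comb ps a)"
  unfolding harm_comb_def[abs_def] by (intro continuous_intros)

lemma lin_comb_Ups: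
  "lin_comb a (Ups_odd N i) = harm_comb (odd_idx N i) (vec_index a)"
  "lin_comb a (Ups_even N i) = harm_comb (even_idx N i) (vec_index a)"
  "lin_comb a (Ups N) = harm_comb (sph_idx N) (vec_index a)"
  by (simp_all add: fun_eq_iff lin_comb_def harm_comb_def Ups_nth)

lemma harm_comb_odd: "odd_dir (axis i 1) (harm_comb (odd_idx N i) a)"
  using odd_idx_nth(2)[of _ N i] by (simp add: odd_dir_def harm_comb_def sum_negf)

lemma harm_comb_even: "even_dir (axis i 1) (harm_comb (even_idx N i) a)"
  using even_idx_nth(2)[of _ N i] by (simp add: even_dir_def harm_comb_def)

lemma integral_harm_comb:
  assumes "distinct ps" "set ps \<subseteq> set (sph_idx N)"
  shows "(LINT \<Omega>|usph. harm_comb ps a \<Omega> * harm_comb ps b \<Omega>) = (\<Sum>r<length ps. a r * b r)"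
proof -
  have "(LINT \<Omega>|usph. 1 * (\<Sum>r<length ps. a r * sph_harm (ps ! r) \<Omega>) * (\<Sum>c<length ps. b c * sph_harm (ps ! c) \<Omega>))
    = (\<Sum>r<length ps. \<Sum>c<length ps. a r * b c * (LINT \<Omega>|usph. 1 * sph_harm (ps ! r) \<Omega> * sph_harm (ps ! c) \<Omega>))"
    by (rule integral_bilinear) (auto intro!: integrable_usph_continuous continuous_intros)
  also have "\<dots> = (\<Sum>r<length ps. \<Sum>c<length ps. a r * b c * (if r = c then 1 else 0))"
  proof (intro sum.cong refl)
    fix r c assume "r \<in> {..<length ps}" "c \<in> {..<length ps}"
    moreover from this have "ps ! r \<in> set (sph_idx N)" "ps ! c \<in> set (sph_idx N)"
      using assms(2) nth_mem by blast+
    ultimately show "a r * b c * (LINT \<Omega>|usph. 1 * sph_harm (ps ! r) \<Omega> * sph_harm (ps ! c) \<Omega>) = a r * b c * (if r = c then 1 else 0)"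
      using sph_harm_orthonormal[of "ps ! r" N "ps ! c"] assms(1) by (simp add: nth_eq_iff_index_eq)
  qed
  also have "\<dots> = (\<Sum>r<length ps. a r * b r)"
    by (simp add: if_distrib cong: if_cong)
  finally show ?thesis by (simp add: harm_comb_def)
qed

lemma polyf_harm_comb:
  assumes "set ps \<subseteq> set (sph_idx N)"
  obtains f where "polyf N f" "\<And>\<Omega>. \<Omega> \<in> sphere 0 1 \<Longrightarrow> harm_comb ps a \<Omega> = f \<Omega>"
proof (rule that)
  show "polyf N (\<lambda>\<Omega>. \<Sum>r<length ps. a r * sph_poly (ps ! r) \<Omega>)"
  proof (intro polyf_sum polyf_cmult)
    fix r assume "r \<in> {..<length ps}"
    hence "ps ! r \<in> set (sph_idx N)" using assms nth_mem by blast
    moreover obtain l k where p: "ps ! r = (l, k)" by (cases "ps ! r")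
    ultimately have "l \<le> N" "\<bar>k\<bar> \<le> int l" by (simp_all add: set_sph_idx)
    thus "polyf N (sph_poly (ps ! r))" unfolding p by (rule polyf_mono[OF _ polyf_sph_poly])
  qed
qed (simp add: harm_comb_def sph_harm_eq_sph_poly)

lemma odd_harm_comb_factor:
  obtains q where "polyf (N - 1) q" "even_dir (axis i 1) q"
    "\<And>\<Omega>. \<Omega> \<in> sphere 0 1 \<Longrightarrow> harm_comb (odd_idx N i) a \<Omega> = \<Omega> $ i * q \<Omega>"
proof -
  have "set (odd_idx N i) \<subseteq> set (sph_idx N)" by (auto simp: odd_idx_def)
  then obtain f where "polyf N f" "\<And>\<Omega>. \<Omega> \<in> sphere 0 1 \<Longrightarrow> harm_comb (odd_idx N i) a \<Omega> = f \<Omega>"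
    using polyf_harm_comb[of _ N a] by blast
  from odd_polyf_factor[OF this harm_comb_odd] show ?thesis using that by blast
qed

text \<open>The coefficients against even harmonics vanish by parity, so only the odd part of the
  full expansion remains.\<close>

lemma expansion_odd:
  assumes f: "sph_span N f" "odd_dir (axis i 1) f" and fc: "continuous_on (sphere 0 1) f" and S: "\<Omega> \<in> sphere 0 1"
  shows "f \<Omega> = harm_comb (odd_idx N i) (\<lambda>k. LINT \<Omega>|usph. f \<Omega> * sph_harm (odd_idx N i ! k) \<Omega>) \<Omega>"
proof -
  let ?g = "\<lambda>p. (LINT \<Omega>|usph. f \<Omega> * sph_harm p \<Omega>) * sph_harm p \<Omega>"
  have "?g p = 0" if "p \<in> set (even_idx N i)" for p
    using that f(2) fc integral_even_odd[of i "sph_harm p" f]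
    by (auto simp: even_idx_def mult.commute intro!: continuous_intros)
  moreover have "f \<Omega> = (\<Sum>p\<in>set (odd_idx N i). ?g p) + (\<Sum>p\<in>set (even_idx N i). ?g p)"
    unfolding sph_span_expansion[OF f(1) S] set_odd_even_idx(1)[of N i, symmetric]
    by (rule sum.union_disjoint) (use set_odd_even_idx(2)[of N i] in auto)
  ultimately have "f \<Omega> = (\<Sum>p\<in>set (odd_idx N i). ?g p)" by simp
  thus ?thesis unfolding harm_comb_def by (simp add: sum_nth_distinct[OF distinct_odd_even_idx(1), of ?g])
qed

lemma expansion_even:
  assumes f: "sph_span N f" "even_dir (axis i 1) f" and fc: "continuous_on (sphere 0 1) f" and S: "\<Omega> \<in> sphere 0 1"
  shows "f \<Omega> = harm_comb (even_idx N i) (\<lambda>k. LINT \<Omega>|usph. f \<Omega> * sph_harm (even_idx N i ! k) \<Omega>) \<Omega>"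
proof -
  let ?g = "\<lambda>p. (LINT \<Omega>|usph. f \<Omega> * sph_harm p \<Omega>) * sph_harm p \<Omega>"
  have "?g p = 0" if "p \<in> set (odd_idx N i)" for p
    using that f(2) fc integral_even_odd[of i f "sph_harm p"]
    by (auto simp: odd_idx_def intro!: continuous_intros)
  moreover have "f \<Omega> = (\<Sum>p\<in>set (odd_idx N i). ?g p) + (\<Sum>p\<in>set (even_idx N i). ?g p)"
    unfolding sph_span_expansion[OF f(1) S] set_odd_even_idx(1)[of N i, symmetric]
    by (rule sum.union_disjoint) (use set_odd_even_idx(2)[of N i] in auto)
  ultimately have "f \<Omega> = (\<Sum>p\<in>set (even_idx N i). ?g p)" by simp
  thus ?thesis unfolding harm_comb_def by (simp add: sum_nth_distinct[OF distinct_odd_even_idx(2), of ?g])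
qed

lemma A_hat_form:
  assumes "a \<in> carrier_vec (length (odd_idx N i))" "b \<in> carrier_vec (length (even_idx N i))"
  shows "scalar_prod a (A_hat N i *\<^sub>v b)
     = (LINT \<Omega>|usph. \<Omega> $ i * harm_comb (odd_idx N i) (vec_index a) \<Omega> * harm_comb (even_idx N i) (vec_index b) \<Omega>)"
  unfolding scalar_prod_mult_mat_vec[OF A_hat_carrier assms] harm_comb_def
  by (subst integral_bilinear(1)) (auto intro!: integrable_usph_continuous continuous_intros sum.cong simp: A_hat_index)

lemma integral_square_eq_0:
  fixes f :: "real ^ 3 \<Rightarrow> real"
  assumes "a \<in> carrier_vec (length ps)" "distinct ps" "set ps \<subseteq> set (sph_idx N)"
   "(LINT \<Omega>|usph. harm_comb ps (vec_index a) \<Omega> * harm_comb ps (vec_index a) \<Omega>) = 0"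
  shows "a = 0\<^sub>v (length ps)"
proof -
  have "(\<Sum>r<length ps. vec_index a r * vec_index a r) = 0"
    using assms(4) unfolding integral_harm_comb[OF assms(2,3)] .
  hence "\<forall>r<length ps. vec_index a r = 0" by (simp add: sum_nonneg_eq_0_iff)
  thus ?thesis using assms(1) by (intro eq_vecI) auto
qed

text \<open>
  An odd \<open>f\<close> of degree at most \<open>N\<close> is \<open>\<Omega>_i q\<close> with an even \<open>q\<close> of degree at most \<open>N - 1\<close>, so if
  \<open>\<Omega>_i f\<close> is orthogonal to all even harmonics then \<open>0 = \<integral> \<Omega>_i f q = \<integral> f^2\<close>.
\<close>
lemma A_hat_transpose_injective:
  assumes a: "a \<in> carrier_vec (length (odd_idx N i))"
    and 0: "transpose_mat (A_hat N i) *\<^sub>v a = 0\<^sub>v (length (even_idx N i))"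
  shows "a = 0\<^sub>v (length (odd_idx N i))"
proof (rule integral_square_eq_0[OF a distinct_odd_even_idx(1)])
  show "set (odd_idx N i) \<subseteq> set (sph_idx N)" by (auto simp: odd_idx_def)
  define f where "f = harm_comb (odd_idx N i) (vec_index a)"
  obtain q where q: "polyf (N - 1) q" "even_dir (axis i 1) q"
    "\<And>\<Omega>. \<Omega> \<in> sphere 0 1 \<Longrightarrow> f \<Omega> = \<Omega> $ i * q \<Omega>"
    unfolding f_def using odd_harm_comb_factor[of N i "vec_index a"] by blast
  define b where "b = Matrix.vec (length (even_idx N i)) (\<lambda>k. LINT \<Omega>|usph. q \<Omega> * sph_harm (even_idx N i ! k) \<Omega>)"
  have b: "b \<in> carrier_vec (length (even_idx N i))" by (simp add: b_def)
  have "sph_span N q" using q(1) by (intro polyf_sph_span) (rule polyf_mono, auto)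
  hence qb: "q \<Omega> = harm_comb (even_idx N i) (vec_index b) \<Omega>" if "\<Omega> \<in> sphere 0 1" for \<Omega>
    using expansion_even[OF _ q(2) polyf_continuous[OF q(1)] that] by (simp add: b_def harm_comb_def)
  have "(LINT \<Omega>|usph. f \<Omega> * f \<Omega>) = (LINT \<Omega>|usph. \<Omega> $ i * f \<Omega> * harm_comb (even_idx N i) (vec_index b) \<Omega>)"
    by (rule integral_usph_cong) (simp add: qb[symmetric] q(3) mult_ac del: mem_sphere_0)
  also have "\<dots> = scalar_prod a (A_hat N i *\<^sub>v b)" unfolding f_def by (rule A_hat_form[OF a b, symmetric])
  also have "\<dots> = scalar_prod (transpose_mat (A_hat N i) *\<^sub>v a) b"
    by (rule transpose_vec_mult_scalar[OF A_hat_carrier b a, symmetric])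
  also have "\<dots> = 0" unfolding 0 using b by simp
  finally show "(LINT \<Omega>|usph. harm_comb (odd_idx N i) (vec_index a) \<Omega> * harm_comb (odd_idx N i) (vec_index a) \<Omega>) = 0"
    unfolding f_def .
qed

lemma A_hat_rank: "vec_space.rank (dim_row (A_hat N i)) (A_hat N i) = dim_row (A_hat N i)"
  using rank_eq_dim_row[OF A_hat_carrier A_hat_transpose_injective] A_hat_carrier[of N i] by auto

section \<open>The Onsager matrix\<close>

lemma measurable_half_sphere: "indicat_real (half_sphere i) \<in> borel_measurable usph"
proof -
  have "indicat_real (half_sphere i) \<in> borel_measurable borel"
    using half_sphere_closed by (intro borel_measurable_indicator) (rule borel_closed)
  hence "indicat_real (half_sphere i) \<in> borel_measurable (restrict_space borel (sphere 0 1))"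
    by (rule measurable_restrict_space1)
  thus ?thesis using measurable_cong_sets[OF sets_usph refl] by blast
qed

lemma integrable_half_sphere:
  fixes f :: "real ^ 3 \<Rightarrow> real"
  assumes "continuous_on (sphere 0 1) f"
  shows "integrable usph (\<lambda>\<Omega>. indicator (half_sphere i) \<Omega> * f \<Omega>)"
proof -
  obtain B where B: "0 \<le> B" "\<And>x. x \<in> sphere 0 1 \<Longrightarrow> \<bar>f x\<bar> \<le> B"
    using continuous_sphere_bounded[OF assms] by blast
  show ?thesis
  proof (rule integrable_usph_bounded)
    show "(\<lambda>\<Omega>. indicat_real (half_sphere i) \<Omega> * f \<Omega>) \<in> borel_measurable usph"
      by (intro borel_measurable_times measurable_half_sphere measurable_usph_continuous assms)
    fix x :: "real^3" assume "x \<in> sphere 0 1"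
    thus "\<bar>indicat_real (half_sphere i) x * f x\<bar> \<le> B"
      using B by (auto simp: indicator_def)
  qed
qed

text \<open>Where \<open>Omega_i = 0\<close> the left side is 0 because \<open>1 / 0 = 0\<close>,
  while \<open>q\<close> need not vanish. The second odd factor \<open>h\<close> does vanish there,
  so the identity holds at every point of the sphere and not merely almost everywhere.\<close>

lemma odd_divide:
  assumes "\<Omega> \<in> sphere 0 1" "f \<Omega> = \<Omega> $ i * q \<Omega>" "odd_dir (axis i 1) h"
  shows "1 / \<Omega> $ i * f \<Omega> * h \<Omega> = q \<Omega> * h \<Omega>"
  using assms odd_dir_zero[OF assms(3,1)] by (cases "\<Omega> $ i = 0") auto

text \<open>Cancelling \<open>Omega_i\<close> against the odd harmonic leaves a polynomial, so the
  integrand agrees on the sphere with a bounded function.\<close>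

lemma integrable_odd_odd:
  assumes "r < length (odd_idx N i)" and h: "odd_dir (axis i 1) h" "continuous_on (sphere 0 1) h"
  shows "integrable usph (\<lambda>\<Omega>. indicator (half_sphere i) \<Omega> * (1 / \<Omega> $ i) * sph_harm (odd_idx N i ! r) \<Omega> * h \<Omega>)"
proof -
  obtain l k where p: "odd_idx N i ! r = (l, k)" by fastforce
  have "\<bar>k\<bar> \<le> int l" using odd_idx_nth(1)[OF assms(1)] by (simp add: p set_sph_idx)
  from odd_polyf_factor[OF polyf_sph_poly[OF this] sph_harm_eq_sph_poly, of i] odd_idx_nth(2)[OF assms(1)]
  obtain q where q: "polyf (l - 1) q" "\<And>\<Omega>. \<Omega> \<in> sphere 0 1 \<Longrightarrow> sph_harm (l, k) \<Omega> = \<Omega> $ i * q \<Omega>"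
    unfolding p by blast
  have "integrable usph (\<lambda>\<Omega>. indicator (half_sphere i) \<Omega> * (q \<Omega> * h \<Omega>))"
    by (intro integrable_half_sphere continuous_intros polyf_continuous[OF q(1)] h)
  moreover have "integrable usph (\<lambda>\<Omega>. indicator (half_sphere i) \<Omega> * (1 / \<Omega> $ i) * sph_harm (odd_idx N i ! r) \<Omega> * h \<Omega>)
     = integrable usph (\<lambda>\<Omega>. indicator (half_sphere i) \<Omega> * (q \<Omega> * h \<Omega>))"
  proof (rule Bochner_Integration.integrable_cong)
    fix \<Omega> assume "\<Omega> \<in> space usph"
    hence "\<Omega> \<in> sphere 0 1" by simp
    from odd_divide[of _ "sph_harm (l, k)" i q h, OF this q(2)[OF this] h(1)]
    show "indicator (half_sphere i) \<Omega> * (1 / \<Omega> $ i) * sph_harm (odd_idx N i ! r) \<Omega> * h \<Omega> = indicator (half_sphere i) \<Omega> * (q \<Omega> * h \<Omega>)"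
      unfolding p by (simp only: mult.assoc)
  qed simp
  ultimately show ?thesis by simp
qed

lemma L_mat_carrier: "L_mat N i \<in> carrier_mat (length (odd_idx N i)) (length (odd_idx N i))"
  by (rule carrier_matI) (simp_all add: L_mat_def)

lemma L_mat_index:
  "r < length (odd_idx N i) \<Longrightarrow> c < length (odd_idx N i) \<Longrightarrow>
    L_mat N i $$ (r, c) = 2 * (LINT \<Omega>|usph. indicator (half_sphere i) \<Omega> * (1 / \<Omega> $ i) * sph_harm (odd_idx N i ! r) \<Omega> * sph_harm (odd_idx N i ! c) \<Omega>)"
  by (simp add: L_mat_def moment_mat_half_index Ups_nth mult.assoc)

lemma L_mat_integrable:
  assumes "f \<in> set (Ups_odd N i)" "h \<in> set (Ups_odd N i)"
  shows "set_integrable sphere_measure (half_sphere i) (\<lambda>\<Omega>. 1 / \<Omega> $ i * f \<Omega> * h \<Omega>)"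
proof -
  obtain r where r: "r < length (odd_idx N i)" "f = sph_harm (odd_idx N i ! r)"
    using assms(1) by (auto simp: in_set_conv_nth Ups_nth)
  obtain c where c: "c < length (odd_idx N i)" "h = sph_harm (odd_idx N i ! c)"
    using assms(2) by (auto simp: in_set_conv_nth Ups_nth)
  show ?thesis
    using integrable_odd_odd[OF r(1) odd_idx_nth(2)[OF c(1)] continuous_sph_harm]
    unfolding set_integrable_half_sphere r c by (simp only: mult.assoc)
qed

lemma L_mat_sym: "transpose_mat (L_mat N i) = L_mat N i"
proof (rule eq_matI)
  fix r c assume "r < dim_row (L_mat N i)" "c < dim_col (L_mat N i)"
  hence rc: "r < length (odd_idx N i)" "c < length (odd_idx N i)" using L_mat_carrier[of N i] by auto
  hence "transpose_mat (L_mat N i) $$ (r, c) = L_mat N i $$ (c, r)" using L_mat_carrier[of N i] by auto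
  also have "\<dots> = L_mat N i $$ (r, c)" using rc by (simp add: L_mat_index mult_ac)
  finally show "transpose_mat (L_mat N i) $$ (r, c) = L_mat N i $$ (r, c)" .
qed (use L_mat_carrier[of N i] in auto)

lemma L_mat_form:
  assumes "a \<in> carrier_vec (length (odd_idx N i))" "b \<in> carrier_vec (length (odd_idx N i))"
  shows "scalar_prod a (L_mat N i *\<^sub>v b)
     = 2 * (LINT \<Omega>|usph. indicator (half_sphere i) \<Omega> * (1 / \<Omega> $ i) * harm_comb (odd_idx N i) (vec_index a) \<Omega> * harm_comb (odd_idx N i) (vec_index b) \<Omega>)"
proof -
  have i: "integrable usph (\<lambda>\<Omega>. indicator (half_sphere i) \<Omega> * (1 / \<Omega> $ i) * sph_harm (odd_idx N i ! r) \<Omega> * sph_harm (odd_idx N i ! c) \<Omega>)"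
    if "r < length (odd_idx N i)" "c < length (odd_idx N i)" for r c
    by (rule integrable_odd_odd[OF that(1) odd_idx_nth(2)[OF that(2)] continuous_sph_harm])
  show ?thesis
    unfolding scalar_prod_mult_mat_vec[OF L_mat_carrier assms] harm_comb_def
    by (subst integral_bilinear(1)[OF i]) (auto simp: L_mat_index sum_distrib_left intro!: sum.cong)
qed

text \<open>The closed half sphere and its mirror image cover the sphere and overlap exactly where
  \<open>Omega_i = 0\<close>. Assumption \<open>z\<close> makes \<open>f\<close> vanish on this
  overlap, so it is not counted twice.\<close>

lemma integral_half_sphere_even:
  assumes f: "continuous_on (sphere 0 1) f" and even: "even_dir (axis i 1) f"
    and z: "\<And>\<Omega>. \<Omega> \<in> sphere 0 1 \<Longrightarrow> \<Omega> $ i = 0 \<Longrightarrow> f \<Omega> = 0"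
  shows "2 * (LINT \<Omega>|usph. indicator (half_sphere i) \<Omega> * f \<Omega>) = (LINT \<Omega>|usph. f \<Omega>)"
proof -
  let ?H = "\<lambda>\<Omega>. indicat_real (half_sphere i) \<Omega> * f \<Omega>"
  have Hm: "?H \<in> borel_measurable usph"
    by (intro borel_measurable_times measurable_half_sphere measurable_usph_continuous f)
  have "(LINT \<Omega>|usph. f \<Omega> - ?H \<Omega>) = (LINT \<Omega>|usph. ?H (reflect_dir (axis i 1) \<Omega>))"
  proof (rule integral_usph_cong)
    fix \<Omega> :: "real^3" assume S: "\<Omega> \<in> sphere 0 1"
    have "reflect_dir (axis i 1) \<Omega> \<in> sphere 0 1" "reflect_dir (axis i 1) \<Omega> $ i = - \<Omega> $ i"
      using S reflect_axis_sphere by (auto simp: reflect_axis_nth simp del: mem_sphere_0)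
    moreover have "f (reflect_dir (axis i 1) \<Omega>) = f \<Omega>" using even S by (simp add: even_dir_def)
    ultimately show "f \<Omega> - ?H \<Omega> = ?H (reflect_dir (axis i 1) \<Omega>)"
      using S z[OF S] by (auto simp: indicator_def half_sphere_def)
  qed
  also have "\<dots> = (LINT \<Omega>|usph. ?H \<Omega>)"
    by (rule integral_usph_orthogonal[OF orthogonal_reflect_axis Hm])
  finally show ?thesis
    using integrable_usph_continuous[OF f] integrable_half_sphere[OF f, of i]
    by (simp add: Bochner_Integration.integral_diff)
qed

text \<open>Since \<open>0 < \<Omega>_i \<le> 1\<close> wherever an odd function does not vanish on the half sphere, the form of \<open>L\<close> dominates the identity.\<close>
lemma L_mat_ge:
  assumes a: "a \<in> carrier_vec (length (odd_idx N i))"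
  shows "scalar_prod a a \<le> scalar_prod a (L_mat N i *\<^sub>v a)"
proof -
  let ?f = "harm_comb (odd_idx N i) (vec_index a)"
  have "scalar_prod a a = (LINT \<Omega>|usph. ?f \<Omega> * ?f \<Omega>)"
    by (subst integral_harm_comb[OF distinct_odd_even_idx(1), of N])
      (use a in \<open>auto simp: odd_idx_def scalar_prod_def atLeast0LessThan\<close>)
  also have "\<dots> = 2 * (LINT \<Omega>|usph. indicator (half_sphere i) \<Omega> * (?f \<Omega> * ?f \<Omega>))"
    using harm_comb_odd[of i N "vec_index a"] odd_dir_zero[OF harm_comb_odd]
    by (intro integral_half_sphere_even[symmetric]) (auto intro!: continuous_intros simp: even_dir_def odd_dir_def)
  also have "\<dots> \<le> 2 * (LINT \<Omega>|usph. indicator (half_sphere i) \<Omega> * (1 / \<Omega> $ i) * ?f \<Omega> * ?f \<Omega>)"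
  proof (intro mult_left_mono integral_mono)
    show "integrable usph (\<lambda>\<Omega>. indicator (half_sphere i) \<Omega> * (?f \<Omega> * ?f \<Omega>))"
      by (intro integrable_half_sphere continuous_intros)
    show "integrable usph (\<lambda>\<Omega>. indicator (half_sphere i) \<Omega> * (1 / \<Omega> $ i) * ?f \<Omega> * ?f \<Omega>)"
      unfolding harm_comb_def
      by (intro integral_bilinear(2) integrable_odd_odd odd_idx_nth continuous_sph_harm)
    fix \<Omega> assume "\<Omega> \<in> space usph"
    hence S: "\<Omega> \<in> sphere 0 1" by simp
    show "indicator (half_sphere i) \<Omega> * (?f \<Omega> * ?f \<Omega>) \<le> indicator (half_sphere i) \<Omega> * (1 / \<Omega> $ i) * ?f \<Omega> * ?f \<Omega>"
    proof (cases "\<Omega> \<in> half_sphere i \<and> \<Omega> $ i \<noteq> 0")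
      case True
      hence 0: "\<Omega> $ i > 0" by (simp add: half_sphere_def)
      have "\<Omega> $ i \<le> 1" using S component_le_norm_cart[of \<Omega> i] by simp
      hence "1 \<le> 1 / \<Omega> $ i" using 0 by simp
      from mult_right_mono[OF this, of "?f \<Omega> * ?f \<Omega>"] show ?thesis using True by (simp add: mult.assoc)
    next
      case False
      thus ?thesis using odd_dir_zero[OF harm_comb_odd S] by (auto simp: indicator_def)
    qed
  qed simp
  also have "\<dots> = scalar_prod a (L_mat N i *\<^sub>v a)" by (rule L_mat_form[OF a a, symmetric])
  finally show ?thesis .
qed

lemma scalar_prod_self_pos:
  fixes w :: "real Matrix.vec"
  assumes "w \<in> carrier_vec m" "w \<noteq> 0\<^sub>v m"
  shows "scalar_prod w w > 0"
proof -
  have "scalar_prod w w \<noteq> 0" using assms scalar_prod_self_eq_0 by blast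
  moreover have "scalar_prod w w \<ge> 0" by (auto simp: scalar_prod_def intro: sum_nonneg)
  ultimately show ?thesis by simp
qed

lemma L_mat_pos_def: "pos_def_mat (L_mat N i)"
proof -
  have "0 < scalar_prod v (L_mat N i *\<^sub>v v)"
    if "v \<in> carrier_vec (dim_col (L_mat N i))" "v \<noteq> 0\<^sub>v (dim_col (L_mat N i))" for v
    using L_mat_ge[of v N i] that scalar_prod_self_pos[OF that] L_mat_carrier[of N i] by auto
  thus ?thesis using L_mat_carrier[of N i] unfolding pos_def_mat_def by auto
qed

lemma L_mat_inverse:
  obtains B where "B \<in> carrier_mat (length (odd_idx N i)) (length (odd_idx N i))"
    "L_mat N i * B = 1\<^sub>m (length (odd_idx N i))" "B * L_mat N i = 1\<^sub>m (length (odd_idx N i))"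
    "mat_inverse (L_mat N i) = Some B"
proof (rule mat_unit_of_injective[OF L_mat_carrier])
  fix v assume v: "v \<in> carrier_vec (length (odd_idx N i))" and "L_mat N i *\<^sub>v v = 0\<^sub>v (length (odd_idx N i))"
  hence "scalar_prod v v \<le> 0" using L_mat_ge[OF v] by simp
  thus "v = 0\<^sub>v (length (odd_idx N i))" using scalar_prod_self_pos[OF v] by (meson not_less)
qed (rule that)

lemma L_mat_invertible: "invertible_mat (L_mat N i)"
proof -
  obtain B where "B \<in> carrier_mat (length (odd_idx N i)) (length (odd_idx N i))"
    "L_mat N i * B = 1\<^sub>m (length (odd_idx N i))" "B * L_mat N i = 1\<^sub>m (length (odd_idx N i))"
    by (rule L_mat_inverse)
  thus ?thesis using L_mat_carrier[of N i]
    unfolding invertible_mat_def inverts_mat_def by auto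
qed

text \<open>By orthonormality the coefficients of \<open>Omega_i * Y\<close> in the odd harmonics
  are the entries of column \<open>c\<close> of \<open>A_hat\<close>. Applying \<open>L\<close> to
  that column therefore evaluates the form of \<open>L\<close> at
  \<open>Omega_i * Y\<close>.\<close>

lemma L_A_hat_column:
  assumes c: "c < length (even_idx N i)" and N: "fst (even_idx N i ! c) \<noteq> N"
  shows "col (L_mat N i * A_hat N i) c = col (M_tilde N i) c"
proof (rule eq_vecI)
  let ?o = "odd_idx N i" and ?Y = "sph_harm (even_idx N i ! c)"
  have M: "M_tilde N i \<in> carrier_mat (length ?o) (length (even_idx N i))"
    by (rule carrier_matI) (simp_all add: M_tilde_def)
  note carr = M L_mat_carrier[of N i] A_hat_carrier[of N i]
  show "dim_vec (col (L_mat N i * A_hat N i) c) = dim_vec (col (M_tilde N i) c)" using carr by simp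
  fix r assume "r < dim_vec (col (M_tilde N i) c)"
  hence r: "r < length ?o" using M by simp
  have p: "even_idx N i ! c \<in> set (sph_idx N)" and ev: "even_dir (axis i 1) ?Y"
    using even_idx_nth[OF c] by auto
  hence "even_idx N i ! c \<in> set (sph_idx (N - 1))" "N = Suc (N - 1)"
    using N by (auto simp: set_sph_idx split_beta)
  hence "sph_span N (\<lambda>\<Omega>. \<Omega> $ i * ?Y \<Omega>)"
    using sph_span_nth_sph_harm[of "even_idx N i ! c" "N - 1" i] by simp
  from expansion_odd[OF this even_dir_nth_mult[OF ev]]
  have ex: "\<Omega> $ i * ?Y \<Omega> = harm_comb ?o (\<lambda>k. A_hat N i $$ (k, c)) \<Omega>" if "\<Omega> \<in> sphere 0 1" for \<Omega>
    using that c by (simp add: harm_comb_def A_hat_index continuous_on_mult continuous_sph_harm continuous_on_component continuous_on_id mult_ac)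
  define b where "b = col (A_hat N i) c"
  have b: "b \<in> carrier_vec (length ?o)" unfolding b_def using carr(3) c col_dim[of "A_hat N i" c] by auto
  have bk: "vec_index b k = A_hat N i $$ (k, c)" if "k < length ?o" for k
    using that c carr by (simp add: b_def)
  have u: "unit_vec (length ?o) r \<in> carrier_vec (length ?o)" by simp
  have hu: "harm_comb ?o (vec_index (unit_vec (length ?o) r)) \<Omega> = sph_harm (?o ! r) \<Omega>" for \<Omega>
    using r by (simp add: harm_comb_def unit_vec_def if_distrib[of "\<lambda>x. x * _"] cong: if_cong)
  have "vec_index (col (L_mat N i * A_hat N i) c) r = vec_index (L_mat N i *\<^sub>v b) r"
    using r c carr by (simp add: b_def)
  \<comment> \<open>Pairing with a unit vector reads off entry \<open>r\<close> and puts the single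
    harmonic \<open>odd_idx N i ! r\<close> into the first slot of the form of
    \<open>L\<close>.\<close>
  also have "\<dots> = scalar_prod (unit_vec (length ?o) r) (L_mat N i *\<^sub>v b)"
    using r carr b by (subst scalar_prod_left_unit) auto
  also have "\<dots> = 2 * (LINT \<Omega>|usph. indicator (half_sphere i) \<Omega> * (1 / \<Omega> $ i) * sph_harm (?o ! r) \<Omega> * harm_comb ?o (vec_index b) \<Omega>)"
    unfolding L_mat_form[OF u b] hu ..
  also have "\<dots> = 2 * (LINT \<Omega>|usph. indicator (half_sphere i) \<Omega> * (sph_harm (?o ! r) \<Omega> * ?Y \<Omega>))"
  proof (rule arg_cong[of _ _ "(*) 2"], rule integral_usph_cong)
    fix \<Omega> :: "real^3" assume S: "\<Omega> \<in> sphere 0 1"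
    have "harm_comb ?o (vec_index b) \<Omega> = \<Omega> $ i * ?Y \<Omega>"
      unfolding ex[OF S] by (simp add: harm_comb_def bk)
    moreover have "\<Omega> $ i = 0 \<Longrightarrow> sph_harm (?o ! r) \<Omega> = 0"
      by (rule odd_dir_zero[OF odd_idx_nth(2)[OF r] S])
    ultimately show "indicator (half_sphere i) \<Omega> * (1 / \<Omega> $ i) * sph_harm (?o ! r) \<Omega> * harm_comb ?o (vec_index b) \<Omega>
        = indicator (half_sphere i) \<Omega> * (sph_harm (?o ! r) \<Omega> * ?Y \<Omega>)"
      by (cases "\<Omega> $ i = 0") auto
  qed
  also have "\<dots> = vec_index (col (M_tilde N i) c) r"
    using r c by (simp add: M_tilde_def moment_mat_half_index Ups_nth)
  finally show "vec_index (col (L_mat N i * A_hat N i) c) r = vec_index (col (M_tilde N i) c) r" .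
qed

section \<open>Dissipativity of the collision operator\<close>

interpretation usph_pair: pair_sigma_finite usph usph
  by unfold_locales

lemma measurable_usph_borel: "(\<lambda>x. x) \<in> measurable usph borel"
  using measurable_restrict_space1[of "\<lambda>x. x" borel borel "sphere 0 1"] measurable_cong_sets[OF sets_usph refl] by auto

locale scattering_kernel =
  fixes s :: "real \<Rightarrow> real"
  assumes nonneg: "\<And>\<mu>. \<mu> \<in> {-1..1} \<Longrightarrow> s \<mu> \<ge> 0"
    and measurable: "set_borel_measurable borel {-1..1} s"
    and integrable: "\<And>\<Omega>. \<Omega> \<in> sphere 0 1 \<Longrightarrow> set_integrable sphere_measure (sphere 0 1) (\<lambda>\<Omega>'. s (\<Omega>' \<bullet> \<Omega> :: real))"
begin

text \<open>Measurability of \<open>s\<close> is given only on \<open>[-1, 1]\<close>; the indicator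
  extends it by 0 to a Borel function. By Cauchy-Schwarz nothing changes for arguments on the
  sphere.\<close>

definition ker :: "real ^ 3 \<Rightarrow> real ^ 3 \<Rightarrow> real" where
  "ker \<Omega> \<Omega>' = indicator {-1..1} (\<Omega>' \<bullet> \<Omega>) * s (\<Omega>' \<bullet> \<Omega>)"

lemma ker_nonneg: "ker \<Omega> \<Omega>' \<ge> 0"
  using nonneg[of "\<Omega>' \<bullet> \<Omega>"] by (auto simp: ker_def indicator_def)

lemma ker_commute: "ker \<Omega> \<Omega>' = ker \<Omega>' \<Omega>"
  by (simp add: ker_def inner_commute)

lemma ker_sphere:
  assumes "\<Omega> \<in> sphere 0 1" "\<Omega>' \<in> sphere 0 1"
  shows "ker \<Omega> \<Omega>' = s (\<Omega>' \<bullet> \<Omega>)"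
proof -
  have "\<bar>\<Omega>' \<bullet> \<Omega>\<bar> \<le> 1" using Cauchy_Schwarz_ineq2[of \<Omega>' \<Omega>] assms by simp
  thus ?thesis by (auto simp: ker_def indicator_def)
qed

lemma ker_measurable: "(\<lambda>z. ker (fst z) (snd z)) \<in> borel_measurable (usph \<Otimes>\<^sub>M usph)"
proof -
  have g: "(\<lambda>\<mu>. indicat_real {-1..1} \<mu> * s \<mu>) \<in> borel_measurable borel"
    using measurable by (simp add: set_borel_measurable_def)
  have f: "fst \<in> measurable (usph \<Otimes>\<^sub>M usph) borel" "snd \<in> measurable (usph \<Otimes>\<^sub>M usph) borel"
    using measurable_compose[OF measurable_fst measurable_usph_borel] measurable_compose[OF measurable_snd measurable_usph_borel]
    by auto
  have "(\<lambda>z. snd z \<bullet> fst z) \<in> borel_measurable (usph \<Otimes>\<^sub>M usph)"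
    using f by (intro borel_measurable_inner)
  from measurable_compose[OF this g] show ?thesis by (simp add: ker_def)
qed

lemma ker_measurable1: "ker \<Omega> \<in> borel_measurable usph"
proof -
  have g: "(\<lambda>\<mu>. indicat_real {-1..1} \<mu> * s \<mu>) \<in> borel_measurable borel"
    using measurable by (simp add: set_borel_measurable_def)
  have "(\<lambda>\<Omega>'. \<Omega>' \<bullet> \<Omega>) \<in> borel_measurable usph"
    using measurable_usph_borel by (intro borel_measurable_inner) auto
  from measurable_compose[OF this g] show ?thesis by (simp add: ker_def[abs_def])
qed

lemma ker_integrable1:
  assumes "\<Omega> \<in> sphere 0 1"
  shows "integrable usph (ker \<Omega>)"
proof -
  have "integrable usph (\<lambda>\<Omega>'. s (\<Omega>' \<bullet> \<Omega>))"
    using integrable[OF assms] by (simp add: set_integrable_sphere)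
  moreover have "integrable usph (ker \<Omega>) = integrable usph (\<lambda>\<Omega>'. s (\<Omega>' \<bullet> \<Omega>))"
    by (rule Bochner_Integration.integrable_cong) (use ker_sphere assms in auto)
  ultimately show ?thesis by simp
qed

definition total :: real where "total = (LINT \<Omega>'|usph. ker (axis 1 1) \<Omega>')"

text \<open>The kernel depends only on the inner product, and an orthogonal map carries
  \<open>e_1\<close> to any given point of the sphere. This is why the total cross-section is a
  constant.\<close>

lemma ker_total:
  assumes "\<Omega> \<in> sphere 0 1"
  shows "(LINT \<Omega>'|usph. ker \<Omega> \<Omega>') = total"
proof -
  have "\<exists>T. orthogonal_transformation T \<and> T (axis 1 1 :: real ^ 3) = \<Omega>"
  proof (rule orthogonal_transformation_exists_1)
    show "norm (axis 1 1 :: real ^ 3) = 1" "norm \<Omega> = 1" using assms by (auto simp: norm_axis_1)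
    fix f assume f: "orthogonal_transformation f" "f (axis 1 1 :: real ^ 3) = \<Omega>"
    show ?thesis by (rule exI[of _ f], rule conjI) (rule f)+
  qed
  then obtain T where T: "orthogonal_transformation T" "T (axis 1 1 :: real ^ 3) = \<Omega>" by (elim exE conjE)
  have "(LINT \<Omega>'|usph. ker \<Omega> \<Omega>') = (LINT \<Omega>'|usph. ker \<Omega> (T \<Omega>'))"
    by (rule integral_usph_orthogonal[OF T(1) ker_measurable1, symmetric])
  also have "\<dots> = total"
    unfolding total_def T(2)[symmetric] using T(1)
    by (simp add: ker_def[abs_def] orthogonal_transformation_def)
  finally show ?thesis .
qed

text \<open>Joint integrability from integrability in one variable: the inner integral of the
  nonnegative kernel is the constant \<open>total\<close>, and the sphere has finite
  measure.\<close>

lemma ker_integrable: "integrable (usph \<Otimes>\<^sub>M usph) (\<lambda>z. ker (fst z) (snd z))"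
proof (rule usph_pair.Fubini_integrable[OF ker_measurable])
  have "integrable usph (\<lambda>x. LINT y|usph. norm (ker (fst (x, y)) (snd (x, y)))) = integrable usph (\<lambda>x. total)"
    by (rule Bochner_Integration.integrable_cong) (simp_all add: ker_nonneg ker_total)
  thus "integrable usph (\<lambda>x. LINT y|usph. norm (ker (fst (x, y)) (snd (x, y))))" by simp
  show "AE x in usph. integrable usph (\<lambda>y. ker (fst (x, y)) (snd (x, y)))"
    by (rule AE_I2) (use ker_integrable1 in simp)
qed

text \<open>The kernel may be unbounded, so the dominating function is the kernel times the maxima
  of the continuous factors.\<close>

lemma ker_integrable_mult:
  assumes f: "continuous_on (sphere 0 1) f" and g: "continuous_on (sphere 0 1) g"
  shows "integrable (usph \<Otimes>\<^sub>M usph) (\<lambda>z. ker (fst z) (snd z) * f (fst z) * g (snd z))"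
proof -
  obtain A where A: "0 \<le> A" "\<And>x. x \<in> sphere 0 1 \<Longrightarrow> \<bar>f x\<bar> \<le> A"
    using continuous_sphere_bounded[OF f] by blast
  obtain B where B: "0 \<le> B" "\<And>x. x \<in> sphere 0 1 \<Longrightarrow> \<bar>g x\<bar> \<le> B"
    using continuous_sphere_bounded[OF g] by blast
  have fm: "(\<lambda>z. f (fst z)) \<in> borel_measurable (usph \<Otimes>\<^sub>M usph)" "(\<lambda>z. g (snd z)) \<in> borel_measurable (usph \<Otimes>\<^sub>M usph)"
    by (rule measurable_compose[OF measurable_fst measurable_usph_continuous[OF f]],
        rule measurable_compose[OF measurable_snd measurable_usph_continuous[OF g]])
  show ?thesis
  proof (rule Bochner_Integration.integrable_bound)
    show "integrable (usph \<Otimes>\<^sub>M usph) (\<lambda>z. ker (fst z) (snd z) * (A * B))"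
      using ker_integrable by (rule integrable_mult_left)
    show "(\<lambda>z. ker (fst z) (snd z) * f (fst z) * g (snd z)) \<in> borel_measurable (usph \<Otimes>\<^sub>M usph)"
      by (intro borel_measurable_times ker_measurable fm)
    show "AE z in usph \<Otimes>\<^sub>M usph. norm (ker (fst z) (snd z) * f (fst z) * g (snd z)) \<le> norm (ker (fst z) (snd z) * (A * B))"
    proof (rule AE_I2)
      fix z assume "z \<in> space (usph \<Otimes>\<^sub>M usph)"
      hence z: "fst z \<in> sphere 0 1" "snd z \<in> sphere 0 1" by (auto simp: space_pair_measure)
      have "\<bar>f (fst z)\<bar> * \<bar>g (snd z)\<bar> \<le> A * B"
        using A B z by (intro mult_mono) auto
      from mult_left_mono[OF this ker_nonneg[of "fst z" "snd z"]]
      show "norm (ker (fst z) (snd z) * f (fst z) * g (snd z)) \<le> norm (ker (fst z) (snd z) * (A * B))"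
        using A B ker_nonneg[of "fst z" "snd z"] by (simp add: abs_mult mult.assoc)
    qed
  qed
qed

lemma ker_double_integral:
  assumes f: "continuous_on (sphere 0 1) f" and g: "continuous_on (sphere 0 1) g"
  shows "(LINT z|(usph \<Otimes>\<^sub>M usph). ker (fst z) (snd z) * f (fst z) * g (snd z))
     = (LINT \<Omega>|usph. f \<Omega> * (LINT \<Omega>'|usph. ker \<Omega> \<Omega>' * g \<Omega>'))"
  and "integrable usph (\<lambda>\<Omega>. f \<Omega> * (LINT \<Omega>'|usph. ker \<Omega> \<Omega>' * g \<Omega>'))"
proof -
  have e: "(LINT y|usph. ker (fst (x, y)) (snd (x, y)) * f (fst (x, y)) * g (snd (x, y)))
      = f x * (LINT \<Omega>'|usph. ker x \<Omega>' * g \<Omega>')" for x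
  proof -
    have "(\<lambda>y. ker x y * f x * g y) = (\<lambda>y. f x * (ker x y * g y))" by (simp add: fun_eq_iff)
    thus ?thesis by simp
  qed
  show "(LINT z|(usph \<Otimes>\<^sub>M usph). ker (fst z) (snd z) * f (fst z) * g (snd z))
     = (LINT \<Omega>|usph. f \<Omega> * (LINT \<Omega>'|usph. ker \<Omega> \<Omega>' * g \<Omega>'))"
    using usph_pair.integral_fst'[OF ker_integrable_mult[OF f g]] unfolding e by simp
  show "integrable usph (\<lambda>\<Omega>. f \<Omega> * (LINT \<Omega>'|usph. ker \<Omega> \<Omega>' * g \<Omega>'))"
    using usph_pair.integrable_fst'[OF ker_integrable_mult[OF f g]] unfolding e by simp
qed

lemma ker_double_integral_fst:
  assumes f: "continuous_on (sphere 0 1) f"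
  shows "(LINT z|(usph \<Otimes>\<^sub>M usph). ker (fst z) (snd z) * f (fst z)) = total * (LINT \<Omega>|usph. f \<Omega>)"
proof -
  have "(LINT z|(usph \<Otimes>\<^sub>M usph). ker (fst z) (snd z) * f (fst z)) = (LINT \<Omega>|usph. f \<Omega> * (LINT \<Omega>'|usph. ker \<Omega> \<Omega>'))"
    using ker_double_integral(1)[OF f continuous_on_const[of _ 1]] by simp
  also have "\<dots> = (LINT \<Omega>|usph. total * f \<Omega>)"
    by (rule integral_usph_cong) (simp add: ker_total)
  finally show ?thesis by simp
qed

text \<open>Swapping the two variables and using the symmetry of the kernel reduces this to the
  marginal in the first variable.\<close>

lemma ker_double_integral_snd:
  assumes f: "continuous_on (sphere 0 1) f"
  shows "(LINT z|(usph \<Otimes>\<^sub>M usph). ker (fst z) (snd z) * f (snd z)) = total * (LINT \<Omega>|usph. f \<Omega>)"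
proof -
  have m: "(\<lambda>z. ker (fst z) (snd z) * f (snd z)) \<in> borel_measurable (usph \<Otimes>\<^sub>M usph)"
    using ker_integrable_mult[OF continuous_on_const[of _ 1] f] by simp
  have "(LINT z|(usph \<Otimes>\<^sub>M usph). ker (fst z) (snd z) * f (fst z))
     = (LINT (x, y)|(usph \<Otimes>\<^sub>M usph). ker y x * f y)"
    using usph_pair.integral_product_swap[of "\<lambda>z. ker (fst z) (snd z) * f (fst z)"]
      ker_integrable_mult[OF f continuous_on_const[of _ 1]] by (simp add: split_beta)
  thus ?thesis
    unfolding ker_double_integral_fst[OF f] by (simp only: case_prod_unfold ker_commute[of "snd _"])
qed

text \<open>The pointwise bound \<open>f a * f b <= (f a^2 + f b^2) / 2\<close> is multiplied by the
  nonnegative kernel; either square then integrates to \<open>total\<close> times the integral of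
  \<open>f^2\<close>.\<close>

lemma ker_form_le:
  assumes f: "continuous_on (sphere 0 1) f"
  shows "(LINT z|(usph \<Otimes>\<^sub>M usph). ker (fst z) (snd z) * f (fst z) * f (snd z)) \<le> total * (LINT \<Omega>|usph. f \<Omega> * f \<Omega>)"
proof -
  let ?P = "usph \<Otimes>\<^sub>M usph"
  have ff: "continuous_on (sphere 0 1) (\<lambda>\<Omega>. f \<Omega> * f \<Omega>)" using f by (intro continuous_intros)
  have i1: "integrable ?P (\<lambda>z. ker (fst z) (snd z) * (f (fst z) * f (fst z)))"
    using ker_integrable_mult[OF ff continuous_on_const[of _ 1]] by simp
  have i2: "integrable ?P (\<lambda>z. ker (fst z) (snd z) * (f (snd z) * f (snd z)))"
    using ker_integrable_mult[OF continuous_on_const[of _ 1] ff] by simp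
  have "(LINT z|?P. ker (fst z) (snd z) * f (fst z) * f (snd z))
     \<le> (LINT z|?P. 1/2 * (ker (fst z) (snd z) * (f (fst z) * f (fst z))) + 1/2 * (ker (fst z) (snd z) * (f (snd z) * f (snd z))))"
  proof (rule integral_mono[OF ker_integrable_mult[OF f f]])
    show "integrable ?P (\<lambda>z. 1/2 * (ker (fst z) (snd z) * (f (fst z) * f (fst z))) + 1/2 * (ker (fst z) (snd z) * (f (snd z) * f (snd z))))"
      by (intro Bochner_Integration.integrable_add integrable_mult_right i1 i2)
    fix z
    have "f (fst z) * f (snd z) \<le> 1/2 * (f (fst z) * f (fst z)) + 1/2 * (f (snd z) * f (snd z))"
      using sum_squares_bound[of "f (fst z)" "f (snd z)"] by (simp add: power2_eq_square)
    from mult_left_mono[OF this ker_nonneg[of "fst z" "snd z"]]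
    show "ker (fst z) (snd z) * f (fst z) * f (snd z) \<le> 1/2 * (ker (fst z) (snd z) * (f (fst z) * f (fst z))) + 1/2 * (ker (fst z) (snd z) * (f (snd z) * f (snd z)))"
      by (simp add: algebra_simps)
  qed
  also have "\<dots> = 1/2 * (total * (LINT \<Omega>|usph. f \<Omega> * f \<Omega>)) + 1/2 * (total * (LINT \<Omega>|usph. f \<Omega> * f \<Omega>))"
    unfolding ker_double_integral_fst[OF ff, symmetric]
    by (subst Bochner_Integration.integral_add)
      (use i1 i2 ker_double_integral_fst[OF ff] ker_double_integral_snd[OF ff] in \<open>auto intro: integrable_mult_right\<close>)
  finally show ?thesis by simp
qed

end

text \<open>For \<open>f\<close> with coefficient vector \<open>u\<close> the form is the double
  integral of the kernel against \<open>f f\<close> minus \<open>total\<close> times the integral of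
  \<open>f^2\<close>, so \<open>ker_form_le\<close> decides the sign.\<close>

lemma collision_mat_form_le:
  assumes "scattering_cross_section G \<sigma>s" "x \<in> G" and u: "u \<in> carrier_vec ((N + 1)\<^sup>2)"
  shows "scalar_prod u (collision_mat N \<sigma>s x *\<^sub>v u) \<le> 0"
proof -
  interpret scattering_kernel "\<sigma>s x"
    using assms(1,2) by unfold_locales (auto simp: scattering_cross_section_def)
  let ?n = "length (sph_idx N)"
  let ?Y = "\<lambda>r. sph_harm (sph_idx N ! r)"
  define f where "f = harm_comb (sph_idx N) (vec_index u)"
  have C: "collision_mat N \<sigma>s x \<in> carrier_mat ?n ?n"
    by (rule carrier_matI) (simp_all add: collision_mat_def)
  have u': "u \<in> carrier_vec ?n" using u by (simp add: length_sph_idx)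
  have col: "collision \<sigma>s x g \<Omega> = (LINT \<Omega>'|usph. ker \<Omega> \<Omega>' * g \<Omega>') - total * g \<Omega>" if "\<Omega> \<in> sphere 0 1" for g \<Omega>
  proof -
    have "(LINT \<Omega>'|usph. \<sigma>s x (\<Omega>' \<bullet> \<Omega>) * g \<Omega>') = (LINT \<Omega>'|usph. ker \<Omega> \<Omega>' * g \<Omega>')"
      by (rule integral_usph_cong) (simp only: ker_sphere[OF that])
    moreover have "(LINT \<Omega>'|usph. \<sigma>s x (\<Omega>' \<bullet> \<Omega>)) = total"
      unfolding ker_total[OF that, symmetric]
      by (rule integral_usph_cong) (simp only: ker_sphere[OF that])
    ultimately show ?thesis
      by (simp add: collision_def total_cross_section_def set_integral_sphere)
  qed
  have ind: "collision_mat N \<sigma>s x $$ (r, c)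
      = (LINT z|(usph \<Otimes>\<^sub>M usph). ker (fst z) (snd z) * ?Y c (fst z) * ?Y r (snd z)) - total * (LINT \<Omega>|usph. 1 * ?Y r \<Omega> * ?Y c \<Omega>)"
    if "r < ?n" "c < ?n" for r c
  proof -
    have "collision_mat N \<sigma>s x $$ (r, c) = (LINT \<Omega>|usph. collision \<sigma>s x (?Y r) \<Omega> * ?Y c \<Omega>)"
      unfolding collision_mat_def using that by (subst moment_mat_sphere_index) (simp_all add: Ups_nth)
    also have "\<dots> = (LINT \<Omega>|usph. ?Y c \<Omega> * (LINT \<Omega>'|usph. ker \<Omega> \<Omega>' * ?Y r \<Omega>') - total * (1 * ?Y r \<Omega> * ?Y c \<Omega>))"
      by (rule integral_usph_cong) (simp add: col algebra_simps del: mem_sphere_0)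
    also have "\<dots> = (LINT \<Omega>|usph. ?Y c \<Omega> * (LINT \<Omega>'|usph. ker \<Omega> \<Omega>' * ?Y r \<Omega>')) - (LINT \<Omega>|usph. total * (1 * ?Y r \<Omega> * ?Y c \<Omega>))"
      by (intro Bochner_Integration.integral_diff ker_double_integral(2) integrable_mult_right integrable_usph_continuous continuous_intros)
    finally show ?thesis
      unfolding ker_double_integral(1)[OF continuous_sph_harm continuous_sph_harm] by simp
  qed
  have "scalar_prod u (collision_mat N \<sigma>s x *\<^sub>v u)
     = (\<Sum>r<?n. \<Sum>c<?n. vec_index u r * vec_index u c * collision_mat N \<sigma>s x $$ (r, c))"
    by (rule scalar_prod_mult_mat_vec[OF C u' u'])
  also have "\<dots> = (\<Sum>r<?n. \<Sum>c<?n. vec_index u c * vec_index u r * (LINT z|(usph \<Otimes>\<^sub>M usph). ker (fst z) (snd z) * ?Y c (fst z) * ?Y r (snd z)))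
      - total * (\<Sum>r<?n. \<Sum>c<?n. vec_index u r * vec_index u c * (LINT \<Omega>|usph. 1 * ?Y r \<Omega> * ?Y c \<Omega>))"
    by (simp add: ind sum_subtractf sum_distrib_left algebra_simps)
  also have "(\<Sum>r<?n. \<Sum>c<?n. vec_index u r * vec_index u c * (LINT \<Omega>|usph. 1 * ?Y r \<Omega> * ?Y c \<Omega>)) = (LINT \<Omega>|usph. f \<Omega> * f \<Omega>)"
    by (subst integral_bilinear(1)[symmetric])
      (auto intro!: integrable_usph_continuous continuous_intros simp: f_def harm_comb_def)
  also have "(\<Sum>r<?n. \<Sum>c<?n. vec_index u c * vec_index u r * (LINT z|(usph \<Otimes>\<^sub>M usph). ker (fst z) (snd z) * ?Y c (fst z) * ?Y r (snd z)))
     = (LINT z|(usph \<Otimes>\<^sub>M usph). ker (fst z) (snd z) * f (fst z) * f (snd z))"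
    unfolding f_def harm_comb_def
    by (subst sum.swap, rule integral_bilinear(1)[symmetric], intro ker_integrable_mult continuous_sph_harm)
  also have "\<dots> - total * (LINT \<Omega>|usph. f \<Omega> * f \<Omega>) \<le> 0"
    using ker_form_le[of f] by (simp add: f_def harm_comb_continuous)
  finally show ?thesis .
qed

section \<open>Energy estimate for symmetric hyperbolic systems\<close>

lemma space_boundary_measure: "space (boundary_measure G) = frontier G"
  by (simp add: boundary_measure_def space_restrict_space space_measure_of)

text \<open>\<open>measure_of\<close> keeps the given sigma-algebra for any set function, so the
  Borel sets are read off without establishing additivity of the Hausdorff outer measure.\<close>

lemma sets_boundary_measure: "sets (boundary_measure G) = sets (restrict_space borel (frontier G))"
proof -
  have "sets (measure_of UNIV (sets borel) hausdorff2_outer) = sets (borel :: (real^3) measure)"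
    using sets.sigma_sets_eq[of "borel :: (real^3) measure"] by (simp add: sets_measure_of)
  thus ?thesis unfolding boundary_measure_def by (rule sets_restrict_space_cong)
qed

lemma measurable_ident_boundary: "(\<lambda>x. x) \<in> measurable (boundary_measure G) borel"
  using measurable_restrict_space1[of "\<lambda>x. x" borel borel "frontier G"]
    measurable_cong_sets[OF sets_boundary_measure refl] by auto

section \<open>Measurability, extended integrals and C^1 functions up to the boundary\<close>

lemma measurable_pair_continuous:
  fixes f :: "'a::second_countable_topology \<times> 'b::second_countable_topology \<Rightarrow> real"
  assumes f: "continuous_on (A \<times> B) f"
    and M1: "(\<lambda>x. x) \<in> measurable M1 borel" "space M1 \<subseteq> A"
    and M2: "(\<lambda>x. x) \<in> measurable M2 borel" "space M2 \<subseteq> B"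
  shows "f \<in> borel_measurable (M1 \<Otimes>\<^sub>M M2)"
proof -
  have "(\<lambda>z. (fst z, snd z)) \<in> measurable (M1 \<Otimes>\<^sub>M M2) (borel \<Otimes>\<^sub>M borel)"
    by (intro measurable_Pair measurable_compose[OF measurable_fst M1(1)] measurable_compose[OF measurable_snd M2(1)])
  hence "(\<lambda>z. z) \<in> measurable (M1 \<Otimes>\<^sub>M M2) borel" by (simp add: borel_prod)
  hence "(\<lambda>z. z) \<in> measurable (M1 \<Otimes>\<^sub>M M2) (restrict_space borel (A \<times> B))"
    by (rule measurable_restrict_space2[rotated]) (use M1(2) M2(2) in \<open>auto simp: space_pair_measure\<close>)
  from measurable_compose[OF this borel_measurable_continuous_on_restrict[OF f]] show ?thesis by simp
qed

text \<open>True without integrability, since the Bochner integral of a non-integrable function is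
  0. The energy increment and the boundary flux can thus be bounded before anything is known about
  their integrability.\<close>

lemma ennreal_integral_le: "ennreal (integral\<^sup>L M f) \<le> (\<integral>\<^sup>+x. ennreal (f x) \<partial>M)"
proof (cases "integrable M f")
  case True
  have i: "integrable M (\<lambda>x. max 0 (f x))" using True by simp
  have "integral\<^sup>L M f \<le> integral\<^sup>L M (\<lambda>x. max 0 (f x))"
    by (rule integral_mono[OF True i]) simp
  hence "ennreal (integral\<^sup>L M f) \<le> ennreal (integral\<^sup>L M (\<lambda>x. max 0 (f x)))" by (rule ennreal_leI)
  also have "\<dots> = (\<integral>\<^sup>+x. ennreal (max 0 (f x)) \<partial>M)"
    by (rule nn_integral_eq_integral[symmetric, OF i]) simp
  also have "\<dots> = (\<integral>\<^sup>+x. ennreal (f x) \<partial>M)" by (rule nn_integral_cong) (auto simp: max_def ennreal_neg)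
  finally show ?thesis .
next
  case False
  thus ?thesis by (simp add: not_integrable_integral_eq)
qed

lemma C1_up_to_sum:
  assumes "finite A" "\<And>i. i \<in> A \<Longrightarrow> C1_up_to S S' (f i)"
  shows "C1_up_to S S' (\<lambda>x. \<Sum>i\<in>A. f i x)"
  using assms
proof (induction A rule: finite_induct)
  case empty
  show ?case unfolding C1_up_to_def
    by (intro conjI exI[of _ "\<lambda>_. 0"]) (auto intro!: continuous_intros simp: zero_blinfun.rep_eq)
next
  case (insert i A)
  obtain g' where g: "continuous_on S' (\<lambda>x. \<Sum>i\<in>A. f i x)" "continuous_on S' g'"
    "\<And>z. z \<in> S \<Longrightarrow> ((\<lambda>x. \<Sum>i\<in>A. f i x) has_derivative blinfun_apply (g' z)) (at z)"
    using insert.IH insert.prems unfolding C1_up_to_def by auto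
  obtain f' where f: "continuous_on S' (f i)" "continuous_on S' f'"
    "\<And>z. z \<in> S \<Longrightarrow> (f i has_derivative blinfun_apply (f' z)) (at z)"
    using insert.prems[OF insertI1] unfolding C1_up_to_def by auto
  have d: "((\<lambda>x. f i x + (\<Sum>i\<in>A. f i x)) has_derivative blinfun_apply (f' z + g' z)) (at z)" if "z \<in> S" for z
    using has_derivative_add[OF f(3)[OF that] g(3)[OF that]] by (simp add: plus_blinfun.rep_eq)
  have c: "continuous_on S' (\<lambda>z. f' z + g' z)" "continuous_on S' (\<lambda>x. f i x + (\<Sum>i\<in>A. f i x))"
    using f g by (auto intro: continuous_intros)
  show ?case unfolding C1_up_to_def sum.insert[OF insert.hyps]
    by (intro conjI exI[of _ "\<lambda>z. f' z + g' z"] ballI d c)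
qed

text \<open>The product rule is written as an identity of bounded linear maps:
  \<open>C1_up_to\<close> asks for a continuous extension of the derivative to \<open>S'\<close>,
  and \<open>d\<close> inherits one from the extensions for \<open>f\<close> and
  \<open>g\<close>.\<close>

lemma C1_up_to_mult_scaleR:
  fixes f g :: "'a::real_normed_vector \<Rightarrow> real" and v :: "'b::real_normed_vector"
  assumes "C1_up_to S S' f" "C1_up_to S S' g"
  shows "C1_up_to S S' (\<lambda>x. (c * (f x * g x)) *\<^sub>R v)"
proof -
  obtain f' where f: "continuous_on S' f" "continuous_on S' f'"
    "\<And>z. z \<in> S \<Longrightarrow> (f has_derivative blinfun_apply (f' z)) (at z)"
    using assms(1) unfolding C1_up_to_def by auto
  obtain g' where g: "continuous_on S' g" "continuous_on S' g'"
    "\<And>z. z \<in> S \<Longrightarrow> (g has_derivative blinfun_apply (g' z)) (at z)"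
    using assms(2) unfolding C1_up_to_def by auto
  define d where "d z = c *\<^sub>R (f z *\<^sub>R (blinfun_scaleR_left v o\<^sub>L g' z) + g z *\<^sub>R (blinfun_scaleR_left v o\<^sub>L f' z))" for z
  have "((\<lambda>x. (c * (f x * g x)) *\<^sub>R v) has_derivative blinfun_apply (d z)) (at z)" if "z \<in> S" for z
  proof -
    have "((\<lambda>x. (c * (f x * g x)) *\<^sub>R v) has_derivative (\<lambda>h. (c * (f z * g' z h + f' z h * g z)) *\<^sub>R v)) (at z)"
      by (intro has_derivative_scaleR_left has_derivative_mult_right has_derivative_mult f(3) g(3) that)
    moreover have "(\<lambda>h. (c * (f z * g' z h + f' z h * g z)) *\<^sub>R v) = blinfun_apply (d z)"
      by (simp add: fun_eq_iff d_def scaleR_blinfun.rep_eq plus_blinfun.rep_eq blinfun_scaleR_left.rep_eq algebra_simps)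
    ultimately show ?thesis by simp
  qed
  moreover have "continuous_on S' d"
    unfolding d_def[abs_def] by (intro continuous_intros f g)
  moreover have "continuous_on S' (\<lambda>x. (c * (f x * g x)) *\<^sub>R v)"
    by (intro continuous_intros f g)
  ultimately show ?thesis unfolding C1_up_to_def by blast
qed

lemma C1_up_to_slice:
  fixes f :: "'a::real_normed_vector \<times> 'b::real_normed_vector \<Rightarrow> 'c::real_normed_vector"
  assumes "C1_up_to (A \<times> S) (A \<times> S') f" and t: "t \<in> A"
  shows "C1_up_to S S' (\<lambda>x. f (t, x))"
proof -
  obtain f' where f: "continuous_on (A \<times> S') f" "continuous_on (A \<times> S') f'"
    "\<And>z. z \<in> A \<times> S \<Longrightarrow> (f has_derivative blinfun_apply (f' z)) (at z)"
    using assms(1) unfolding C1_up_to_def by auto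
  define e :: "'b \<Rightarrow>\<^sub>L ('a \<times> 'b)" where "e = Blinfun (Pair 0)"
  have bl: "bounded_linear (Pair (0::'a) :: 'b \<Rightarrow> 'a \<times> 'b)"
    by (rule bounded_linear_Pair[OF bounded_linear_zero bounded_linear_ident])
  have e: "blinfun_apply e h = (0, h)" for h unfolding e_def by (simp add: bounded_linear_Blinfun_apply[OF bl])
  have d: "((\<lambda>x. f (t, x)) has_derivative blinfun_apply (f' (t, x) o\<^sub>L e)) (at x)" if "x \<in> S" for x
  proof -
    have "((\<lambda>x. (t, x)) has_derivative (\<lambda>h. (0, h))) (at x)"
      by (intro has_derivative_Pair has_derivative_const has_derivative_ident)
    from has_derivative_compose[OF this f(3)] t that
    show ?thesis by (simp add: e blinfun_compose.rep_eq comp_def)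
  qed
  have p: "continuous_on S' (\<lambda>x. (t, x))" "(\<lambda>x. (t, x)) ` S' \<subseteq> A \<times> S'"
    using t by (auto intro!: continuous_intros)
  have c: "continuous_on S' (\<lambda>x. f (t, x))" "continuous_on S' (\<lambda>x. f' (t, x) o\<^sub>L e)"
    using continuous_on_compose2[OF f(1) p] continuous_on_compose2[OF f(2) p]
    by (auto intro: continuous_intros)
  show ?thesis unfolding C1_up_to_def
    by (intro conjI exI[of _ "\<lambda>x. f' (t, x) o\<^sub>L e"] ballI d c)
qed

text \<open>The energy method separated from the harmonics. \<open>dissipative\<close> is the system
  tested with \<open>U\<close>, with the sign of the source already used; \<open>boundary\<close>
  bounds the inflow of energy. The instance takes for \<open>\<gamma>\<close> the squared norm of
  the boundary data and for \<open>K\<close> the spectral norm of the inverse of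
  \<open>L\<close>.\<close>

locale symmetric_hyperbolic =
  fixes G :: "(real ^ 3) set" and n :: "real ^ 3 \<Rightarrow> real ^ 3"
    and m :: nat and U :: "nat \<Rightarrow> real \<Rightarrow> real ^ 3 \<Rightarrow> real" and a :: "3 \<Rightarrow> nat \<Rightarrow> nat \<Rightarrow> real"
    and \<gamma> :: "real \<Rightarrow> real ^ 3 \<Rightarrow> real" and K :: real
  assumes domain: "divergence_domain G n"
    and sym: "\<And>j r c. r < m \<Longrightarrow> c < m \<Longrightarrow> a j r c = a j c r"
    and cont: "\<And>r. r < m \<Longrightarrow> continuous_on ({0..} \<times> closure G) (\<lambda>(t, x). U r t x)"
    and C1: "\<And>r. r < m \<Longrightarrow> C1_up_to ({0<..} \<times> G) ({0<..} \<times> closure G) (\<lambda>(t, x). U r t x)"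
    and dissipative: "\<And>t x. t > 0 \<Longrightarrow> x \<in> G \<Longrightarrow>
      (\<Sum>r<m. U r t x * (deriv (\<lambda>s. U r s x) t +
         (\<Sum>j\<in>UNIV. \<Sum>c<m. a j r c * deriv (\<lambda>h. U c t (x + h *\<^sub>R axis j 1)) 0))) \<le> 0"
    and boundary: "AE x in boundary_measure G. \<forall>t>0.
      - (\<Sum>j\<in>UNIV. (\<Sum>r<m. \<Sum>c<m. a j r c * (U r t x * U c t x)) * n x $ j) \<le> K * \<gamma> t x"
    and K: "K > 0"
begin

text \<open>A choice of derivative that is continuous up to the boundary of \<open>G\<close>. Inside
  it is the derivative of \<open>U\<close>; on the boundary its values are fixed only by
  continuity.\<close>

definition D :: "nat \<Rightarrow> real \<times> (real ^ 3) \<Rightarrow> (real \<times> (real ^ 3)) \<Rightarrow>\<^sub>L real" where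
  "D r = (SOME f'. (\<forall>z\<in>{0<..} \<times> G. ((\<lambda>(t, x). U r t x) has_derivative blinfun_apply (f' z)) (at z)) \<and>
     continuous_on ({0<..} \<times> closure G) f')"

lemma D:
  assumes "r < m"
  shows "\<And>t x. t > 0 \<Longrightarrow> x \<in> G \<Longrightarrow> ((\<lambda>(t, x). U r t x) has_derivative blinfun_apply (D r (t, x))) (at (t, x))"
    "continuous_on ({0<..} \<times> closure G) (D r)"
proof -
  have "(\<forall>z\<in>{0<..} \<times> G. ((\<lambda>(t, x). U r t x) has_derivative blinfun_apply (D r z)) (at z)) \<and>
     continuous_on ({0<..} \<times> closure G) (D r)"
    using someI_ex[OF conjunct2[OF C1[OF assms, unfolded C1_up_to_def]]] unfolding D_def .
  thus "\<And>t x. t > 0 \<Longrightarrow> x \<in> G \<Longrightarrow> ((\<lambda>(t, x). U r t x) has_derivative blinfun_apply (D r (t, x))) (at (t, x))"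
    "continuous_on ({0<..} \<times> closure G) (D r)" by auto
qed

definition Ut :: "nat \<Rightarrow> real \<Rightarrow> real ^ 3 \<Rightarrow> real" where "Ut r t x = blinfun_apply (D r (t, x)) (1, 0)"
definition Ux :: "nat \<Rightarrow> 3 \<Rightarrow> real \<Rightarrow> real ^ 3 \<Rightarrow> real" where "Ux r j t x = blinfun_apply (D r (t, x)) (0, axis j 1)"

lemma U_deriv_t:
  assumes "r < m" "t > 0" "x \<in> G"
  shows "((\<lambda>s. U r s x) has_real_derivative Ut r t x) (at t)"
proof -
  have "((\<lambda>s. (s, x)) has_derivative (\<lambda>h. (h, 0))) (at t)"
    by (intro has_derivative_Pair has_derivative_const has_derivative_ident)
  from has_derivative_compose[OF this D(1)[OF assms]]
  have "((\<lambda>s. U r s x) has_derivative (\<lambda>h. blinfun_apply (D r (t, x)) (h, 0))) (at t)" by simp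
  moreover have "(\<lambda>h. blinfun_apply (D r (t, x)) (h, 0)) = (*) (Ut r t x)"
  proof
    fix h :: real
    have "(h, 0 :: real^3) = h *\<^sub>R (1, 0)" by simp
    thus "blinfun_apply (D r (t, x)) (h, 0) = Ut r t x * h"
      unfolding Ut_def by (simp only: blinfun.scaleR_right) simp
  qed
  ultimately show ?thesis by (simp add: has_field_derivative_def)
qed

lemma U_deriv_x:
  assumes "r < m" "t > 0" "x \<in> G"
  shows "(U r t has_derivative (\<lambda>h. blinfun_apply (D r (t, x)) (0, h))) (at x)"
proof -
  have "((\<lambda>x. (t, x)) has_derivative (\<lambda>h. (0, h))) (at x)"
    by (intro has_derivative_Pair has_derivative_const has_derivative_ident)
  from has_derivative_compose[OF this D(1)[OF assms]] show ?thesis by simp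
qed

lemma U_deriv_axis:
  assumes "r < m" "t > 0" "x \<in> G"
  shows "deriv (\<lambda>h. U r t (x + h *\<^sub>R axis j 1)) 0 = Ux r j t x"
proof (rule DERIV_imp_deriv)
  have g: "((\<lambda>h. x + h *\<^sub>R axis j 1) has_derivative (\<lambda>h. h *\<^sub>R axis j 1)) (at 0)"
    by (auto intro!: derivative_eq_intros)
  have "((\<lambda>h. U r t (x + h *\<^sub>R axis j 1)) has_derivative (\<lambda>h. blinfun_apply (D r (t, x)) (0, h *\<^sub>R axis j 1))) (at 0)"
    by (rule has_derivative_compose[OF g]) (use U_deriv_x[OF assms] in simp)
  moreover have "(\<lambda>h. blinfun_apply (D r (t, x)) (0, h *\<^sub>R axis j 1)) = (*) (Ux r j t x)"
  proof
    fix h :: real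
    have "(0 :: real, h *\<^sub>R axis j 1 :: real^3) = h *\<^sub>R (0, axis j 1)" by simp
    thus "blinfun_apply (D r (t, x)) (0, h *\<^sub>R axis j 1) = Ux r j t x * h"
      unfolding Ux_def by (simp only: blinfun.scaleR_right) simp
  qed
  ultimately show "((\<lambda>h. U r t (x + h *\<^sub>R axis j 1)) has_real_derivative Ux r j t x) (at 0)"
    by (simp add: has_field_derivative_def)
qed

text \<open>\<open>E\<close> is the energy density, and \<open>P\<close> and \<open>dv\<close> are
  its time derivative and the divergence of its flux. The latter two are built from \<open>D\<close>
  instead of \<open>deriv\<close>, which makes them continuous on the closure of \<open>G\<close> at
  positive times.\<close>

definition E :: "real \<Rightarrow> real ^ 3 \<Rightarrow> real" where "E t x = (\<Sum>r<m. (U r t x)\<^sup>2)"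
definition P :: "real \<Rightarrow> real ^ 3 \<Rightarrow> real" where "P t x = 2 * (\<Sum>r<m. U r t x * Ut r t x)"
definition dv :: "real \<Rightarrow> real ^ 3 \<Rightarrow> real" where
  "dv t x = 2 * (\<Sum>r<m. U r t x * (\<Sum>j\<in>UNIV. \<Sum>c<m. a j r c * Ux c j t x))"
definition flux :: "3 \<Rightarrow> real \<Rightarrow> real ^ 3 \<Rightarrow> real" where
  "flux j t x = (\<Sum>r<m. \<Sum>c<m. a j r c * (U r t x * U c t x))"
definition F :: "real \<Rightarrow> real ^ 3 \<Rightarrow> real ^ 3" where
  "F t x = (\<Sum>j\<in>UNIV. \<Sum>r<m. \<Sum>c<m. (a j r c * (U r t x * U c t x)) *\<^sub>R axis j 1)"

lemma sum_axis_nth: "(\<Sum>j\<in>UNIV. f j *\<^sub>R axis j 1 :: real ^ 3) $ k = f k"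
  by (simp add: axis_def if_distrib[of "\<lambda>x. _ * x"] cong: if_cong)

lemma F_nth: "F t x $ k = flux k t x"
proof -
  have "F t x = (\<Sum>j\<in>UNIV. flux j t x *\<^sub>R axis j 1)"
    by (simp add: F_def flux_def scaleR_sum_left)
  thus ?thesis by (simp add: sum_axis_nth del: sum_component)
qed

lemma F_C1: "t > 0 \<Longrightarrow> C1_up_to G (closure G) (F t)"
proof -
  assume t: "t > 0"
  have U: "C1_up_to G (closure G) (U r t)" if "r < m" for r
    using C1_up_to_slice[OF C1[OF that], of t] t by simp
  show ?thesis unfolding F_def[abs_def]
    by (intro C1_up_to_sum C1_up_to_mult_scaleR U) auto
qed

text \<open>The product rule produces two sums that differ by exchanging the indices
  \<open>r\<close> and \<open>c\<close>; symmetry of the coefficient matrices identifies them and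
  gives the factor 2 in \<open>dv\<close>.\<close>

lemma F_divergence:
  assumes t: "t > 0" and x: "x \<in> G"
  shows "divergence (F t) x = dv t x"
proof -
  let ?d = "\<lambda>r h. blinfun_apply (D r (t, x)) (0, h)"
  let ?f' = "\<lambda>h. \<Sum>j\<in>UNIV. (\<Sum>r<m. \<Sum>c<m. a j r c * (U r t x * ?d c h + ?d r h * U c t x)) *\<^sub>R axis j 1 :: real ^ 3"
  have tm: "((\<lambda>y. (a j r c * (U r t y * U c t y)) *\<^sub>R axis j 1 :: real ^ 3) has_derivative
      (\<lambda>h. (a j r c * (U r t x * ?d c h + ?d r h * U c t x)) *\<^sub>R axis j 1)) (at x)"
    if "r \<in> {..<m}" "c \<in> {..<m}" for j r c
  proof -
    have "r < m" "c < m" using that by auto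
    note d = U_deriv_x[OF this(1) t x] U_deriv_x[OF this(2) t x]
    show ?thesis
      by (rule has_derivative_scaleR_left[OF has_derivative_mult_right[OF has_derivative_mult[OF d]]])
  qed
  have "(F t has_derivative ?f') (at x)"
    unfolding F_def[abs_def] scaleR_sum_left by (intro has_derivative_sum tm)
  hence "frechet_derivative (F t) (at x) = ?f'" by (rule frechet_derivative_at[symmetric])
  hence "divergence (F t) x = (\<Sum>k\<in>UNIV. \<Sum>r<m. \<Sum>c<m. a k r c * (U r t x * Ux c k t x + Ux r k t x * U c t x))"
    unfolding divergence_def by (simp only: sum_axis_nth Ux_def)
  also have "\<dots> = (\<Sum>k\<in>UNIV. 2 * (\<Sum>r<m. \<Sum>c<m. a k r c * (U r t x * Ux c k t x)))"
  proof (rule sum.cong[OF refl])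
    fix k :: 3
    have "(\<Sum>r<m. \<Sum>c<m. a k r c * (Ux r k t x * U c t x)) = (\<Sum>c<m. \<Sum>r<m. a k r c * (Ux r k t x * U c t x))"
      by (rule sum.swap)
    also have "\<dots> = (\<Sum>r<m. \<Sum>c<m. a k r c * (U r t x * Ux c k t x))"
      by (intro sum.cong refl) (use sym in \<open>auto simp: mult_ac\<close>)
    finally show "(\<Sum>r<m. \<Sum>c<m. a k r c * (U r t x * Ux c k t x + Ux r k t x * U c t x)) = 2 * (\<Sum>r<m. \<Sum>c<m. a k r c * (U r t x * Ux c k t x))"
      by (simp add: distrib_left sum.distrib)
  qed
  also have "\<dots> = 2 * (\<Sum>k\<in>UNIV. \<Sum>r<m. U r t x * (\<Sum>c<m. a k r c * Ux c k t x))"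
    by (simp add: sum_distrib_left mult_ac)
  also have "\<dots> = dv t x"
    unfolding dv_def by (subst sum.swap) (simp add: sum_distrib_left)
  finally show ?thesis .
qed

lemma P_le: "t > 0 \<Longrightarrow> x \<in> G \<Longrightarrow> P t x \<le> - dv t x"
proof -
  assume t: "t > 0" and x: "x \<in> G"
  have "(\<Sum>r<m. U r t x * (Ut r t x + (\<Sum>j\<in>UNIV. \<Sum>c<m. a j r c * Ux c j t x))) \<le> 0"
    using dissipative[OF t x] t x by (simp add: U_deriv_axis DERIV_imp_deriv[OF U_deriv_t])
  thus ?thesis by (simp add: P_def dv_def distrib_left sum.distrib)
qed

lemma E_deriv:
  assumes "t > 0" "x \<in> G"
  shows "((\<lambda>s. E s x) has_real_derivative P t x) (at t)"
proof -
  have "((\<lambda>s. \<Sum>r<m. (U r s x)\<^sup>2) has_real_derivative (\<Sum>r<m. 2 * U r t x * Ut r t x)) (at t)"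
  proof (rule DERIV_sum)
    fix r assume "r \<in> {..<m}"
    hence "((\<lambda>s. U r s x) has_real_derivative Ut r t x) (at t)" using U_deriv_t assms by simp
    from DERIV_power[OF this, of 2]
    show "((\<lambda>s. (U r s x)\<^sup>2) has_real_derivative 2 * U r t x * Ut r t x) (at t)" by (simp add: mult_ac)
  qed
  thus ?thesis by (simp add: E_def[abs_def] P_def sum_distrib_left mult_ac)
qed

lemma cont_pos: "r < m \<Longrightarrow> continuous_on ({0<..} \<times> closure G) (\<lambda>z. U r (fst z) (snd z))"
proof -
  assume r: "r < m"
  have "{0<..} \<times> closure G \<subseteq> {0 :: real..} \<times> closure G" by auto
  from continuous_on_subset[OF cont[OF r] this] show ?thesis by (simp add: case_prod_unfold)
qed

lemma cont_E: "continuous_on ({0..} \<times> closure G) (\<lambda>z. E (fst z) (snd z))"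
  unfolding E_def using cont by (auto intro!: continuous_intros simp: case_prod_unfold)

lemma cont_P: "continuous_on ({0<..} \<times> closure G) (\<lambda>z. P (fst z) (snd z))"
  unfolding P_def Ut_def prod.collapse by (intro continuous_intros cont_pos D(2)) auto

lemma cont_dv: "continuous_on ({0<..} \<times> closure G) (\<lambda>z. dv (fst z) (snd z))"
  unfolding dv_def Ux_def prod.collapse by (intro continuous_intros cont_pos D(2)) auto

lemma cont_flux: "continuous_on ({0<..} \<times> closure G) (\<lambda>z. flux j (fst z) (snd z))"
  unfolding flux_def by (intro continuous_intros cont_pos) auto

section \<open>Energy balance over the domain\<close>

abbreviation "MG \<equiv> restrict_space lborel G"

lemma G: "open G" "bounded G" "G \<in> sets borel" "compact (closure G)"
  using domain by (auto simp: divergence_domain_def compact_closure)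

lemma finite_MG: "finite_measure MG"
proof (rule finite_measureI)
  have "emeasure MG (space MG) = emeasure lborel G"
    using G(3) by (subst emeasure_restrict_space) (auto simp: space_restrict_space)
  thus "emeasure MG (space MG) \<noteq> \<infinity>" using emeasure_bounded_finite[OF G(2)] by simp
qed

lemma space_MG: "space MG = G"
  by (simp add: space_restrict_space)

lemma measurable_MG:
  fixes f :: "real ^ 3 \<Rightarrow> real"
  assumes "continuous_on (closure G) f"
  shows "f \<in> borel_measurable MG"
proof -
  have "f \<in> borel_measurable (restrict_space borel G)"
    using assms closure_subset by (intro borel_measurable_continuous_on_restrict) (rule continuous_on_subset)
  thus ?thesis by (simp add: measurable_cong_sets[OF sets_restrict_space_cong[OF sets_lborel] refl])
qed

lemma integrable_MG:
  fixes f :: "real ^ 3 \<Rightarrow> real"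
  assumes "continuous_on (closure G) f"
  shows "integrable MG f"
proof -
  interpret finite_measure MG by (rule finite_MG)
  have "bounded (f ` closure G)"
    using compact_continuous_image[OF assms G(4)] by (rule compact_imp_bounded)
  then obtain B where "\<And>x. x \<in> closure G \<Longrightarrow> norm (f x) \<le> B" unfolding bounded_iff by auto
  thus ?thesis
    using closure_subset[of G]
    by (intro integrable_const_bound[where B=B] measurable_MG assms AE_I2) (auto simp: space_MG)
qed

lemma slice:
  fixes f :: "real \<times> (real ^ 3) \<Rightarrow> real"
  assumes "continuous_on (A \<times> closure G) f" "t \<in> A"
  shows "continuous_on (closure G) (\<lambda>x. f (t, x))"
  by (rule continuous_on_compose2[OF assms(1)]) (use assms(2) in \<open>auto intro!: continuous_intros\<close>)

lemma E_continuous: "t \<ge> 0 \<Longrightarrow> continuous_on (closure G) (E t)"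
  using slice[OF cont_E, of t] by simp

lemma flux_balance:
  assumes t: "t > 0"
  shows "(LINT x|MG. P t x) \<le> (LINT x|boundary_measure G. - (\<Sum>j\<in>UNIV. flux j t x * n x $ j))"
proof -
  have c: "continuous_on (closure G) (P t)" "continuous_on (closure G) (dv t)"
    using slice[OF cont_P, of t] slice[OF cont_dv, of t] t by auto
  have "(LINT x|MG. P t x) \<le> (LINT x|MG. - dv t x)"
    by (rule integral_mono) (use c P_le t in \<open>auto intro!: integrable_MG continuous_intros simp: space_MG\<close>)
  also have "\<dots> = - (LINT x|MG. dv t x)" by simp
  also have "(LINT x|MG. dv t x) = (LINT x|MG. divergence (F t) x)"
    by (rule Bochner_Integration.integral_cong) (auto simp: space_MG F_divergence t)
  also have "\<dots> = (LINT x:G|lborel. divergence (F t) x)"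
    unfolding set_lebesgue_integral_def by (rule integral_restrict_space) (use G(3) in auto)
  also have "\<dots> = (LINT x|boundary_measure G. F t x \<bullet> n x)"
    using domain F_C1[OF t] by (simp add: divergence_domain_def)
  also have "\<dots> = (LINT x|boundary_measure G. (\<Sum>j\<in>UNIV. flux j t x * n x $ j))"
    by (simp add: inner_vec_def F_nth)
  finally show ?thesis by simp
qed

abbreviation "MT s T \<equiv> restrict_space lborel {s..T}"

text \<open>The fundamental theorem of calculus at each point, followed by Fubini. Starting at a
  positive \<open>s\<close> confines \<open>P\<close> to a compact set on which it is continuous,
  hence bounded; nothing is assumed about \<open>P\<close> as time tends to 0.\<close>

lemma E_increment:
  assumes s: "0 < s" "s \<le> T"
  shows "(LINT x|MG. E T x) - (LINT x|MG. E s x) = (LINT t|MT s T. (LINT x|MG. P t x))"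
    and "integrable (MT s T) (\<lambda>t. LINT x|MG. P t x)"
proof -
  interpret MG: finite_measure MG by (rule finite_MG)
  interpret MT: finite_measure "MT s T"
    by (rule finite_measureI) (use s in \<open>simp add: emeasure_restrict_space space_restrict_space\<close>)
  interpret pair_sigma_finite "MT s T" MG by unfold_locales
  have sp: "space (MT s T) = {s..T}" by (simp add: space_restrict_space)
  have "continuous_on ({s..T} \<times> closure G) (\<lambda>z. P (fst z) (snd z))"
    by (rule continuous_on_subset[OF cont_P]) (use s in auto)
  moreover from this have "bounded ((\<lambda>z. P (fst z) (snd z)) ` ({s..T} \<times> closure G))"
    by (intro compact_imp_bounded compact_continuous_image compact_Times G) auto
  ultimately obtain B where B: "\<And>t x. t \<in> {s..T} \<Longrightarrow> x \<in> closure G \<Longrightarrow> \<bar>P t x\<bar> \<le> B"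
    unfolding bounded_iff by (fastforce simp: image_iff)
  have m: "(\<lambda>z. P (fst z) (snd z)) \<in> borel_measurable (MT s T \<Otimes>\<^sub>M MG)"
    by (rule measurable_pair_continuous[OF cont_P])
      (use s closure_subset[of G] in \<open>auto simp: sp space_MG intro: measurable_restrict_space1\<close>)
  interpret fp: finite_measure "MT s T \<Otimes>\<^sub>M MG"
    by (rule finite_measure_pair_measure) unfold_locales
  have i: "integrable (MT s T \<Otimes>\<^sub>M MG) (\<lambda>z. P (fst z) (snd z))"
    by (rule fp.integrable_const_bound[where B=B, OF AE_I2 m])
      (use B closure_subset[of G] in \<open>auto simp: space_pair_measure sp space_MG\<close>)
  show "integrable (MT s T) (\<lambda>t. LINT x|MG. P t x)" using integrable_fst'[OF i] by simp
  have ftc: "(LINT t|MT s T. P t x) = E T x - E s x" if x: "x \<in> G" for x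
  proof -
    have "(LINT t|MT s T. P t x) = (LBINT t. P t x * indicat_real {s..T} t)"
      by (subst integral_restrict_space) (auto simp: mult.commute)
    also have "\<dots> = E T x - E s x"
    proof (rule integral_FTC_Icc_real[OF s(2)])
      fix t assume t: "s \<le> t" "t \<le> T"
      show "((\<lambda>s. E s x) has_real_derivative P t x) (at t)" using E_deriv t s x by simp
      have "continuous_on {0<..} (\<lambda>t. (\<lambda>z. P (fst z) (snd z)) (t, x))"
        by (rule continuous_on_compose2[OF cont_P]) (use x closure_subset[of G] in \<open>auto intro!: continuous_intros\<close>)
      hence "continuous_on {0<..} (\<lambda>t. P t x)" by simp
      thus "isCont (\<lambda>t. P t x) t" using t s by (simp add: continuous_on_eq_continuous_at)
    qed
    finally show ?thesis .
  qed
  have "(LINT x|MG. E T x) - (LINT x|MG. E s x) = (LINT x|MG. E T x - E s x)"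
    using s by (intro Bochner_Integration.integral_diff[symmetric] integrable_MG E_continuous) auto
  also have "\<dots> = (LINT x|MG. (LINT t|MT s T. P t x))"
    by (rule Bochner_Integration.integral_cong) (auto simp: space_MG ftc)
  also have "\<dots> = (LINT t|MT s T. (LINT x|MG. P t x))"
    using Fubini_integral[of P] i by (simp add: case_prod_unfold)
  finally show "(LINT x|MG. E T x) - (LINT x|MG. E s x) = (LINT t|MT s T. (LINT x|MG. P t x))" .
qed

section \<open>The boundary term and the limit at the initial time\<close>

abbreviation "MB \<equiv> boundary_measure G"
abbreviation "M0 T \<equiv> restrict_space lborel {0<..<T}"

text \<open>
  \<open>\<gamma>\<close> is not assumed to be measurable (the rotations in the boundary data are arbitrary), so its
  integral is a lower integral; the comparison goes through the measurable flux.
\<close>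
lemma boundary_bound:
  assumes T: "T > 0"
  shows "(\<integral>\<^sup>+t. (\<integral>\<^sup>+x. ennreal (- (\<Sum>j\<in>UNIV. flux j t x * n x $ j)) \<partial>MB) \<partial>M0 T)
     \<le> ennreal K * (\<integral>\<^sup>+z. ennreal (\<gamma> (fst z) (snd z)) \<partial>(M0 T \<Otimes>\<^sub>M MB))"
proof -
  interpret MB: finite_measure MB using domain by (simp add: divergence_domain_def)
  have sp: "space (M0 T) = {0<..<T}" by (simp add: space_restrict_space)
  define b where "b z = - (\<Sum>j\<in>UNIV. flux j (fst z) (snd z) * n (snd z) $ j)" for z
  have nm: "n \<in> borel_measurable MB" using domain by (simp add: divergence_domain_def)
  have nj: "(\<lambda>x. n x $ j) \<in> borel_measurable MB" for j
    by (rule measurable_compose[OF nm]) (intro borel_measurable_continuous_onI continuous_intros)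
  have fm: "(\<lambda>z. flux j (fst z) (snd z)) \<in> borel_measurable (M0 T \<Otimes>\<^sub>M MB)" for j
    by (rule measurable_pair_continuous[OF cont_flux])
      (auto simp: sp space_boundary_measure frontier_def measurable_ident_boundary intro: measurable_restrict_space1)
  have bm: "b \<in> borel_measurable (M0 T \<Otimes>\<^sub>M MB)"
    unfolding b_def[abs_def]
    by (intro borel_measurable_uminus borel_measurable_sum borel_measurable_times fm measurable_compose[OF measurable_snd nj])
  have ae: "AE z in M0 T \<Otimes>\<^sub>M MB. b z / K \<le> \<gamma> (fst z) (snd z)"
  proof -
    \<comment> \<open>The exceptional set of boundary points is uniform in \<open>t\<close>, so its
      product with the time interval is a null set.\<close>
    obtain Z where Z: "Z \<in> null_sets MB"
      "{x \<in> space MB. \<not> (\<forall>t>0. - (\<Sum>j\<in>UNIV. flux j t x * n x $ j) \<le> K * \<gamma> t x)} \<subseteq> Z"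
      using boundary unfolding eventually_ae_filter flux_def by auto
    have "{0<..<T} \<times> Z \<in> null_sets (M0 T \<Otimes>\<^sub>M MB)"
      by (rule MB.times_in_null_sets2[OF _ Z(1)]) (metis sets.top sp)
    moreover have "{z \<in> space (M0 T \<Otimes>\<^sub>M MB). \<not> b z / K \<le> \<gamma> (fst z) (snd z)} \<subseteq> {0<..<T} \<times> Z"
    proof
      fix z assume z: "z \<in> {z \<in> space (M0 T \<Otimes>\<^sub>M MB). \<not> b z / K \<le> \<gamma> (fst z) (snd z)}"
      hence s: "fst z \<in> {0<..<T}" "snd z \<in> space MB" by (auto simp: space_pair_measure sp)
      have "\<not> b z \<le> K * \<gamma> (fst z) (snd z)" using z K by (simp add: field_simps)
      hence "snd z \<in> Z" using s Z(2) unfolding b_def by auto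
      thus "z \<in> {0<..<T} \<times> Z" using s by (auto simp: mem_Times_iff)
    qed
    ultimately show ?thesis by (rule AE_I')
  qed
  have "(\<integral>\<^sup>+t. (\<integral>\<^sup>+x. ennreal (- (\<Sum>j\<in>UNIV. flux j t x * n x $ j)) \<partial>MB) \<partial>M0 T)
     = (\<integral>\<^sup>+z. ennreal (b z) \<partial>(M0 T \<Otimes>\<^sub>M MB))"
    using MB.nn_integral_fst[OF measurable_compose[OF bm measurable_ennreal]] by (simp add: b_def)
  \<comment> \<open>The constant is split off on the side of the measurable flux, where it may be
    moved out of the integral.\<close>
  also have "\<dots> = (\<integral>\<^sup>+z. ennreal K * ennreal (b z / K) \<partial>(M0 T \<Otimes>\<^sub>M MB))"
    using K by (intro nn_integral_cong) (simp add: ennreal_mult'[symmetric])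
  also have "\<dots> = ennreal K * (\<integral>\<^sup>+z. ennreal (b z / K) \<partial>(M0 T \<Otimes>\<^sub>M MB))"
    using bm by (intro nn_integral_cmult) auto
  also have "\<dots> \<le> ennreal K * (\<integral>\<^sup>+z. ennreal (\<gamma> (fst z) (snd z)) \<partial>(M0 T \<Otimes>\<^sub>M MB))"
    using ae by (intro mult_left_mono nn_integral_mono_AE) (auto elim!: eventually_mono intro: ennreal_leI)
  finally show ?thesis .
qed

lemma E_nonneg: "E t x \<ge> 0" by (simp add: E_def sum_nonneg)

lemma nn_integral_E: "t \<ge> 0 \<Longrightarrow> (\<integral>\<^sup>+x. ennreal (E t x) \<partial>MG) = ennreal (LINT x|MG. E t x)"
  by (intro nn_integral_eq_integral integrable_MG E_continuous) (auto simp: E_nonneg)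

lemma energy_pos:
  assumes s: "0 < s" "s < T"
  shows "ennreal (LINT x|MG. E T x) \<le> ennreal (LINT x|MG. E s x) +
     ennreal K * (\<integral>\<^sup>+z. ennreal (\<gamma> (fst z) (snd z)) \<partial>(M0 T \<Otimes>\<^sub>M MB))"
proof -
  let ?b = "\<lambda>t. (\<integral>\<^sup>+x. ennreal (- (\<Sum>j\<in>UNIV. flux j t x * n x $ j)) \<partial>MB)"
  have sT: "s \<le> T" "T > 0" using s by auto
  have pos: "0 \<le> (LINT x|MG. E s x)" by (intro Bochner_Integration.integral_nonneg E_nonneg)
  have "(LINT x|MG. E T x) = (LINT x|MG. E s x) + (LINT t|MT s T. (LINT x|MG. P t x))"
    using E_increment(1)[OF s(1) sT(1)] by linarith
  hence "ennreal (LINT x|MG. E T x) = ennreal ((LINT x|MG. E s x) + (LINT t|MT s T. (LINT x|MG. P t x)))"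
    by (rule arg_cong)
  \<comment> \<open>The increment may be negative; \<open>ennreal\<close> then truncates it to 0,
    which only enlarges the right-hand side.\<close>
  also have "\<dots> \<le> ennreal (LINT x|MG. E s x) + ennreal (LINT t|MT s T. (LINT x|MG. P t x))"
    using pos by (cases "0 \<le> (LINT t|MT s T. (LINT x|MG. P t x))")
      (auto simp: ennreal_plus ennreal_neg intro!: ennreal_leI)
  also have "ennreal (LINT t|MT s T. (LINT x|MG. P t x)) \<le> (\<integral>\<^sup>+t. ennreal (LINT x|MG. P t x) \<partial>MT s T)"
    by (rule ennreal_integral_le)
  also have "\<dots> \<le> (\<integral>\<^sup>+t. ?b t \<partial>MT s T)"
  proof (rule nn_integral_mono)
    fix t assume "t \<in> space (MT s T)"
    hence "t > 0" using s by (simp add: space_restrict_space)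
    from ennreal_leI[OF flux_balance[OF this]] ennreal_integral_le
    show "ennreal (LINT x|MG. P t x) \<le> ?b t" by (rule order_trans)
  qed
  also have "\<dots> \<le> (\<integral>\<^sup>+t. ?b t \<partial>M0 T)"
  proof -
    \<comment> \<open>Apart from the single point \<open>T\<close>, a null set, the interval
      \<open>{s..T}\<close> lies in \<open>{0<..<T}\<close>.\<close>
    have "(\<integral>\<^sup>+t. ?b t * indicator {s..T} t \<partial>lborel) \<le> (\<integral>\<^sup>+t. ?b t * indicator {0<..<T} t \<partial>lborel)"
      using AE_lborel_singleton[of T] s
      by (intro nn_integral_mono_AE) (auto elim!: eventually_mono simp: indicator_def)
    thus ?thesis by (simp add: nn_integral_restrict_space)
  qed
  also note boundary_bound[OF sT(2)]
  finally show ?thesis by (simp add: add_left_mono)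
qed

text \<open>The times \<open>T / (k + 2)\<close> lie strictly between 0 and \<open>T\<close> for
  every \<open>k\<close>. Continuity of \<open>E\<close> on the compact set \<open>{0..T}\<close>
  times the closure of \<open>G\<close> gives both the pointwise limit and a constant dominating
  function.\<close>

lemma energy_initial_limit:
  assumes T: "T > 0"
  shows "(\<lambda>k. LINT x|MG. E (T / real (k + 2)) x) \<longlonglongrightarrow> (LINT x|MG. E 0 x)"
proof -
  interpret MG: finite_measure MG by (rule finite_MG)
  have s: "0 \<le> T / real (k + 2)" "T / real (k + 2) \<le> T" for k
    using T by (auto simp: field_simps)
  have "continuous_on ({0..T} \<times> closure G) (\<lambda>z. E (fst z) (snd z))"
    by (rule continuous_on_subset[OF cont_E]) auto
  hence "bounded ((\<lambda>z. E (fst z) (snd z)) ` ({0..T} \<times> closure G))"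
    by (intro compact_imp_bounded compact_continuous_image compact_Times G) auto
  then obtain B where B: "\<And>t x. t \<in> {0..T} \<Longrightarrow> x \<in> closure G \<Longrightarrow> norm (E t x) \<le> B"
    unfolding bounded_iff by (fastforce simp: image_iff)
  have lim0: "(\<lambda>k. T / real (k + 2)) \<longlonglongrightarrow> 0"
    using LIMSEQ_ignore_initial_segment[OF lim_const_over_n[of T], of 2] by simp
  show ?thesis
  proof (rule integral_dominated_convergence[where w="\<lambda>_. B"])
    show "E 0 \<in> borel_measurable MG" "\<And>k. E (T / real (k + 2)) \<in> borel_measurable MG"
      using s by (auto intro!: measurable_MG E_continuous)
    show "AE x in MG. (\<lambda>k. E (T / real (k + 2)) x) \<longlonglongrightarrow> E 0 x"
    proof (rule AE_I2)
      fix x assume "x \<in> space MG"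
      hence x: "x \<in> closure G" using closure_subset[of G] by (auto simp: space_MG)
      have "continuous_on {0..} (\<lambda>t. (\<lambda>z. E (fst z) (snd z)) (t, x))"
        by (rule continuous_on_compose2[OF cont_E]) (use x in \<open>auto intro!: continuous_intros\<close>)
      hence "continuous_on {0..} (\<lambda>t. E t x)" by simp
      from continuous_on_tendsto_compose[OF this lim0]
      show "(\<lambda>k. E (T / real (k + 2)) x) \<longlonglongrightarrow> E 0 x" using s by simp
    qed
    show "AE x in MG. norm (E (T / real (k + 2)) x) \<le> B" for k
      by (rule AE_I2) (use B s closure_subset[of G] in \<open>auto simp: space_MG\<close>)
  qed simp
qed

lemma energy_bound:
  assumes T: "T > 0"
  shows "(\<integral>\<^sup>+x. ennreal (E T x) \<partial>MG) \<le> (\<integral>\<^sup>+x. ennreal (E 0 x) \<partial>MG) +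
     ennreal K * (\<integral>\<^sup>+z. ennreal (\<gamma> (fst z) (snd z)) \<partial>(M0 T \<Otimes>\<^sub>M MB))"
proof -
  define R where "R = ennreal K * (\<integral>\<^sup>+z. ennreal (\<gamma> (fst z) (snd z)) \<partial>(M0 T \<Otimes>\<^sub>M MB))"
  have "ennreal (LINT x|MG. E T x) \<le> ennreal (LINT x|MG. E 0 x) + R"
  \<comment> \<open>For infinite \<open>R\<close> the claim is trivial; for finite \<open>R\<close>
    the inequality is transferred to the reals, where the limit can be taken.\<close>
  proof (cases R)
    case (real r)
    have "(LINT x|MG. E T x) \<le> (LINT x|MG. E (T / real (k + 2)) x) + r" for k
    proof -
      have "T * 1 < T * real (k + 2)" using T by (intro mult_strict_left_mono) auto
      hence "T / real (k + 2) < T" "0 < T / real (k + 2)" using T by (simp_all add: pos_divide_less_eq)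
      from energy_pos[OF this(2,1)]
      have "ennreal (LINT x|MG. E T x) \<le> ennreal ((LINT x|MG. E (T / real (k + 2)) x) + r)"
        using real unfolding R_def by (simp add: ennreal_plus Bochner_Integration.integral_nonneg E_nonneg)
      moreover have "0 \<le> (LINT x|MG. E (T / real (k + 2)) x) + r"
        using real by (intro add_nonneg_nonneg Bochner_Integration.integral_nonneg E_nonneg) auto
      ultimately show ?thesis by (simp add: ennreal_le_iff)
    qed
    moreover have "(\<lambda>k. (LINT x|MG. E (T / real (k + 2)) x) + r) \<longlonglongrightarrow> (LINT x|MG. E 0 x) + r"
      by (intro tendsto_add energy_initial_limit[OF T] tendsto_const)
    ultimately have "(LINT x|MG. E T x) \<le> (LINT x|MG. E 0 x) + r"
      by (intro LIMSEQ_le_const) auto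
    hence "ennreal (LINT x|MG. E T x) \<le> ennreal ((LINT x|MG. E 0 x) + r)" by (rule ennreal_leI)
    thus ?thesis using real by (simp add: ennreal_plus Bochner_Integration.integral_nonneg E_nonneg)
  qed simp
  thus ?thesis using T by (simp add: nn_integral_E R_def)
qed

end

section \<open>The energy bound\<close>

lemma scalar_prod_le_vec_norm2:
  assumes "v \<in> carrier_vec k" "w \<in> carrier_vec k"
  shows "scalar_prod v w \<le> vec_norm2 v * vec_norm2 w"
proof -
  have "vec_norm2 u = L2_set (vec_index u) {0..<k}" if "u \<in> carrier_vec k" for u
    using that by (simp add: vec_norm2_def L2_set_def scalar_prod_def power2_eq_square)
  moreover have "scalar_prod v w \<le> (\<Sum>i\<in>{0..<k}. \<bar>vec_index v i\<bar> * \<bar>vec_index w i\<bar>)"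
    using assms unfolding scalar_prod_def by (auto intro!: sum_mono simp: abs_mult[symmetric])
  ultimately show ?thesis
    using L2_set_mult_ineq[of "vec_index v" "vec_index w" "{0..<k}"] assms by simp
qed

lemma vec_norm2_sq: "(vec_norm2 v)\<^sup>2 = scalar_prod v v"
  unfolding vec_norm2_def by (intro real_sqrt_pow2) (auto simp: scalar_prod_def intro: sum_nonneg)

lemma vec_norm2_nonneg: "vec_norm2 v \<ge> 0"
  unfolding vec_norm2_def by (intro real_sqrt_ge_zero) (auto simp: scalar_prod_def intro: sum_nonneg)

text \<open>The coordinate \<open>Omega_i\<close> is odd, of degree 1 and nonzero at
  \<open>e_i\<close>, so its expansion must contain an odd harmonic. This makes the matrices
  nontrivial and the spectral norm positive.\<close>

lemma odd_idx_nonempty: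
  assumes "N \<ge> 1"
  shows "length (odd_idx N i) > 0"
proof (rule ccontr)
  assume "\<not> length (odd_idx N i) > 0"
  hence 0: "odd_idx N i = []" by simp
  have "sph_span N (\<lambda>\<Omega>. \<Omega> $ i)"
    by (rule polyf_sph_span, rule polyf_mono[OF assms polyf_nth])
  moreover have "odd_dir (axis i 1) (\<lambda>\<Omega>. \<Omega> $ i)" by (simp add: odd_dir_def reflect_axis_nth)
  moreover have "continuous_on (sphere 0 1) (\<lambda>\<Omega> :: real^3. \<Omega> $ i)" by (intro continuous_intros)
  moreover have "(axis i 1 :: real^3) \<in> sphere 0 1" by (simp add: norm_axis_1)
  ultimately have "(axis i 1 :: real^3) $ i = 0"
    using expansion_odd[of N "\<lambda>\<Omega>. \<Omega> $ i" i "axis i 1"] 0 by (simp add: harm_comb_def)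
  thus False by (simp add: axis_def)
qed

text \<open>With \<open>y = B g\<close>, the lower bound for \<open>L\<close> gives
  \<open>|y|^2 <= y . L y = y . g <= |y| |g|\<close>.\<close>

lemma L_inverse_contraction:
  assumes B: "B \<in> carrier_mat (length (odd_idx N i)) (length (odd_idx N i))"
    "L_mat N i * B = 1\<^sub>m (length (odd_idx N i))"
    and g: "g \<in> carrier_vec (length (odd_idx N i))"
  shows "vec_norm2 (B *\<^sub>v g) \<le> vec_norm2 g"
proof -
  define y where "y = B *\<^sub>v g"
  have y: "y \<in> carrier_vec (length (odd_idx N i))" unfolding y_def using B g by (intro mult_mat_vec_carrier)
  have Ly: "L_mat N i *\<^sub>v y = g"
    unfolding y_def assoc_mult_mat_vec[OF L_mat_carrier B(1) g, symmetric] B(2) using g by simp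
  have "vec_norm2 y * vec_norm2 y \<le> vec_norm2 y * vec_norm2 g"
    using L_mat_ge[OF y] scalar_prod_le_vec_norm2[OF y g] vec_norm2_sq[of y] by (simp add: Ly power2_eq_square)
  thus ?thesis
    using vec_norm2_nonneg[of y] vec_norm2_nonneg[of g] unfolding y_def[symmetric]
    by (cases "vec_norm2 y = 0") auto
qed

text \<open>A real \<open>SUP\<close> is a supremum only over a set bounded above; the bound 1 comes
  from \<open>L_inverse_contraction\<close>, and at \<open>v = 0\<close> the quotient is
  \<open>0 / 0 = 0\<close>. Positivity supplies the assumption \<open>K > 0\<close> of the energy
  estimate.\<close>

lemma spectral_norm_L_inverse:
  fixes i :: 3
  assumes B: "B \<in> carrier_mat (length (odd_idx N i)) (length (odd_idx N i))"
    "L_mat N i * B = 1\<^sub>m (length (odd_idx N i))"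
  shows "\<And>g. g \<in> carrier_vec (length (odd_idx N i)) \<Longrightarrow> vec_norm2 (B *\<^sub>v g) \<le> spectral_norm B * vec_norm2 g"
    and "N \<ge> 1 \<Longrightarrow> spectral_norm B > 0"
proof -
  let ?k = "length (odd_idx N i)"
  have bdd: "bdd_above ((\<lambda>v. vec_norm2 (B *\<^sub>v v) / vec_norm2 v) ` carrier_vec (dim_col B))"
  proof (rule bdd_aboveI2[where M=1])
    fix v :: "real Matrix.vec" assume "v \<in> carrier_vec (dim_col B)"
    hence "v \<in> carrier_vec ?k" using B by simp
    from L_inverse_contraction[OF B this] show "vec_norm2 (B *\<^sub>v v) / vec_norm2 v \<le> 1"
      using vec_norm2_nonneg[of v] by (cases "vec_norm2 v = 0") (auto simp: divide_le_eq)
  qed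
  have le: "vec_norm2 (B *\<^sub>v g) / vec_norm2 g \<le> spectral_norm B" if "g \<in> carrier_vec ?k" for g
    unfolding spectral_norm_def by (rule cSUP_upper[OF _ bdd]) (use that B in simp)
  show "vec_norm2 (B *\<^sub>v g) \<le> spectral_norm B * vec_norm2 g" if g: "g \<in> carrier_vec ?k" for g
  proof (cases "vec_norm2 g = 0")
    case True
    thus ?thesis using L_inverse_contraction[OF B g] by simp
  next
    case False
    thus ?thesis using le[OF g] vec_norm2_nonneg[of g] by (simp add: divide_le_eq split: if_splits)
  qed
  assume "N \<ge> 1"
  hence k: "?k > 0" by (rule odd_idx_nonempty)
  define g where "g = (unit_vec ?k 0 :: real Matrix.vec)"
  have g: "g \<in> carrier_vec ?k" "g \<noteq> 0\<^sub>v ?k" using k by (auto simp: g_def)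
  have y: "B *\<^sub>v g \<in> carrier_vec ?k" using B g by (intro mult_mat_vec_carrier)
  have "B *\<^sub>v g \<noteq> 0\<^sub>v ?k"
  proof
    assume 0: "B *\<^sub>v g = 0\<^sub>v ?k"
    have "g = L_mat N i *\<^sub>v (B *\<^sub>v g)"
      unfolding assoc_mult_mat_vec[OF L_mat_carrier B(1) g(1), symmetric] B(2) using g by simp
    also have "\<dots> = 0\<^sub>v ?k" unfolding 0 using L_mat_carrier[of N i] by (intro eq_vecI) auto
    finally show False using g by simp
  qed
  hence "vec_norm2 (B *\<^sub>v g) > 0" "vec_norm2 g > 0"
    unfolding vec_norm2_def using scalar_prod_self_pos[OF y] scalar_prod_self_pos[OF g] by simp_all
  hence "0 < vec_norm2 (B *\<^sub>v g) / vec_norm2 g" by simp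
  thus "spectral_norm B > 0" using le[OF g(1)] by linarith
qed

text \<open>
  With \<open>w = A u^e\<close> and \<open>u^o = L w + g\<close>, completing the square in the form of \<open>L\<close> gives
  \<open>w \<cdot> L w + w \<cdot> g + g \<cdot> L^{-1} g / 4 \<ge> 0\<close>.
\<close>
lemma boundary_square:
  assumes B: "B \<in> carrier_mat (length (odd_idx N i)) (length (odd_idx N i))"
    "L_mat N i * B = 1\<^sub>m (length (odd_idx N i))"
    and w: "w \<in> carrier_vec (length (odd_idx N i))" and g: "g \<in> carrier_vec (length (odd_idx N i))"
  shows "- 2 * scalar_prod (L_mat N i *\<^sub>v w + g) w \<le> spectral_norm B * scalar_prod g g"
proof -
  let ?L = "L_mat N i" and ?k = "length (odd_idx N i)"
  note L = L_mat_carrier[of N i]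
  define y where "y = B *\<^sub>v g"
  have y: "y \<in> carrier_vec ?k" unfolding y_def using B g by (intro mult_mat_vec_carrier)
  have Lw: "?L *\<^sub>v w \<in> carrier_vec ?k" using L w by (intro mult_mat_vec_carrier)
  have Ly: "?L *\<^sub>v y = g"
    unfolding y_def assoc_mult_mat_vec[OF L B(1) g, symmetric] B(2) using g by simp
  define h where "h = (1/2) \<cdot>\<^sub>v y"
  have h: "h \<in> carrier_vec ?k" using y by (simp add: h_def)
  have Lh: "?L *\<^sub>v h = (1/2) \<cdot>\<^sub>v g" unfolding h_def Ly[symmetric] by (rule mult_mat_vec[OF L y])
  have hg: "(1/2) \<cdot>\<^sub>v g \<in> carrier_vec ?k" using g by simp
  have yLw: "scalar_prod y (?L *\<^sub>v w) = scalar_prod g w"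
    using transpose_vec_mult_scalar[OF L w y] unfolding L_mat_sym Ly by simp
  have wh: "w + h \<in> carrier_vec ?k" using w h by simp
  have yg: "scalar_prod y g = scalar_prod g y" by (rule comm_scalar_prod[OF y g])
  have wg: "scalar_prod w g = scalar_prod g w" by (rule comm_scalar_prod[OF w g])
  have "0 \<le> scalar_prod (w + h) (w + h)" by (auto simp: scalar_prod_def intro: sum_nonneg)
  also have "\<dots> \<le> scalar_prod (w + h) (?L *\<^sub>v (w + h))" by (rule L_mat_ge[OF wh])
  also have "?L *\<^sub>v (w + h) = ?L *\<^sub>v w + (1/2) \<cdot>\<^sub>v g"
    unfolding mult_add_distrib_mat_vec[OF L w h] Lh ..
  also have "scalar_prod (w + h) (?L *\<^sub>v w + (1/2) \<cdot>\<^sub>v g)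
     = scalar_prod w (?L *\<^sub>v w) + 1/2 * scalar_prod w g + (1/2 * scalar_prod y (?L *\<^sub>v w) + 1/4 * scalar_prod y g)"
    unfolding scalar_prod_add_distrib[OF wh Lw hg] add_scalar_prod_distrib[OF w h Lw] add_scalar_prod_distrib[OF w h hg]
    using w y g Lw by (simp add: h_def)
  finally have "0 \<le> scalar_prod w (?L *\<^sub>v w) + scalar_prod g w + 1/4 * scalar_prod g y"
    by (simp add: yLw yg wg)
  moreover have "scalar_prod (?L *\<^sub>v w + g) w = scalar_prod w (?L *\<^sub>v w) + scalar_prod g w"
    unfolding add_scalar_prod_distrib[OF Lw g w] comm_scalar_prod[OF Lw w] ..
  moreover have "scalar_prod g y \<le> spectral_norm B * scalar_prod g g"
  proof -
    have "scalar_prod g y \<le> vec_norm2 g * vec_norm2 y" by (rule scalar_prod_le_vec_norm2[OF g y])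
    also have "\<dots> \<le> vec_norm2 g * (spectral_norm B * vec_norm2 g)"
      unfolding y_def by (intro mult_left_mono spectral_norm_L_inverse(1)[OF B g] vec_norm2_nonneg)
    also have "\<dots> = spectral_norm B * scalar_prod g g"
      unfolding vec_norm2_sq[symmetric] by (simp add: power2_eq_square)
    finally show ?thesis .
  qed
  \<comment> \<open>The completed square bounds the left side by half of \<open>g . y\<close>. As
    this product is nonnegative, half of it may be replaced by the whole.\<close>
  moreover have "0 \<le> scalar_prod g y"
    using L_mat_ge[OF y] unfolding Ly yg by (rule order_trans[rotated]) (auto simp: scalar_prod_def intro: sum_nonneg)
  ultimately show ?thesis by linarith
qed

section \<open>The normal flux in rotated coordinates\<close>

lemma A_mat_carrier: "A_mat N j \<in> carrier_mat (length (sph_idx N)) (length (sph_idx N))"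
  by (rule carrier_matI) (simp_all add: A_mat_def)

lemma A_mat_index:
  "r < length (sph_idx N) \<Longrightarrow> c < length (sph_idx N) \<Longrightarrow>
    A_mat N j $$ (r, c) = (LINT \<Omega>|usph. \<Omega> $ j * sph_harm (sph_idx N ! r) \<Omega> * sph_harm (sph_idx N ! c) \<Omega>)"
  by (simp add: A_mat_def moment_mat_sphere_index Ups_nth)

lemma A_mat_form:
  "(\<Sum>j\<in>UNIV. (\<Sum>r<length (sph_idx N). \<Sum>c<length (sph_idx N). A_mat N j $$ (r, c) * (v r * v c)) * \<nu> $ j)
    = (LINT \<Omega>|usph. (\<Omega> \<bullet> \<nu>) * harm_comb (sph_idx N) v \<Omega> * harm_comb (sph_idx N) v \<Omega>)"
proof -
  let ?m = "length (sph_idx N)" and ?Y = "\<lambda>r. sph_harm (sph_idx N ! r)"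
  let ?f = "harm_comb (sph_idx N) v"
  have "(\<Sum>r<?m. \<Sum>c<?m. A_mat N j $$ (r, c) * (v r * v c)) = (LINT \<Omega>|usph. \<Omega> $ j * ?f \<Omega> * ?f \<Omega>)" for j
    unfolding harm_comb_def
    by (subst integral_bilinear(1)) (auto intro!: integrable_usph_continuous continuous_intros sum.cong simp: A_mat_index mult_ac)
  hence "(\<Sum>j\<in>UNIV. (\<Sum>r<?m. \<Sum>c<?m. A_mat N j $$ (r, c) * (v r * v c)) * \<nu> $ j)
     = (\<Sum>j\<in>UNIV. (LINT \<Omega>|usph. \<Omega> $ j * ?f \<Omega> * ?f \<Omega> * \<nu> $ j))"
    by simp
  also have "\<dots> = (LINT \<Omega>|usph. (\<Sum>j\<in>UNIV. \<Omega> $ j * ?f \<Omega> * ?f \<Omega> * \<nu> $ j))"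
    by (rule Bochner_Integration.integral_sum[symmetric]) (intro integrable_usph_continuous continuous_intros)
  also have "\<dots> = (LINT \<Omega>|usph. (\<Omega> \<bullet> \<nu>) * ?f \<Omega> * ?f \<Omega>)"
    by (rule integral_usph_cong) (simp add: inner_vec_def sum_distrib_left sum_distrib_right mult_ac)
  finally show ?thesis .
qed

text \<open>The substitution of \<open>transpose Q *v \<omega>\<close> for the direction turns its
  product with \<open>\<nu>\<close> into the \<open>i\<close>-th coordinate of
  \<open>\<omega>\<close> and undoes the rotation in both families of harmonics. By parity the
  squares of the odd and of the even part integrate to 0 against this coordinate, leaving twice the
  mixed term.\<close>

lemma boundary_form:
  assumes n: "rotation_matrix Q" "Q *v \<nu> = axis i 1"
    and uo: "uo \<in> carrier_vec (length (odd_idx N i))" and ue: "ue \<in> carrier_vec (length (even_idx N i))"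
    and rep: "\<And>\<Omega>. \<Omega> \<in> sphere 0 1 \<Longrightarrow> harm_comb (sph_idx N) v \<Omega>
       = lin_comb uo (rotate_fun Q (Ups_odd N i)) \<Omega> + lin_comb ue (rotate_fun Q (Ups_even N i)) \<Omega>"
  shows "(LINT \<Omega>|usph. (\<Omega> \<bullet> \<nu>) * harm_comb (sph_idx N) v \<Omega> * harm_comb (sph_idx N) v \<Omega>)
     = 2 * scalar_prod uo (A_hat N i *\<^sub>v ue)"
proof -
  let ?T = "\<lambda>\<omega>. transpose Q *v \<omega>"
  let ?o = "harm_comb (odd_idx N i) (vec_index uo)" and ?e = "harm_comb (even_idx N i) (vec_index ue)"
  have oQ: "orthogonal_matrix Q" using n(1) by (simp add: rotation_matrix_def)
  have T: "orthogonal_transformation ?T"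
    unfolding orthogonal_transformation_matrix matrix_of_matrix_vector_mul
    using oQ by (simp only: matrix_vector_mul_linear orthogonal_matrix_transpose simp_thms)
  have QT: "Q *v ?T \<omega> = \<omega>" for \<omega>
    unfolding matrix_vector_mul_assoc
    by (simp only: oQ[unfolded orthogonal_matrix_def] matrix_vector_mul_lid)
  have rot: "lin_comb b (rotate_fun Q w) (?T \<omega>) = lin_comb b w \<omega>" for b w \<omega>
    by (simp add: lin_comb_def rotate_fun_def QT del: transpose_matrix_vector)
  have "(LINT \<Omega>|usph. (\<Omega> \<bullet> \<nu>) * harm_comb (sph_idx N) v \<Omega> * harm_comb (sph_idx N) v \<Omega>)
    = (LINT \<omega>|usph. (\<omega> $ i) * (?o \<omega> + ?e \<omega>) * (?o \<omega> + ?e \<omega>))"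
  proof (rule integral_usph_rotate[OF T])
    show "continuous_on (sphere 0 1) (\<lambda>\<Omega>. (\<Omega> \<bullet> \<nu>) * harm_comb (sph_idx N) v \<Omega> * harm_comb (sph_idx N) v \<Omega>)"
      by (intro continuous_intros)
    fix \<omega> :: "real^3" assume S: "\<omega> \<in> sphere 0 1"
    have "?T \<omega> \<bullet> \<nu> = \<omega> \<bullet> (Q *v \<nu>)" by (simp add: dot_lmul_matrix[symmetric] transpose_matrix_vector)
    also have "\<dots> = \<omega> $ i" unfolding n(2) by (simp add: inner_axis)
    finally have "?T \<omega> \<bullet> \<nu> = \<omega> $ i" .
    thus "(?T \<omega> \<bullet> \<nu>) * harm_comb (sph_idx N) v (?T \<omega>) * harm_comb (sph_idx N) v (?T \<omega>) = (\<omega> $ i) * (?o \<omega> + ?e \<omega>) * (?o \<omega> + ?e \<omega>)"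
      unfolding rep[OF orthogonal_transformation_sphere[OF T S]] rot lin_comb_Ups by simp
  qed
  also have "\<dots> = (LINT \<omega>|usph. 1 * (\<omega> $ i * ?o \<omega> * ?o \<omega> + \<omega> $ i * ?e \<omega> * ?e \<omega>) + 2 * (\<omega> $ i * ?o \<omega> * ?e \<omega>))"
    by (rule integral_usph_cong) (simp add: algebra_simps)
  also have "\<dots> = 1 * (LINT \<omega>|usph. \<omega> $ i * ?o \<omega> * ?o \<omega> + \<omega> $ i * ?e \<omega> * ?e \<omega>) + 2 * (LINT \<omega>|usph. \<omega> $ i * ?o \<omega> * ?e \<omega>)"
    by (rule integral_usph_linear) (intro continuous_intros)+
  also have "(LINT \<omega>|usph. \<omega> $ i * ?o \<omega> * ?o \<omega> + \<omega> $ i * ?e \<omega> * ?e \<omega>)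
     = (LINT \<omega>|usph. \<omega> $ i * ?o \<omega> * ?o \<omega>) + (LINT \<omega>|usph. \<omega> $ i * ?e \<omega> * ?e \<omega>)"
    by (intro Bochner_Integration.integral_add integrable_usph_continuous continuous_intros)
  also have "(LINT \<omega>|usph. \<omega> $ i * ?o \<omega> * ?o \<omega>) = 0"
    by (rule integral_even_odd[OF odd_dir_nth_mult[OF harm_comb_odd] harm_comb_odd]) (intro continuous_intros)
  also have "(LINT \<omega>|usph. \<omega> $ i * ?e \<omega> * ?e \<omega>) = (LINT \<omega>|usph. ?e \<omega> * (\<omega> $ i * ?e \<omega>))"
    by (simp add: mult_ac)
  also have "\<dots> = 0"
    by (rule integral_even_odd[OF harm_comb_even even_dir_nth_mult[OF harm_comb_even]]) (intro continuous_intros)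
  finally show ?thesis by (simp add: A_hat_form[OF uo ue])
qed

lemma PN_energy_bound:
  fixes i :: 3
  assumes N: "N \<ge> 1"
    and dom: "divergence_domain G n" and R: "rotation_choice i R"
    and sc: "scattering_cross_section G \<sigma>s"
    and sol: "PN_solution N \<sigma>s G u0 u" and bc: "PN_boundary_condition N i R G n \<psi>in u"
    and T: "T > 0"
  shows "L2_norm_sq (restrict_space lborel G) (u T)
       \<le> L2_norm_sq (restrict_space lborel G) u0
         + ennreal (spectral_norm (the (mat_inverse (L_mat N i)))) *
           L2_norm_sq (restrict_space lborel {0<..<T} \<Otimes>\<^sub>M boundary_measure G)
             (\<lambda>(t, x). boundary_data N i R n \<psi>in t x)"
proof -
  obtain B where B: "B \<in> carrier_mat (length (odd_idx N i)) (length (odd_idx N i))"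
    "L_mat N i * B = 1\<^sub>m (length (odd_idx N i))" "mat_inverse (L_mat N i) = Some B"
    by (rule L_mat_inverse)
  note solD = sol[unfolded PN_solution_def]
  note carrier = solD[THEN conjunct1] and regular = solD[THEN conjunct2, THEN conjunct1]
    and pde = solD[THEN conjunct2, THEN conjunct2, THEN conjunct1]
    and initial = solD[THEN conjunct2, THEN conjunct2, THEN conjunct2]
  define m where "m = (N + 1)\<^sup>2"
  have len: "length (sph_idx N) = m" by (simp add: m_def length_sph_idx)
  define g where "g t x = boundary_data N i R n \<psi>in t x" for t x
  have gc: "g t x \<in> carrier_vec (length (odd_idx N i))" for t x by (simp add: g_def boundary_data_def)
  have uc: "u t x \<in> carrier_vec m" if "t \<ge> 0" "x \<in> closure G" for t x
    unfolding m_def by (rule carrier[rule_format, OF that])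
  interpret symmetric_hyperbolic G n m "\<lambda>r t x. vec_index (u t x) r" "\<lambda>j r c. A_mat N j $$ (r, c)"
    "\<lambda>t x. scalar_prod (g t x) (g t x)" "spectral_norm B"
  proof
    show "divergence_domain G n" by (rule dom)
    show "A_mat N j $$ (r, c) = A_mat N j $$ (c, r)" if "r < m" "c < m" for j r c
      using that by (simp add: A_mat_index len mult_ac)
    show "continuous_on ({0..} \<times> closure G) (\<lambda>(t, x). vec_index (u t x) r)" if "r < m" for r
      by (rule regular[rule_format, THEN conjunct1, OF that[unfolded m_def]])
    show "C1_up_to ({0<..} \<times> G) ({0<..} \<times> closure G) (\<lambda>(t, x). vec_index (u t x) r)" if "r < m" for r
      by (rule regular[rule_format, THEN conjunct2, OF that[unfolded m_def]])
    show "0 < spectral_norm B" by (rule spectral_norm_L_inverse(2)[OF B(1,2) N])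
  next
    fix t x assume t: "(t :: real) > 0" and x: "x \<in> G"
    have u: "u t x \<in> carrier_vec m" using t by (intro uc subsetD[OF closure_subset x]) simp
    let ?dx = "\<lambda>j. Matrix.vec m (\<lambda>c. deriv (\<lambda>h. vec_index (u t (x + h *\<^sub>R axis j 1)) c) 0)"
    let ?C = "collision_mat N \<sigma>s x"
    have C: "?C \<in> carrier_mat m m" by (rule carrier_matI) (simp_all add: collision_mat_def len)
    have eq: "deriv (\<lambda>s. vec_index (u s x) r) t +
         (\<Sum>j\<in>UNIV. \<Sum>c<m. A_mat N j $$ (r, c) * deriv (\<lambda>h. vec_index (u t (x + h *\<^sub>R axis j 1)) c) 0)
        = vec_index (?C *\<^sub>v u t x) r" if r: "r < m" for r
    proof -
      have "vec_index (A_mat N j *\<^sub>v ?dx j) r = (\<Sum>c<m. A_mat N j $$ (r, c) * deriv (\<lambda>h. vec_index (u t (x + h *\<^sub>R axis j 1)) c) 0)" for j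
        using r A_mat_carrier[of N j] by (auto simp: len scalar_prod_def atLeast0LessThan intro!: sum.cong)
      moreover have "deriv (\<lambda>s. vec_index (u s x) r) t + (\<Sum>j\<in>UNIV. vec_index (A_mat N j *\<^sub>v ?dx j) r) = vec_index (?C *\<^sub>v u t x) r"
        using pde[rule_format, OF t x, of r] r unfolding m_def by simp
      ultimately show ?thesis by simp
    qed
    have "(\<Sum>r<m. vec_index (u t x) r * (deriv (\<lambda>s. vec_index (u s x) r) t +
         (\<Sum>j\<in>UNIV. \<Sum>c<m. A_mat N j $$ (r, c) * deriv (\<lambda>h. vec_index (u t (x + h *\<^sub>R axis j 1)) c) 0)))
       = (\<Sum>r<m. vec_index (u t x) r * vec_index (?C *\<^sub>v u t x) r)"
      by (rule sum.cong) (simp_all add: eq)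
    also have "\<dots> = scalar_prod (u t x) (?C *\<^sub>v u t x)"
      using C by (simp add: scalar_prod_def atLeast0LessThan)
    also have "\<dots> \<le> 0" using collision_mat_form_le[OF sc x] u by (simp add: m_def)
    finally show "(\<Sum>r<m. vec_index (u t x) r * (deriv (\<lambda>s. vec_index (u s x) r) t +
         (\<Sum>j\<in>UNIV. \<Sum>c<m. A_mat N j $$ (r, c) * deriv (\<lambda>h. vec_index (u t (x + h *\<^sub>R axis j 1)) c) 0))) \<le> 0" .
  next
    \<comment> \<open>\<open>rotation_choice\<close> speaks about unit vectors only, so the boundary
      condition is exploited at those boundary points where \<open>n x\<close> has norm 1.\<close>
    have "AE x in boundary_measure G. norm (n x) = 1" using dom by (simp add: divergence_domain_def)
    with bc[unfolded PN_boundary_condition_def]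
    show "AE x in boundary_measure G. \<forall>t>0.
      - (\<Sum>j\<in>UNIV. (\<Sum>r<m. \<Sum>c<m. A_mat N j $$ (r, c) * (vec_index (u t x) r * vec_index (u t x) c)) * n x $ j)
        \<le> spectral_norm B * scalar_prod (g t x) (g t x)"
    proof eventually_elim
      case (elim x)
      have Q: "rotation_matrix (R (n x))" "R (n x) *v n x = axis i 1"
        using R elim(2) by (auto simp: rotation_choice_def)
      show ?case
      proof (intro allI impI)
        fix t :: real assume t: "t > 0"
        from elim(1)[THEN spec, THEN mp, OF t, folded g_def, unfolded length_Ups]
        obtain uo ue where uo: "uo \<in> carrier_vec (length (odd_idx N i))" and ue: "ue \<in> carrier_vec (length (even_idx N i))"
          and rep: "\<And>\<Omega>. \<Omega> \<in> sphere 0 1 \<Longrightarrow> lin_comb (u t x) (Ups N) \<Omega> =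
             lin_comb uo (rotate_fun (R (n x)) (Ups_odd N i)) \<Omega> + lin_comb ue (rotate_fun (R (n x)) (Ups_even N i)) \<Omega>"
          and bd: "uo = (L_mat N i * A_hat N i) *\<^sub>v ue + g t x"
          by (elim exE conjE) (rule that, auto)
        \<comment> \<open>The condition involves \<open>ue\<close> only through \<open>w\<close>:
          the flux is \<open>2 * (uo . w)\<close> and \<open>uo\<close> is \<open>L w + g\<close>,
          so the estimate becomes a statement about one vector of odd length.\<close>
        define w where "w = A_hat N i *\<^sub>v ue"
        have w: "w \<in> carrier_vec (length (odd_idx N i))"
          unfolding w_def using A_hat_carrier ue by (intro mult_mat_vec_carrier)
        have uo': "uo = L_mat N i *\<^sub>v w + g t x"
          unfolding w_def assoc_mult_mat_vec[OF L_mat_carrier A_hat_carrier ue, symmetric] by (rule bd)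
        have "(\<Sum>j\<in>UNIV. (\<Sum>r<m. \<Sum>c<m. A_mat N j $$ (r, c) * (vec_index (u t x) r * vec_index (u t x) c)) * n x $ j)
           = (LINT \<Omega>|usph. (\<Omega> \<bullet> n x) * harm_comb (sph_idx N) (vec_index (u t x)) \<Omega> * harm_comb (sph_idx N) (vec_index (u t x)) \<Omega>)"
          by (rule A_mat_form[where N=N, unfolded len])
        also have "\<dots> = 2 * scalar_prod uo w"
          unfolding w_def by (rule boundary_form[OF Q uo ue]) (use rep in \<open>simp only: lin_comb_Ups\<close>)
        finally show "- (\<Sum>j\<in>UNIV. (\<Sum>r<m. \<Sum>c<m. A_mat N j $$ (r, c) * (vec_index (u t x) r * vec_index (u t x) c)) * n x $ j)
          \<le> spectral_norm B * scalar_prod (g t x) (g t x)"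
          using boundary_square[OF B(1,2) w gc] unfolding uo' by simp
      qed
    qed
  qed
  have E: "scalar_prod (u t x) (u t x) = E t x" if "t \<ge> 0" "x \<in> G" for t x
  proof -
    have "u t x \<in> carrier_vec m" by (intro uc that(1) subsetD[OF closure_subset that(2)])
    thus ?thesis by (simp add: E_def scalar_prod_def atLeast0LessThan power2_eq_square)
  qed
  have "L2_norm_sq (restrict_space lborel G) (u T) = (\<integral>\<^sup>+x. ennreal (E T x) \<partial>restrict_space lborel G)"
    unfolding L2_norm_sq_def using T by (intro nn_integral_cong) (simp add: space_MG E)
  moreover have "L2_norm_sq (restrict_space lborel G) u0 = (\<integral>\<^sup>+x. ennreal (E 0 x) \<partial>restrict_space lborel G)"
    unfolding L2_norm_sq_def
  proof (rule nn_integral_cong)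
    fix x assume "x \<in> space (restrict_space lborel G)"
    hence x: "x \<in> G" by (simp add: space_MG)
    have "u 0 x = u0 x" by (rule initial[rule_format, OF x])
    thus "ennreal (scalar_prod (u0 x) (u0 x)) = ennreal (E 0 x)" using E[of 0 x] x by simp
  qed
  moreover have "L2_norm_sq (restrict_space lborel {0<..<T} \<Otimes>\<^sub>M boundary_measure G) (\<lambda>(t, x). boundary_data N i R n \<psi>in t x)
     = (\<integral>\<^sup>+z. ennreal (scalar_prod (g (fst z) (snd z)) (g (fst z) (snd z))) \<partial>(restrict_space lborel {0<..<T} \<Otimes>\<^sub>M boundary_measure G))"
    unfolding L2_norm_sq_def g_def by (simp only: case_prod_unfold)
  ultimately show ?thesis using energy_bound[OF T] by (simp only: B(3) option.sel)
qed

theorem mainTheorem4: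
  fixes N :: nat and i :: 3
  assumes "N \<ge> 1"
  shows
    "(mset (odd_idx N i @ even_idx N i) = mset (sph_idx N) \<and>
      moment_mat (sphere 0 1) (omega_times i (Ups_odd N i @ Ups_even N i)) (Ups_odd N i @ Ups_even N i)
        = four_block_mat
            (0\<^sub>m (length (Ups_odd N i)) (length (Ups_odd N i))) (A_hat N i)
            (transpose_mat (A_hat N i)) (0\<^sub>m (length (Ups_even N i)) (length (Ups_even N i))) \<and>
      vec_space.rank (dim_row (A_hat N i)) (A_hat N i) = dim_row (A_hat N i))
    \<and>
     ((\<forall>f\<in>set (Ups_odd N i). \<forall>h\<in>set (Ups_odd N i).
         set_integrable sphere_measure (half_sphere i) (\<lambda>\<Omega>. 1 / \<Omega> $ i * f \<Omega> * h \<Omega>)) \<and>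
      transpose_mat (L_mat N i) = L_mat N i \<and>
      pos_def_mat (L_mat N i) \<and>
      invertible_mat (L_mat N i) \<and>
      (\<forall>c<length (even_idx N i).
         col (L_mat N i * A_hat N i) c \<noteq> col (M_tilde N i) c \<longrightarrow> fst (even_idx N i ! c) = N))
    \<and>
     (\<forall>(G :: (real ^ 3) set) (n :: real ^ 3 \<Rightarrow> real ^ 3) (R :: real ^ 3 \<Rightarrow> real ^ 3 ^ 3)
        (\<sigma>s :: real ^ 3 \<Rightarrow> real \<Rightarrow> real) (\<psi>in :: real \<Rightarrow> real ^ 3 \<Rightarrow> real ^ 3 \<Rightarrow> real)
        (u0 :: real ^ 3 \<Rightarrow> real Matrix.vec) (u :: real \<Rightarrow> real ^ 3 \<Rightarrow> real Matrix.vec).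
        divergence_domain G n \<longrightarrow>
        rotation_choice i R \<longrightarrow>
        scattering_cross_section G \<sigma>s \<longrightarrow>
        incoming_distribution G n \<psi>in \<longrightarrow>
        PN_solution N \<sigma>s G u0 u \<longrightarrow>
        PN_boundary_condition N i R G n \<psi>in u \<longrightarrow>
        (\<forall>T>0.
           L2_norm_sq (restrict_space lborel G) (u T)
           \<le> L2_norm_sq (restrict_space lborel G) u0
             + ennreal (spectral_norm (the (mat_inverse (L_mat N i)))) *
               L2_norm_sq (restrict_space lborel {0<..<T} \<Otimes>\<^sub>M boundary_measure G)
                 (\<lambda>(t, x). boundary_data N i R n \<psi>in t x)))"
  by (intro conjI allI impI ballI mset_odd_even_idx block_form A_hat_rank L_mat_integrable L_mat_sym
      L_mat_pos_def L_mat_invertible PN_energy_bound[OF assms])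
    (use L_A_hat_column in blast)+

end
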